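(* Let $F\subset\mathrm{Sym}^2(\mathbb{R}^n)$ be a cone subequation such that $-P_e\notin F$ for every unit vector $e$. Let $\Omega\subset\mathbb{R}^n$ be a bounded domain with smooth strictly $F$-convex boundary, and $\Sigma\subset\Omega$ a compact subset. Suppose there is a continuous $h:\overline\Omega\to[-\infty,\infty)$ with $\Sigma=h^{-1}(-\infty)$ and $h$ $F$-harmonic on $\Omega\setminus\Sigma$. Then for every $\varphi\in C(\partial\Omega)$: (Existence) there exists $H\in C(\overline\Omega\setminus\Sigma)$ which is $F$-harmonic on $\Omega\setminus\Sigma$, satisfies $H|_{\partial\Omega}=\varphi$, and for which there are constants $c,C\in\mathbb{R}$ with $h+c\le H\le h+C$ on $\Omega\setminus\Sigma$; (Uniqueness) there is at most one $H\in C(\overline\Omega\setminus\Sigma)$ with these three properties, and this uniqueness holds without assuming strict $F$-convexity of $\partial\Omega$.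
   Context: A cone subequation is a closed $F\subset\mathrm{Sym}^2(\mathbb{R}^n)$ with $A\in F,P\ge0\Rightarrow A+P\in F$ and $tF=F$ for $t>0$; $\tilde F=\{A:-A\notin\mathrm{Int}F\}$; $P_e$ is orthogonal projection onto $\mathbb{R}e$. $F$-subharmonic: upper semicontinuous $[-\infty,\infty)$-valued $u$ with $D^2\phi(y)\in F$ for every $C^2$ test function $\phi$ at $y$ ($u\le\phi$ near $y$, equality at $y$); $F$-harmonic: finite, continuous, $F$-subharmonic with $-u$ $\tilde F$-subharmonic. Smooth boundary strictly $F$-convex: for each $x\in\partial\Omega$ and local defining function $\rho$, $D^2\rho(x)+tP_\nu\in\mathrm{Int}F$ for all large $t$, $\nu$ the unit normal. *)

theory Defs
  imports "HOL-Analysis.Analysis" "HOL-Library.Extended_Real"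
begin

definition Sym :: "(real^'n^'n) set" where
  "Sym = {A. transpose A = A}"

definition psd :: "real^'n^'n \<Rightarrow> bool" where
  "psd P \<longleftrightarrow> P \<in> Sym \<and> (\<forall>v. 0 \<le> v \<bullet> (P *v v))"

text \<open>Orthogonal projection onto the line R e (for a unit vector e).\<close>
definition proj_line :: "real^'n \<Rightarrow> real^'n^'n" where
  "proj_line e = (\<chi> i j. e $ i * e $ j)"

definition cone_subequation :: "(real^'n^'n) set \<Rightarrow> bool" where
  "cone_subequation F \<longleftrightarrow> F \<subseteq> Sym \<and> closed F
     \<and> (\<forall>A\<in>F. \<forall>P. psd P \<longrightarrow> A + P \<in> F)
     \<and> (\<forall>t>0. (\<lambda>A. t *\<^sub>R A) ` F = F)"

definition IntF :: "(real^'n^'n) set \<Rightarrow> (real^'n^'n) set" where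
  "IntF F = {A \<in> F. \<exists>e>0. \<forall>B\<in>Sym. dist B A < e \<longrightarrow> B \<in> F}"

definition dual :: "(real^'n^'n) set \<Rightarrow> (real^'n^'n) set" where
  "dual F = {A \<in> Sym. - A \<notin> IntF F}"

fun Ck_on :: "nat \<Rightarrow> 'a::euclidean_space set \<Rightarrow> ('a \<Rightarrow> real) \<Rightarrow> bool" where
  "Ck_on 0 U f = continuous_on U f"
| "Ck_on (Suc k) U f = (\<exists>D. (\<forall>x\<in>U. (f has_derivative D x) (at x))
                           \<and> (\<forall>v. Ck_on k U (\<lambda>x. D x v)))"

definition smooth_on :: "'a::euclidean_space set \<Rightarrow> ('a \<Rightarrow> real) \<Rightarrow> bool" where
  "smooth_on U f \<longleftrightarrow> (\<forall>k. Ck_on k U f)"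

definition grad_at :: "(real^'n \<Rightarrow> real) \<Rightarrow> real^'n \<Rightarrow> real^'n" where
  "grad_at f x = (\<chi> i. frechet_derivative f (at x) (axis i 1))"

definition hess_at :: "(real^'n \<Rightarrow> real) \<Rightarrow> real^'n \<Rightarrow> real^'n^'n" where
  "hess_at f x = (\<chi> i j. frechet_derivative
       (\<lambda>z. frechet_derivative f (at z) (axis j 1)) (at x) (axis i 1))"

definition usc_on :: "'a::topological_space set \<Rightarrow> ('a \<Rightarrow> ereal) \<Rightarrow> bool" where
  "usc_on X u \<longleftrightarrow> (\<forall>x\<in>X. \<forall>c. u x < c \<longrightarrow> (\<forall>\<^sub>F y in at x within X. u y < c))"

text \<open>Viscosity F-subharmonicity on an open set X, values in [-\<infinity>,\<infinity>).\<close>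
definition F_subharmonic ::
  "(real^'n^'n) set \<Rightarrow> (real^'n) set \<Rightarrow> (real^'n \<Rightarrow> ereal) \<Rightarrow> bool" where
  "F_subharmonic F X u \<longleftrightarrow>
     (\<forall>x\<in>X. u x \<noteq> \<infinity>) \<and> usc_on X u \<and>
     (\<forall>y\<in>X. \<forall>\<phi>::real^'n \<Rightarrow> real.
        (\<exists>U. open U \<and> y \<in> U \<and> Ck_on 2 U \<phi> \<and> (\<forall>z\<in>U \<inter> X. u z \<le> ereal (\<phi> z)))
        \<and> u y = ereal (\<phi> y) \<longrightarrow> hess_at \<phi> y \<in> F)"

definition F_harmonic ::
  "(real^'n^'n) set \<Rightarrow> (real^'n) set \<Rightarrow> (real^'n \<Rightarrow> real) \<Rightarrow> bool" where
  "F_harmonic F X u \<longleftrightarrow> continuous_on X u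
     \<and> F_subharmonic F X (\<lambda>x. ereal (u x))
     \<and> F_subharmonic (dual F) X (\<lambda>x. ereal (- u x))"

definition local_defining_function ::
  "(real^'n) set \<Rightarrow> real^'n \<Rightarrow> (real^'n) set \<Rightarrow> (real^'n \<Rightarrow> real) \<Rightarrow> bool" where
  "local_defining_function \<Omega> x U \<rho> \<longleftrightarrow> open U \<and> x \<in> U \<and> smooth_on U \<rho>
     \<and> \<Omega> \<inter> U = {y \<in> U. \<rho> y < 0} \<and> (\<forall>y\<in>U. grad_at \<rho> y \<noteq> 0)"

definition smooth_boundary :: "(real^'n) set \<Rightarrow> bool" where
  "smooth_boundary \<Omega> \<longleftrightarrow> (\<forall>x\<in>frontier \<Omega>. \<exists>U \<rho>. local_defining_function \<Omega> x U \<rho>)"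

definition strictly_F_convex_boundary :: "(real^'n^'n) set \<Rightarrow> (real^'n) set \<Rightarrow> bool" where
  "strictly_F_convex_boundary F \<Omega> \<longleftrightarrow> smooth_boundary \<Omega> \<and>
     (\<forall>x\<in>frontier \<Omega>. \<forall>U \<rho>. local_defining_function \<Omega> x U \<rho> \<longrightarrow>
        (\<exists>T. \<forall>t\<ge>T. hess_at \<rho> x
              + t *\<^sub>R proj_line ((1 / norm (grad_at \<rho> x)) *\<^sub>R grad_at \<rho> x) \<in> IntF F))"

definition DP_solution ::
  "(real^'n^'n) set \<Rightarrow> (real^'n) set \<Rightarrow> (real^'n) set \<Rightarrow> (real^'n \<Rightarrow> ereal)
     \<Rightarrow> (real^'n \<Rightarrow> real) \<Rightarrow> (real^'n \<Rightarrow> real) \<Rightarrow> bool" where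
  "DP_solution F \<Omega> \<Sigma> h \<phi> H \<longleftrightarrow>
     continuous_on (closure \<Omega> - \<Sigma>) H
     \<and> F_harmonic F (\<Omega> - \<Sigma>) H
     \<and> (\<forall>x\<in>frontier \<Omega>. H x = \<phi> x)
     \<and> (\<exists>c C::real. \<forall>x\<in>\<Omega> - \<Sigma>. h x + ereal c \<le> ereal (H x) \<and> ereal (H x) \<le> h x + ereal C)"

end

theory Submission
  imports Defs "HOL-Complex_Analysis.Great_Picard"
begin

text \<open>
  Uniqueness and existence both rest on comparison: if u is F-subharmonic and v is subharmonic for the
  dual, then u + v obeys the maximum principle. After sup-convolution both functions are semiconvex.
  At maximum points of linear perturbations of u + v + \<eta>|x|^2 they are C^{1,1}, and these points form a
  set of positive measure because their slopes fill a ball. Blowing up where this set is almost full gives a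
  pair of functions on the whole space that are C^{1,1} at every point. Instead of invoking Alexandrov's or
  Rademacher's theorem, we choose among all such blow-ups, normalised to vanish to first order at 0, one whose
  value at each coordinate vector in turn is maximal. In an extremal direction the function is forced to be
  quadratic, so in the end u is a quadratic polynomial with matrix A in F while -A - \<eta> I lies in the dual, which is absurd.

  Near the singular set only boundedness of u + v is known. Since F is a cone, v may be replaced by
  (1 - \<epsilon>) v, and then u + (1 - \<epsilon>) v tends to -\<infinity> there. The solution itself is the Perron supremum
  between g + c and g + C, where g is the finite part of h. Strict convexity gives lower barriers, and
  -P_e \<notin> F gives upper barriers because it puts P_e in the interior of the dual.
\<close>

section \<open>Locally uniform limits\<close>

text \<open>At a maximum of u + v a paraboloid touching one function need not touch the other, so
  the two viscosity conditions cannot be tested jointly there. Semiconvexity couples them: each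
  function has a supporting paraboloid from below, the maximum bounds the sum from above, and
  subtracting one bound from the other traps both functions between paraboloids. Such a point
  carries slopes but not yet second derivatives. These come from extremality: the blow-ups with
  fixed constants C and \<eta> are closed under further blow-up at any point and under locally
  uniform limits, so a value that is maximal in the family bounds the increments of every member, at
  every point, at all scales and in both orientations of that direction. Equality along one line
  then leaves no freedom. All conditions are scale invariant because a blow-up divides by the square
  of the scale; this is why \<eta> survives as the gap between the two matrices. Up to that point F
  and F' are arbitrary sets; monotonicity, closedness and duality enter only when the pair of
  matrices is refuted.\<close>

definition quad_poly :: "real^'n^'n \<Rightarrow> (real^'n \<Rightarrow> real) \<Rightarrow> bool" where
  "quad_poly A q \<longleftrightarrow> (\<exists>c p. \<forall>z. q z = c + p \<bullet> z + (z \<bullet> (A *v z)) / 2)"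

text \<open>The viscosity inequality at a finite scale: the strict inequality on a sphere is an open condition, so
  it passes to locally uniform limits.\<close>
definition touch_sphere :: "(real^'n^'n) set \<Rightarrow> (real^'n) set \<Rightarrow> (real^'n \<Rightarrow> real) \<Rightarrow> bool" where
  "touch_sphere F S u \<longleftrightarrow> (\<forall>A\<in>Sym. \<forall>q y r x. quad_poly A q \<longrightarrow> cball y r \<subseteq> S \<longrightarrow> x \<in> ball y r \<longrightarrow>
     (\<forall>z\<in>sphere y r. u z - q z < u x - q x) \<longrightarrow> A \<in> F)"

text \<open>If such a slope exists at every x of S, then adding C |z|^2 to u gives a function with
  affine supports: semiconvexity in a form that needs no derivatives, rescales well and passes to
  limits.\<close>

definition paraboloid_below ::
  "real \<Rightarrow> 'a::real_inner set \<Rightarrow> ('a \<Rightarrow> real) \<Rightarrow> 'a \<Rightarrow> 'a \<Rightarrow> bool" where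
  "paraboloid_below C S u x a \<longleftrightarrow> (\<forall>z\<in>S. u x + a \<bullet> (z - x) - C * (norm (z - x))\<^sup>2 \<le> u z)"

text \<open>The first two clauses give each function a slope with quadratic error at x; the third is
  what remains of the maximum of the perturbed sum, with \<eta> as strict concavity.\<close>

definition contact_at ::
  "real \<Rightarrow> real \<Rightarrow> 'a::real_inner set \<Rightarrow> ('a \<Rightarrow> real) \<Rightarrow> ('a \<Rightarrow> real) \<Rightarrow> 'a \<Rightarrow> 'a \<Rightarrow> 'a \<Rightarrow> bool" where
  "contact_at C \<eta> S u v x a b \<longleftrightarrow> (\<forall>z\<in>S.
      \<bar>u z - u x - a \<bullet> (z - x)\<bar> \<le> C * (norm (z - x))\<^sup>2
    \<and> \<bar>v z - v x - b \<bullet> (z - x)\<bar> \<le> C * (norm (z - x))\<^sup>2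
    \<and> u z + v z - u x - v x - (a + b) \<bullet> (z - x) \<le> - \<eta> * (norm (z - x))\<^sup>2)"

text \<open>A unit step from x in the direction of a raises the lower paraboloid by |a| - C, and the
  growth bound on u at both ends limits how far it may rise.\<close>

lemma paraboloid_below_slope:
  fixes u :: "'a::real_inner \<Rightarrow> real"
  assumes "paraboloid_below C (cball 0 r) u x a" and "norm x \<le> \<rho>" and "\<rho> + 1 \<le> r" and "0 \<le> C"
    and g: "\<And>z. norm z \<le> r \<Longrightarrow> \<bar>u z\<bar> \<le> C * (norm z)\<^sup>2"
  shows "norm a \<le> 2 * C * (\<rho> + 1)\<^sup>2 + C"
proof -
  define z where "z = x + sgn a"
  have \<rho>: "\<rho> \<ge> 0" using assms(2) norm_ge_zero[of x] by linarith
  have nz: "norm z \<le> \<rho> + 1"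
    unfolding z_def using norm_triangle_ineq[of x "sgn a"] assms(2) norm_sgn[of a]
    by (auto split: if_splits)
  have b: "u x + a \<bullet> (z - x) - C * (norm (z - x))\<^sup>2 \<le> u z"
    using assms(1,3) nz unfolding paraboloid_below_def by auto
  have "a \<bullet> sgn a = norm a"
    by (cases "a = 0") (simp_all add: sgn_div_norm power2_eq_square dot_square_norm)
  moreover have "C * (norm (sgn a))\<^sup>2 \<le> C" using assms(4) by (simp add: norm_sgn)
  moreover have "\<bar>u z\<bar> \<le> C * (\<rho> + 1)\<^sup>2"
  proof -
    have "\<bar>u z\<bar> \<le> C * (norm z)\<^sup>2" using g nz assms(3) by auto
    also have "\<dots> \<le> C * (\<rho> + 1)\<^sup>2" using nz assms(4) by (intro mult_left_mono power_mono) auto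
    finally show ?thesis .
  qed
  moreover have "\<bar>u x\<bar> \<le> C * (\<rho> + 1)\<^sup>2"
  proof -
    have "\<bar>u x\<bar> \<le> C * (norm x)\<^sup>2" using g assms(2,3) by auto
    also have "\<dots> \<le> C * (\<rho> + 1)\<^sup>2" using assms(2,4) \<rho> by (intro mult_left_mono power_mono) auto
    finally show ?thesis .
  qed
  ultimately show ?thesis using b unfolding z_def by simp
qed

text \<open>The supporting paraboloid at x bounds u x - u z; then x and z are exchanged. The last
  summand of the constant absorbs the quadratic term, since |z - x| is at most 2 * \<rho>.\<close>

lemma paraboloid_below_lipschitz:
  fixes u :: "'a::real_inner \<Rightarrow> real"
  assumes pb: "\<And>x. norm x \<le> r \<Longrightarrow> \<exists>a. paraboloid_below C (cball 0 r) u x a"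
    and "norm x \<le> \<rho>" and "norm z \<le> \<rho>" and "\<rho> + 1 \<le> r" and "0 \<le> C"
    and g: "\<And>z. norm z \<le> r \<Longrightarrow> \<bar>u z\<bar> \<le> C * (norm z)\<^sup>2"
  shows "\<bar>u x - u z\<bar> \<le> (2 * C * (\<rho> + 1)\<^sup>2 + C + 2 * C * \<rho>) * norm (x - z)"
proof -
  have *: "u x - u z \<le> (2 * C * (\<rho> + 1)\<^sup>2 + C + 2 * C * \<rho>) * norm (x - z)"
    if x: "norm x \<le> \<rho>" and z: "norm z \<le> \<rho>" for x z
  proof -
    obtain a where a: "paraboloid_below C (cball 0 r) u x a"
      using pb[of x] x assms(4) by fastforce
    have na: "norm a \<le> 2 * C * (\<rho> + 1)\<^sup>2 + C"
      by (rule paraboloid_below_slope[OF a x assms(4,5) g])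
    have "u x + a \<bullet> (z - x) - C * (norm (z - x))\<^sup>2 \<le> u z"
      using a z assms(4) unfolding paraboloid_below_def by auto
    moreover have "- (a \<bullet> (z - x)) \<le> norm a * norm (z - x)"
      using Cauchy_Schwarz_ineq2[of a "z - x"] by linarith
    moreover have "norm a * norm (z - x) \<le> (2 * C * (\<rho> + 1)\<^sup>2 + C) * norm (z - x)"
      by (intro mult_right_mono na) auto
    moreover have "C * (norm (z - x))\<^sup>2 \<le> 2 * C * \<rho> * norm (z - x)"
    proof -
      have "norm (z - x) \<le> 2 * \<rho>" using norm_triangle_ineq4[of z x] x z by linarith
      then have "norm (z - x) * (C * norm (z - x)) \<le> (2 * \<rho>) * (C * norm (z - x))"
        using assms(5) by (intro mult_right_mono) auto
      then show ?thesis by (simp add: power2_eq_square algebra_simps)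
    qed
    ultimately show ?thesis by (simp add: algebra_simps norm_minus_commute)
  qed
  show ?thesis using *[OF assms(2,3)] *[OF assms(3,2)] by (simp add: abs_le_iff norm_minus_commute)
qed

text \<open>Locally uniform convergence in the form in which it is used: pointwise limits plus one
  Lipschitz constant per ball. The constant holds only eventually, because the k-th function will be
  controlled only on a ball growing with k.\<close>

definition equi_lim :: "(nat \<Rightarrow> 'a::real_normed_vector \<Rightarrow> real) \<Rightarrow> ('a \<Rightarrow> real) \<Rightarrow> bool" where
  "equi_lim f g \<longleftrightarrow> (\<forall>z. (\<lambda>k. f k z) \<longlonglongrightarrow> g z) \<and>
     (\<forall>\<rho>. \<exists>L. \<forall>\<^sub>F k in sequentially. \<forall>x\<in>cball 0 \<rho>. \<forall>z\<in>cball 0 \<rho>. \<bar>f k x - f k z\<bar> \<le> L * norm (x - z))"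

lemma equi_lim_subseq:
  assumes "equi_lim f g" "strict_mono s"
  shows "equi_lim (\<lambda>k. f (s k)) g"
  unfolding equi_lim_def
proof (intro conjI allI)
  show "(\<lambda>k. f (s k) z) \<longlonglongrightarrow> g z" for z
    using LIMSEQ_subseq_LIMSEQ[of "\<lambda>k. f k z", OF _ assms(2)] assms(1)
    by (auto simp: equi_lim_def o_def)
  show "\<exists>L. \<forall>\<^sub>F k in sequentially. \<forall>x\<in>cball 0 \<rho>. \<forall>z\<in>cball 0 \<rho>. \<bar>f (s k) x - f (s k) z\<bar> \<le> L * norm (x - z)" for \<rho>
  proof -
    obtain L where "\<forall>\<^sub>F k in sequentially. \<forall>x\<in>cball 0 \<rho>. \<forall>z\<in>cball 0 \<rho>. \<bar>f k x - f k z\<bar> \<le> L * norm (x - z)"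
      using assms(1) unfolding equi_lim_def by blast
    from eventually_subseq[OF assms(2) this] show ?thesis by blast
  qed
qed

lemma equi_lim_diagonal:
  assumes "equi_lim f g" "xs \<longlonglongrightarrow> x"
  shows "(\<lambda>k. f k (xs k)) \<longlonglongrightarrow> g x"
proof -
  obtain L where L: "\<forall>\<^sub>F k in sequentially. \<forall>y\<in>cball 0 (norm x + 1). \<forall>z\<in>cball 0 (norm x + 1). \<bar>f k y - f k z\<bar> \<le> L * norm (y - z)"
    using assms(1) unfolding equi_lim_def by blast
  have "\<forall>\<^sub>F k in sequentially. dist (xs k) x < 1" using assms(2) tendstoD by fastforce
  then have "\<forall>\<^sub>F k in sequentially. norm (f k (xs k) - f k x) \<le> L * norm (xs k - x)"
    using L
  proof eventually_elim
    case (elim k)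
    have "norm (xs k) \<le> norm x + 1"
      using elim(1) norm_triangle_ineq2[of "xs k" x] by (simp add: dist_norm)
    then show ?case using elim(2) by auto
  qed
  moreover have "(\<lambda>k. L * norm (xs k - x)) \<longlonglongrightarrow> 0"
    using assms(2) by (auto intro!: tendsto_eq_intros simp: LIM_zero_iff tendsto_norm_zero)
  ultimately have "(\<lambda>k. f k (xs k) - f k x) \<longlonglongrightarrow> 0"
    by (rule Lim_null_comparison)
  moreover have "(\<lambda>k. f k x) \<longlonglongrightarrow> g x" using assms(1) unfolding equi_lim_def by blast
  ultimately have "(\<lambda>k. (f k (xs k) - f k x) + f k x) \<longlonglongrightarrow> 0 + g x" by (rule tendsto_add)
  then show ?thesis by simp
qed

text \<open>The Arzela-Ascoli argument: convergence on a countable dense set by a diagonal sequence,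
  then everywhere by the local Lipschitz constants.\<close>

lemma equi_lim_exists:
  fixes f :: "nat \<Rightarrow> 'a::euclidean_space \<Rightarrow> real"
  assumes C: "0 \<le> C"
    and g: "\<And>k z. norm z \<le> real k \<Longrightarrow> \<bar>f k z\<bar> \<le> C * (norm z)\<^sup>2"
    and pb: "\<And>k x. norm x \<le> real k \<Longrightarrow> \<exists>a. paraboloid_below C (cball 0 (real k)) (f k) x a"
  obtains s h where "strict_mono s" "equi_lim (\<lambda>k. f (s k)) h"
proof -
  define K where "K \<rho> = (2 * C * (\<rho> + 1)\<^sup>2 + C + 2 * C * \<rho>)" for \<rho>
  have lip: "\<bar>f k x - f k z\<bar> \<le> K \<rho> * norm (x - z)"
    if "norm x \<le> \<rho>" "norm z \<le> \<rho>" "\<rho> + 1 \<le> real k" for k x z \<rho>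
    unfolding K_def by (rule paraboloid_below_lipschitz[OF pb that C g])
  obtain D :: "'a set" where D: "countable D" "\<And>X. open X \<Longrightarrow> X \<noteq> {} \<Longrightarrow> \<exists>d\<in>D. d \<in> X"
    using countable_dense_setE by blast
  \<comment> \<open>Cutting off outside the n-th ball and dividing by 1 + |x|^2 makes the whole
    sequence bounded by C at all points, as the diagonal argument requires; the weight is undone
    afterwards.\<close>
  define \<phi> where "\<phi> n x = (if norm x \<le> real n then f n x / (1 + (norm x)\<^sup>2) else 0)" for n x
  have \<phi>: "norm (\<phi> n x) \<le> C" for n x
  proof (cases "norm x \<le> real n")
    case True
    have p: "1 + (norm x)\<^sup>2 > 0" by (simp add: add_pos_nonneg)
    have "\<bar>f n x\<bar> \<le> C * (1 + (norm x)\<^sup>2)" using g[OF True] C by (simp add: algebra_simps)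
    then show ?thesis using True p by (simp add: \<phi>_def divide_le_eq)
  qed (use C in \<open>simp add: \<phi>_def\<close>)
  obtain s where s: "strict_mono (s::nat\<Rightarrow>nat)" "\<And>x. x \<in> D \<Longrightarrow> \<exists>l. (\<lambda>n. \<phi> (s n) x) \<longlonglongrightarrow> l"
    using function_convergent_subsequence[OF D(1), of \<phi> C] \<phi> by blast
  have big: "\<forall>\<^sub>F k in sequentially. \<rho> \<le> real (s k)" for \<rho>
  proof -
    have "filterlim (\<lambda>k. real (s k)) at_top sequentially"
      using filterlim_compose[OF filterlim_real_sequentially filterlim_subseq[OF s(1)]] .
    then show ?thesis unfolding filterlim_at_top by blast
  qed
  have D': "Cauchy (\<lambda>n. f (s n) d)" if d: "d \<in> D" for d
  proof -
    obtain l where l: "(\<lambda>n. \<phi> (s n) d) \<longlonglongrightarrow> l" using s(2)[OF d] by blast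
    have "1 + (norm d)\<^sup>2 \<noteq> 0" by (metis add_pos_nonneg zero_le_power2 zero_less_one less_irrefl)
    then have "\<forall>\<^sub>F n in sequentially. \<phi> (s n) d * (1 + (norm d)\<^sup>2) = f (s n) d"
      using \<open>1 + (norm d)\<^sup>2 \<noteq> 0\<close> by (intro eventually_mono[OF big[of "norm d"]]) (simp add: \<phi>_def)
    moreover have "(\<lambda>n. \<phi> (s n) d * (1 + (norm d)\<^sup>2)) \<longlonglongrightarrow> l * (1 + (norm d)\<^sup>2)"
      by (intro tendsto_mult l tendsto_const)
    ultimately have "(\<lambda>n. f (s n) d) \<longlonglongrightarrow> l * (1 + (norm d)\<^sup>2)"
      by (rule Lim_transform_eventually[rotated])
    then show ?thesis by (rule LIMSEQ_imp_Cauchy)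
  qed
  have "Cauchy (\<lambda>n. f (s n) z)" for z
  proof (rule metric_CauchyI)
    fix e :: real assume e: "e > 0"
    define \<rho> where "\<rho> = norm z + 1"
    have K: "K \<rho> \<ge> 0" unfolding K_def \<rho>_def using C by simp
    obtain d where d: "d \<in> D" "d \<in> ball z (min 1 (e / (3 * (K \<rho> + 1))))"
    proof -
      have "min 1 (e / (3 * (K \<rho> + 1))) > 0" using e K by simp
      then have "ball z (min 1 (e / (3 * (K \<rho> + 1)))) \<noteq> {}" by (simp only: ball_eq_empty not_le)
      then show thesis using D(2)[OF open_ball] that by blast
    qed
    have dz: "norm (z - d) < 1" "norm (z - d) < e / (3 * (K \<rho> + 1))"
      using d(2) by (auto simp: dist_norm)
    have nd: "norm d \<le> \<rho>" using norm_triangle_ineq2[of d z] dz(1) unfolding \<rho>_def by (simp add: norm_minus_commute)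
    have "K \<rho> * norm (z - d) \<le> (K \<rho> + 1) * norm (z - d)" by (simp add: mult_right_mono)
    also have "\<dots> < (K \<rho> + 1) * (e / (3 * (K \<rho> + 1)))"
      using dz(2) K by (intro mult_strict_left_mono) auto
    also have "\<dots> = e / 3" using K by (simp add: field_simps)
    finally have sm: "K \<rho> * norm (z - d) < e / 3" .
    obtain N1 where N1: "\<And>n. n \<ge> N1 \<Longrightarrow> \<rho> + 1 \<le> real (s n)"
      using big[of "\<rho> + 1"] unfolding eventually_sequentially by blast
    obtain N2 where N2: "\<And>m n. m \<ge> N2 \<Longrightarrow> n \<ge> N2 \<Longrightarrow> dist (f (s m) d) (f (s n) d) < e / 3"
      using metric_CauchyD[OF D'[OF d(1)], of "e/3"] e by auto
    show "\<exists>M. \<forall>m\<ge>M. \<forall>n\<ge>M. dist (f (s m) z) (f (s n) z) < e"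
    proof (intro exI allI impI)
      fix m n assume mn: "m \<ge> max N1 N2" "n \<ge> max N1 N2"
      have "\<bar>f (s m) z - f (s m) d\<bar> \<le> K \<rho> * norm (z - d)" "\<bar>f (s n) z - f (s n) d\<bar> \<le> K \<rho> * norm (z - d)"
        using lip[OF _ nd N1, of z] mn unfolding \<rho>_def by auto
      then show "dist (f (s m) z) (f (s n) z) < e"
        using N2[of m n] mn sm unfolding dist_real_def by linarith
    qed
  qed
  then have "\<exists>l. (\<lambda>n. f (s n) z) \<longlonglongrightarrow> l" for z using real_Cauchy_convergent[of "\<lambda>n. f (s n) z"] unfolding convergent_def by blast
  then obtain h where h: "\<And>z. (\<lambda>n. f (s n) z) \<longlonglongrightarrow> h z" by metis
  have "equi_lim (\<lambda>k. f (s k)) h"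
    unfolding equi_lim_def
  proof (intro conjI allI)
    fix \<rho> :: real
    show "\<exists>L. \<forall>\<^sub>F k in sequentially. \<forall>x\<in>cball 0 \<rho>. \<forall>z\<in>cball 0 \<rho>. \<bar>f (s k) x - f (s k) z\<bar> \<le> L * norm (x - z)"
      by (rule exI[of _ "K \<rho>"], rule eventually_mono[OF big[of "\<rho> + 1"]]) (auto intro: lip)
  qed (use h in auto)
  with s(1) show thesis by (rule that)
qed

lemma quad_poly_continuous: "quad_poly A q \<Longrightarrow> continuous_on S q"
  unfolding quad_poly_def
  by (auto intro!: continuous_intros matrix_vector_mul_bounded_linear[THEN linear_continuous_on] cong: continuous_on_cong)

text \<open>If A were not in F, each late function would have a point on the sphere doing at least
  as well as x; by compactness a limit of such points contradicts the strict inequality for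
  g.\<close>

lemma touch_sphere_lim:
  fixes f :: "nat \<Rightarrow> real^'n \<Rightarrow> real"
  assumes l: "equi_lim f g" and big: "\<And>\<rho>. \<forall>\<^sub>F k in sequentially. cball 0 \<rho> \<subseteq> S k"
    and t: "\<And>k. touch_sphere F (S k) (f k)"
  shows "touch_sphere F UNIV g"
  unfolding touch_sphere_def
proof (intro ballI allI impI)
  fix A :: "real^'n^'n" and q y r x
  assume A: "A \<in> Sym" and q: "quad_poly A q" and x: "x \<in> ball y r" 
    and lt: "\<forall>z\<in>sphere y r. g z - q z < g x - q x"
  show "A \<in> F"
  proof (rule ccontr)
    assume nA: "A \<notin> F"
    have "cball y r \<subseteq> cball 0 (norm y + r)"
      by (auto simp: dist_norm) (metis add_left_mono norm_minus_commute norm_triangle_sub order_trans)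
    then have "\<forall>\<^sub>F k in sequentially. cball y r \<subseteq> S k"
      using big[of "norm y + r"] by (elim eventually_mono) auto
    then obtain N where N: "\<And>k. k \<ge> N \<Longrightarrow> cball y r \<subseteq> S k"
      unfolding eventually_sequentially by blast
    have "\<exists>z. z \<in> sphere y r \<and> \<not> (f (k + N) z - q z < f (k + N) x - q x)" for k
      using t[of "k + N"] nA A q x N[of "k + N"] unfolding touch_sphere_def by force
    then obtain zs where zs: "\<And>k. zs k \<in> sphere y r" "\<And>k. f (k + N) x - q x \<le> f (k + N) (zs k) - q (zs k)"
      by (metis not_less)
    obtain z s where z: "z \<in> sphere y r" "strict_mono s" "(zs \<circ> s) \<longlonglongrightarrow> z"
      using compact_sphere[of y r] zs(1) unfolding compact_def by metis
    have s': "strict_mono (\<lambda>k. s k + N)" using z(2) unfolding strict_mono_def by simp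
    note l' = equi_lim_subseq[OF l s']
    have "(\<lambda>k. f (s k + N) (zs (s k))) \<longlonglongrightarrow> g z"
      using equi_lim_diagonal[OF l'] z(3) by (simp add: o_def)
    moreover have "(\<lambda>k. q (zs (s k))) \<longlonglongrightarrow> q z"
      using quad_poly_continuous[OF q, of UNIV] z(3) unfolding continuous_on_sequentially by (simp add: o_def)
    ultimately have "(\<lambda>k. f (s k + N) (zs (s k)) - q (zs (s k))) \<longlonglongrightarrow> g z - q z"
      by (rule tendsto_diff)
    moreover have "(\<lambda>k. f (s k + N) x - q x) \<longlonglongrightarrow> g x - q x"
      using l' unfolding equi_lim_def by (intro tendsto_diff) auto
    ultimately have "g x - q x \<le> g z - q z"
      using zs(2) by (intro LIMSEQ_le) auto
    then show False using lt z(1) by fastforce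
  qed
qed

section \<open>Blow-up families\<close>

text \<open>The second-order blow-up at x with slope a. Negative t is allowed and later yields the
  extremal inequality in the direction opposite to e.\<close>

definition rescale :: "real \<Rightarrow> 'a::real_inner \<Rightarrow> 'a \<Rightarrow> ('a \<Rightarrow> real) \<Rightarrow> 'a \<Rightarrow> real" where
  "rescale t x a u = (\<lambda>z. (u (x + t *\<^sub>R z) - u x - t * (a \<bullet> z)) / t\<^sup>2)"

text \<open>The conditions on a blow-up concern increments with a linear part removed. These are
  increments of u divided by \<open>t\<^sup>2\<close>, as are squared distances, so C and \<eta> do
  not change; only the slope is renormalised.\<close>

lemma rescale_increment:
  assumes "t \<noteq> 0"
  shows "rescale t x a u z - rescale t x a u y - ((a' - a) /\<^sub>R t) \<bullet> (z - y)
    = (u (x + t *\<^sub>R z) - u (x + t *\<^sub>R y) - a' \<bullet> ((x + t *\<^sub>R z) - (x + t *\<^sub>R y))) / t\<^sup>2"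
  using assms unfolding rescale_def
  by (simp add: inner_diff_left inner_diff_right field_simps power2_eq_square)

lemma rescale_norm:
  fixes x :: "'a::real_inner"
  shows "(norm ((x + t *\<^sub>R z) - (x + t *\<^sub>R y)))\<^sup>2 = t\<^sup>2 * (norm (z - y))\<^sup>2"
proof -
  have "(x + t *\<^sub>R z) - (x + t *\<^sub>R y) = t *\<^sub>R (z - y)" by (simp add: algebra_simps)
  then show ?thesis by (simp add: power_mult_distrib)
qed

lemma rescale_paraboloid_below:
  assumes t: "t \<noteq> 0" and "paraboloid_below C S u (x + t *\<^sub>R y) a'"
    and "\<And>z. z \<in> T \<Longrightarrow> x + t *\<^sub>R z \<in> S"
  shows "paraboloid_below C T (rescale t x a u) y ((a' - a) /\<^sub>R t)"
  unfolding paraboloid_below_def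
proof
  fix z assume "z \<in> T"
  then have "u (x + t *\<^sub>R y) + a' \<bullet> ((x + t *\<^sub>R z) - (x + t *\<^sub>R y)) - C * (t\<^sup>2 * (norm (z - y))\<^sup>2) \<le> u (x + t *\<^sub>R z)"
    using assms(2,3) unfolding paraboloid_below_def rescale_norm[of x t z y, symmetric] by blast
  then have "- (C * (norm (z - y))\<^sup>2) \<le> (u (x + t *\<^sub>R z) - u (x + t *\<^sub>R y) - a' \<bullet> ((x + t *\<^sub>R z) - (x + t *\<^sub>R y))) / t\<^sup>2"
    using t by (simp add: le_divide_eq algebra_simps)
  then show "rescale t x a u y + ((a' - a) /\<^sub>R t) \<bullet> (z - y) - C * (norm (z - y))\<^sup>2 \<le> rescale t x a u z"
    using rescale_increment[OF t, of x a u z y a'] by linarith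
qed

lemma rescale_contact_at:
  assumes t: "t \<noteq> 0" and c: "contact_at C \<eta> S u v (x + t *\<^sub>R y) a' b'"
    and T: "\<And>z. z \<in> T \<Longrightarrow> x + t *\<^sub>R z \<in> S"
  shows "contact_at C \<eta> T (rescale t x a u) (rescale t x b v) y ((a' - a) /\<^sub>R t) ((b' - b) /\<^sub>R t)"
  unfolding contact_at_def
proof (intro ballI)
  fix z assume z: "z \<in> T"
  define du where "du = u (x + t *\<^sub>R z) - u (x + t *\<^sub>R y) - a' \<bullet> ((x + t *\<^sub>R z) - (x + t *\<^sub>R y))"
  define dv where "dv = v (x + t *\<^sub>R z) - v (x + t *\<^sub>R y) - b' \<bullet> ((x + t *\<^sub>R z) - (x + t *\<^sub>R y))"
  have "\<bar>du\<bar> \<le> C * (t\<^sup>2 * (norm (z - y))\<^sup>2)" "\<bar>dv\<bar> \<le> C * (t\<^sup>2 * (norm (z - y))\<^sup>2)"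
     "du + dv \<le> - \<eta> * (t\<^sup>2 * (norm (z - y))\<^sup>2)"
    using c T[OF z] unfolding contact_at_def du_def dv_def rescale_norm[of x t z y, symmetric]
    by (force simp: inner_add_left)+
  then have "\<bar>du / t\<^sup>2\<bar> \<le> C * (norm (z - y))\<^sup>2" "\<bar>dv / t\<^sup>2\<bar> \<le> C * (norm (z - y))\<^sup>2"
     "du / t\<^sup>2 + dv / t\<^sup>2 \<le> - \<eta> * (norm (z - y))\<^sup>2"
    using t by (simp_all add: divide_le_eq algebra_simps add_divide_distrib[symmetric])
  then show "\<bar>rescale t x a u z - rescale t x a u y - ((a' - a) /\<^sub>R t) \<bullet> (z - y)\<bar> \<le> C * (norm (z - y))\<^sup>2
    \<and> \<bar>rescale t x b v z - rescale t x b v y - ((b' - b) /\<^sub>R t) \<bullet> (z - y)\<bar> \<le> C * (norm (z - y))\<^sup>2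
    \<and> rescale t x a u z + rescale t x b v z - rescale t x a u y - rescale t x b v y
        - ((a' - a) /\<^sub>R t + (b' - b) /\<^sub>R t) \<bullet> (z - y) \<le> - \<eta> * (norm (z - y))\<^sup>2"
    using rescale_increment[OF t, of x a u z y a'] rescale_increment[OF t, of x b v z y b']
    unfolding du_def dv_def inner_add_left by linarith
qed

text \<open>Undoing a blow-up turns a quadratic test function into one with the same matrix. The
  case t = 1 also provides translations and added constants.\<close>

lemma quad_poly_affine_subst:
  assumes "t \<noteq> 0" "quad_poly A q"
  shows "quad_poly A (\<lambda>\<zeta>. t\<^sup>2 * q ((\<zeta> - x) /\<^sub>R t) + k + a \<bullet> \<zeta>)"
proof -
  obtain c p where q: "\<And>z. q z = c + p \<bullet> z + (z \<bullet> (A *v z)) / 2"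
    using assms(2) unfolding quad_poly_def by blast
  show ?thesis unfolding quad_poly_def
  proof (intro exI allI)
    fix \<zeta>
    have "t\<^sup>2 * q ((\<zeta> - x) /\<^sub>R t) = t\<^sup>2 * c + t * (p \<bullet> (\<zeta> - x)) + ((\<zeta> - x) \<bullet> (A *v (\<zeta> - x))) / 2"
    proof -
      define w where "w = \<zeta> - x"
      have "(w /\<^sub>R t) \<bullet> (A *v (w /\<^sub>R t)) = (w \<bullet> (A *v w)) / t\<^sup>2" "p \<bullet> (w /\<^sub>R t) = (p \<bullet> w) / t"
        by (simp_all add: matrix_vector_mult_scaleR power2_eq_square divide_inverse)
      then show ?thesis using assms(1) unfolding q w_def[symmetric] by (simp add: field_simps power2_eq_square)
    qed
    also have "(\<zeta> - x) \<bullet> (A *v (\<zeta> - x)) = \<zeta> \<bullet> (A *v \<zeta>) - (A *v x) \<bullet> \<zeta> - (x v* A) \<bullet> \<zeta> + x \<bullet> (A *v x)"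
      by (simp add: matrix_vector_mult_diff_distrib inner_diff_left inner_diff_right dot_lmul_matrix inner_commute[of "A *v x" \<zeta>])
    finally show "t\<^sup>2 * q ((\<zeta> - x) /\<^sub>R t) + k + a \<bullet> \<zeta> =
      (t\<^sup>2 * c - t * (p \<bullet> x) + (x \<bullet> (A *v x)) / 2 + k)
       + (t *\<^sub>R p - (A *v x) /\<^sub>R 2 - (x v* A) /\<^sub>R 2 + a) \<bullet> \<zeta> + (\<zeta> \<bullet> (A *v \<zeta>)) / 2"
      by (simp add: inner_diff_left inner_diff_right inner_add_left field_simps)
  qed
qed

lemma rescale_touch_sphere:
  fixes u :: "real^'n \<Rightarrow> real"
  assumes t: "t \<noteq> 0" and u: "touch_sphere F S u" and T: "\<And>z. z \<in> T \<Longrightarrow> x + t *\<^sub>R z \<in> S"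
  shows "touch_sphere F T (rescale t x a u)"
  unfolding touch_sphere_def
proof (intro ballI allI impI)
  fix A :: "real^'n^'n" and q y r x0
  assume A: "A \<in> Sym" and q: "quad_poly A q" and c: "cball y r \<subseteq> T" and x0: "x0 \<in> ball y r"
    and lt: "\<forall>z\<in>sphere y r. rescale t x a u z - q z < rescale t x a u x0 - q x0"
  \<comment> \<open>Chosen so that u - Q is \<open>t\<^sup>2\<close> times the rescaled difference;
    strict inequalities on spheres then correspond.\<close>
  define Q where "Q = (\<lambda>\<zeta>. t\<^sup>2 * q ((\<zeta> - x) /\<^sub>R t) + (u x - a \<bullet> x) + a \<bullet> \<zeta>)"
  have Q: "quad_poly A Q" unfolding Q_def by (rule quad_poly_affine_subst[OF t q])
  have eq: "u (x + t *\<^sub>R z) - Q (x + t *\<^sub>R z) = t\<^sup>2 * (rescale t x a u z - q z)" for z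
  proof -
    have "t\<^sup>2 * rescale t x a u z = u (x + t *\<^sub>R z) - u x - t * (a \<bullet> z)" using t unfolding rescale_def by simp
    moreover have "Q (x + t *\<^sub>R z) = t\<^sup>2 * q z + u x + t * (a \<bullet> z)" using t unfolding Q_def by (simp add: inner_add_right)
    ultimately show ?thesis by (simp add: right_diff_distrib)
  qed
  have d: "dist (x + t *\<^sub>R y) (x + t *\<^sub>R z) = \<bar>t\<bar> * dist y z" for z
  proof -
    have "(x + t *\<^sub>R y) - (x + t *\<^sub>R z) = t *\<^sub>R (y - z)" by (simp add: algebra_simps)
    then show ?thesis unfolding dist_norm by simp
  qed
  have surj: "\<exists>z. \<zeta> = x + t *\<^sub>R z" for \<zeta>
    using t by (intro exI[of _ "(\<zeta> - x) /\<^sub>R t"]) simp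
  have "cball (x + t *\<^sub>R y) (\<bar>t\<bar> * r) \<subseteq> S"
  proof
    fix \<zeta> assume z: "\<zeta> \<in> cball (x + t *\<^sub>R y) (\<bar>t\<bar> * r)"
    obtain z where "\<zeta> = x + t *\<^sub>R z" using surj by blast
    then show "\<zeta> \<in> S" using z d[of z] t c T[of z] by auto
  qed
  moreover have "x + t *\<^sub>R x0 \<in> ball (x + t *\<^sub>R y) (\<bar>t\<bar> * r)"
    using x0 t d[of x0] by simp
  moreover have "\<forall>\<zeta>\<in>sphere (x + t *\<^sub>R y) (\<bar>t\<bar> * r). u \<zeta> - Q \<zeta> < u (x + t *\<^sub>R x0) - Q (x + t *\<^sub>R x0)"
  proof
    fix \<zeta> assume z: "\<zeta> \<in> sphere (x + t *\<^sub>R y) (\<bar>t\<bar> * r)"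
    obtain z where zz: "\<zeta> = x + t *\<^sub>R z" using surj by blast
    then have "z \<in> sphere y r" using z d[of z] t by simp
    then show "u \<zeta> - Q \<zeta> < u (x + t *\<^sub>R x0) - Q (x + t *\<^sub>R x0)"
      unfolding zz eq using lt t by simp
  qed
  ultimately show "A \<in> F" using u A Q unfolding touch_sphere_def by blast
qed

text \<open>Blow-ups on the ball of radius k whose contact points are only 1/(k+1)-dense; limits for k to infinity
  have contact everywhere.\<close>
definition near_family ::
  "real \<Rightarrow> real \<Rightarrow> (real^'n^'n) set \<Rightarrow> (real^'n^'n) set \<Rightarrow> nat \<Rightarrow> (real^'n \<Rightarrow> real) \<Rightarrow> (real^'n \<Rightarrow> real) \<Rightarrow> bool" where
  "near_family C \<eta> F F' k u v \<longleftrightarrow>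
     (\<forall>z\<in>cball 0 (real k). \<bar>u z\<bar> \<le> C * (norm z)\<^sup>2 \<and> \<bar>v z\<bar> \<le> C * (norm z)\<^sup>2) \<and>
     (\<forall>x\<in>cball 0 (real k). (\<exists>a. paraboloid_below C (cball 0 (real k)) u x a) \<and> (\<exists>b. paraboloid_below C (cball 0 (real k)) v x b)) \<and>
     (\<forall>x\<in>cball 0 (real k). \<exists>y a b. dist x y \<le> 1 / (real k + 1) \<and> contact_at C \<eta> (cball 0 (real k)) u v y a b) \<and>
     touch_sphere F (cball 0 (real k)) u \<and> touch_sphere F' (cball 0 (real k)) v"

text \<open>The growth bounds fix value and slope zero at the origin, which keeps the family
  compact. The constants are part of the data so that blow-ups at contact points stay in the same
  family.\<close>

definition c11_family ::
  "real \<Rightarrow> real \<Rightarrow> (real^'n^'n) set \<Rightarrow> (real^'n^'n) set \<Rightarrow> (real^'n \<Rightarrow> real) \<Rightarrow> (real^'n \<Rightarrow> real) \<Rightarrow> bool" where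
  "c11_family C \<eta> F F' u v \<longleftrightarrow>
     (\<forall>z. \<bar>u z\<bar> \<le> C * (norm z)\<^sup>2 \<and> \<bar>v z\<bar> \<le> C * (norm z)\<^sup>2) \<and>
     (\<forall>x. \<exists>a b. contact_at C \<eta> UNIV u v x a b) \<and>
     touch_sphere F UNIV u \<and> touch_sphere F' UNIV v"

lemma contact_at_paraboloid_below:
  assumes "contact_at C \<eta> S u v x a b"
  shows "paraboloid_below C S u x a" "paraboloid_below C S v x b"
  using assms unfolding contact_at_def paraboloid_below_def by fastforce+

lemma contact_at_mono: "contact_at C \<eta> S u v x a b \<Longrightarrow> T \<subseteq> S \<Longrightarrow> contact_at C \<eta> T u v x a b"
  unfolding contact_at_def by blast

lemma touch_sphere_mono: "touch_sphere F S u \<Longrightarrow> T \<subseteq> S \<Longrightarrow> touch_sphere F T u"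
  unfolding touch_sphere_def by (meson subset_trans)

text \<open>Lets the compactness of approximate blow-ups be applied to sequences within the family
  itself.\<close>

lemma c11_family_near:
  assumes "c11_family C \<eta> F F' u v"
  shows "near_family C \<eta> F F' k u v"
proof -
  have c: "\<exists>a b. contact_at C \<eta> (cball 0 (real k)) u v x a b" for x
    using assms contact_at_mono[OF _ subset_UNIV] unfolding c11_family_def by metis
  have "(\<exists>a. paraboloid_below C (cball 0 (real k)) u x a) \<and> (\<exists>b. paraboloid_below C (cball 0 (real k)) v x b)" for x
    using c[of x] contact_at_paraboloid_below by blast
  moreover have "\<exists>y a b. dist x y \<le> 1 / (real k + 1) \<and> contact_at C \<eta> (cball 0 (real k)) u v y a b" for x
  proof -
    have "dist x x \<le> 1 / (real k + 1)" by simp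
    then show ?thesis using c[of x] by blast
  qed
  ultimately show ?thesis
    using assms touch_sphere_mono[OF _ subset_UNIV] unfolding near_family_def c11_family_def by blast
qed

text \<open>Two successive subsequences give limits of both functions. For contact at an arbitrary
  x, contact points approaching x have bounded slopes, which converge along a further subsequence,
  and the contact inequalities are closed.\<close>

lemma near_family_lim:
  fixes F F' :: "(real^'n^'n) set"
  assumes C: "0 \<le> C" and nf: "\<And>k. near_family C \<eta> F F' k (f k) (g k)"
  obtains s u v where "strict_mono s" "equi_lim (\<lambda>k. f (s k)) u" "equi_lim (\<lambda>k. g (s k)) v" "c11_family C \<eta> F F' u v"
proof -
  have f1: "\<bar>f k z\<bar> \<le> C * (norm z)\<^sup>2" "\<bar>g k z\<bar> \<le> C * (norm z)\<^sup>2" if "norm z \<le> real k" for k z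
    using nf[of k] that unfolding near_family_def by auto
  have pf: "\<exists>a. paraboloid_below C (cball 0 (real k)) (f k) x a" 
    and pg: "\<exists>a. paraboloid_below C (cball 0 (real k)) (g k) x a" if "norm x \<le> real k" for k x
    using nf[of k] that unfolding near_family_def by auto
  obtain s1 u where s1: "strict_mono s1" "equi_lim (\<lambda>k. f (s1 k)) u"
    using equi_lim_exists[where f=f, OF C f1(1) pf] by blast
  have le1: "k \<le> s1 k" for k by (rule seq_suble[OF s1(1)])
  have sub: "paraboloid_below C T w x a" if "paraboloid_below C S w x a" "T \<subseteq> S" for S T w x a
    using that unfolding paraboloid_below_def by blast
  have pg1: "\<exists>a. paraboloid_below C (cball 0 (real k)) (g (s1 k)) x a" if "norm x \<le> real k" for k x
  proof -
    have "cball 0 (real k) \<subseteq> cball (0::real^'n) (real (s1 k))" using le1[of k] by (intro subset_cball) simp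
    moreover have "norm x \<le> real (s1 k)" using that le1[of k] by linarith
    ultimately show ?thesis using pg[of x "s1 k"] sub by blast
  qed
  have g1: "\<bar>g (s1 k) z\<bar> \<le> C * (norm z)\<^sup>2" if "norm z \<le> real k" for k z
    using f1(2)[of z "s1 k"] that le1[of k] by (meson of_nat_mono order_trans)
  obtain s2 v where s2: "strict_mono s2" "equi_lim (\<lambda>k. g (s1 (s2 k))) v"
    using equi_lim_exists[where f="\<lambda>k. g (s1 k)", OF C g1 pg1] by blast
  define s where "s = (\<lambda>k. s1 (s2 k))"
  have s: "strict_mono s" using s1(1) s2(1) unfolding s_def strict_mono_def by blast
  have lu: "equi_lim (\<lambda>k. f (s k)) u" unfolding s_def by (rule equi_lim_subseq[OF s1(2) s2(1)])
  have lv: "equi_lim (\<lambda>k. g (s k)) v" using s2(2) unfolding s_def .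
  have les: "k \<le> s k" for k by (rule seq_suble[OF s])
  have big: "\<forall>\<^sub>F k in sequentially. \<rho> \<le> real (s k)" for \<rho>
  proof -
    have "filterlim (\<lambda>k. real (s k)) at_top sequentially"
      using filterlim_compose[OF filterlim_real_sequentially filterlim_subseq[OF s(1)]] .
    then show ?thesis unfolding filterlim_at_top by blast
  qed
  have growth: "\<bar>u z\<bar> \<le> C * (norm z)\<^sup>2 \<and> \<bar>v z\<bar> \<le> C * (norm z)\<^sup>2" for z
  proof -
    have "(\<lambda>k. \<bar>f (s k) z\<bar>) \<longlonglongrightarrow> \<bar>u z\<bar>" "(\<lambda>k. \<bar>g (s k) z\<bar>) \<longlonglongrightarrow> \<bar>v z\<bar>"
      using lu lv unfolding equi_lim_def by (auto intro: tendsto_rabs)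
    moreover have "\<forall>\<^sub>F k in sequentially. \<bar>f (s k) z\<bar> \<le> C * (norm z)\<^sup>2" "\<forall>\<^sub>F k in sequentially. \<bar>g (s k) z\<bar> \<le> C * (norm z)\<^sup>2"
      using f1 by (auto intro: eventually_mono[OF big[of "norm z"]])
    ultimately show ?thesis using tendsto_upperbound trivial_limit_sequentially by blast
  qed
  have bigS: "\<forall>\<^sub>F k in sequentially. cball 0 \<rho> \<subseteq> cball 0 (real (s k))" for \<rho>
    by (rule eventually_mono[OF big[of \<rho>]]) auto
  have tu: "touch_sphere F UNIV u" "touch_sphere F' UNIV v"
    using touch_sphere_lim[OF lu bigS, of F] touch_sphere_lim[OF lv bigS, of F'] nf unfolding near_family_def by blast+
  have "\<exists>a b. contact_at C \<eta> UNIV u v x a b" for x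
  proof -
    \<comment> \<open>Radius \<open>norm x + 1\<close> contains all points within distance 1 of x;
      one further unit is the room demanded by \<open>paraboloid_below_slope\<close>.\<close>
    define \<rho> where "\<rho> = norm x + 1"
    obtain N where N: "\<And>k. k \<ge> N \<Longrightarrow> \<rho> + 1 \<le> real (s k)"
      using big[of "\<rho> + 1"] unfolding eventually_sequentially by blast
    have "\<exists>y a b. dist x y \<le> 1 / (real (s (k + N)) + 1) \<and> contact_at C \<eta> (cball 0 (real (s (k + N)))) (f (s (k + N))) (g (s (k + N))) y a b" for k
      using nf[of "s (k + N)"] N[of "k + N"] unfolding near_family_def \<rho>_def by force
    then obtain y a b where y: "\<And>k. dist x (y k) \<le> 1 / (real (s (k + N)) + 1)"
      and c: "\<And>k. contact_at C \<eta> (cball 0 (real (s (k + N)))) (f (s (k + N))) (g (s (k + N))) (y k) (a k) (b k)"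
      by metis
    have y1: "dist x (y k) \<le> 1 / (real k + 1)" for k
    proof -
      have "real k \<le> real (s (k + N))" using les[of "k + N"] by linarith
      then have "1 / (real (s (k + N)) + 1) \<le> 1 / (real k + 1)" by (intro divide_left_mono) (auto intro!: mult_pos_pos)
      then show ?thesis using y[of k] by linarith
    qed
    have "(\<lambda>k. 1 / (real k + 1)) \<longlonglongrightarrow> 0" using LIMSEQ_inverse_real_of_nat by (simp add: inverse_eq_divide add.commute)
    then have "(\<lambda>k. dist x (y k)) \<longlonglongrightarrow> 0"
      by (rule tendsto_sandwich[OF _ _ tendsto_const, rotated 2]) (use y1 in auto)
    then have yx: "y \<longlonglongrightarrow> x" using tendsto_dist_iff[of y x sequentially] by (simp add: dist_commute)
    have ny: "norm (y k) \<le> \<rho>" for k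
    proof -
      have "1 / (real k + 1) \<le> 1" by (simp add: divide_le_eq)
      then have "norm (y k - x) \<le> 1" using y1[of k] unfolding dist_norm norm_minus_commute[of "y k" x] by linarith
      then show ?thesis using norm_triangle_ineq2[of "y k" x] unfolding \<rho>_def by linarith
    qed
    define M where "M = 2 * C * (\<rho> + 1)\<^sup>2 + C"
    have na: "norm (a k) \<le> M" for k unfolding M_def
      by (rule paraboloid_below_slope[OF contact_at_paraboloid_below(1)[OF c[of k]] ny _ C f1(1)]) (use N[of "k + N"] in auto)
    have nb: "norm (b k) \<le> M" for k unfolding M_def
      by (rule paraboloid_below_slope[OF contact_at_paraboloid_below(2)[OF c[of k]] ny _ C f1(2)]) (use N[of "k + N"] in auto)
    have "compact (cball (0::real^'n) M \<times> cball (0::real^'n) M)" by (intro compact_Times compact_cball)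
    moreover have "\<forall>k. (a k, b k) \<in> cball 0 M \<times> cball 0 M" using na nb by simp
    ultimately obtain l r where r: "strict_mono r" "((\<lambda>k. (a k, b k)) \<circ> r) \<longlonglongrightarrow> l"
      unfolding compact_eq_seq_compact_metric by (elim seq_compactE) auto
    define al bl where "al = fst l" and "bl = snd l"
    have al: "(\<lambda>k. a (r k)) \<longlonglongrightarrow> al" and bl: "(\<lambda>k. b (r k)) \<longlonglongrightarrow> bl"
      using tendsto_fst[OF r(2)] tendsto_snd[OF r(2)] by (simp_all add: o_def al_def bl_def)
    have yl: "(\<lambda>k. y (r k)) \<longlonglongrightarrow> x" using LIMSEQ_subseq_LIMSEQ[OF yx r(1)] by (simp add: o_def)
    have rr: "strict_mono (\<lambda>k. r k + N)" using r(1) unfolding strict_mono_def by simp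
    note lu' = equi_lim_subseq[OF lu rr] and lv' = equi_lim_subseq[OF lv rr]
    have "contact_at C \<eta> UNIV u v x al bl"
      unfolding contact_at_def
    proof (intro ballI)
      fix z :: "real^'n"
      have n1: "(\<lambda>k. z - y (r k)) \<longlonglongrightarrow> z - x" by (intro tendsto_diff tendsto_const yl)
      have n2: "(\<lambda>k. C * (norm (z - y (r k)))\<^sup>2) \<longlonglongrightarrow> C * (norm (z - x))\<^sup>2"
        "(\<lambda>k. - \<eta> * (norm (z - y (r k)))\<^sup>2) \<longlonglongrightarrow> - \<eta> * (norm (z - x))\<^sup>2"
        by (intro tendsto_intros n1)+
      have u1: "(\<lambda>k. f (s (r k + N)) z) \<longlonglongrightarrow> u z" "(\<lambda>k. g (s (r k + N)) z) \<longlonglongrightarrow> v z"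
        using lu' lv' unfolding equi_lim_def by auto
      have u2: "(\<lambda>k. f (s (r k + N)) (y (r k))) \<longlonglongrightarrow> u x" "(\<lambda>k. g (s (r k + N)) (y (r k))) \<longlonglongrightarrow> v x"
        using equi_lim_diagonal[OF lu' yl] equi_lim_diagonal[OF lv' yl] by auto
      have e1: "(\<lambda>k. \<bar>f (s (r k + N)) z - f (s (r k + N)) (y (r k)) - a (r k) \<bullet> (z - y (r k))\<bar>) \<longlonglongrightarrow> \<bar>u z - u x - al \<bullet> (z - x)\<bar>"
        by (intro tendsto_intros u1 u2 al n1)
      have e2: "(\<lambda>k. \<bar>g (s (r k + N)) z - g (s (r k + N)) (y (r k)) - b (r k) \<bullet> (z - y (r k))\<bar>) \<longlonglongrightarrow> \<bar>v z - v x - bl \<bullet> (z - x)\<bar>"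
        by (intro tendsto_intros u1 u2 bl n1)
      have e3: "(\<lambda>k. f (s (r k + N)) z + g (s (r k + N)) z - f (s (r k + N)) (y (r k)) - g (s (r k + N)) (y (r k)) - (a (r k) + b (r k)) \<bullet> (z - y (r k))) \<longlonglongrightarrow> u z + v z - u x - v x - (al + bl) \<bullet> (z - x)"
        by (intro tendsto_intros u1 u2 al bl n1)
      have "\<forall>\<^sub>F k in sequentially. norm z \<le> real (s (r k + N))"
        using eventually_subseq[OF rr big[of "norm z"]] .
      then have ev: "\<forall>\<^sub>F k in sequentially. z \<in> cball 0 (real (s (r k + N)))" by simp
      have i1: "\<forall>\<^sub>F k in sequentially. \<bar>f (s (r k + N)) z - f (s (r k + N)) (y (r k)) - a (r k) \<bullet> (z - y (r k))\<bar> \<le> C * (norm (z - y (r k)))\<^sup>2"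
       and i2: "\<forall>\<^sub>F k in sequentially. \<bar>g (s (r k + N)) z - g (s (r k + N)) (y (r k)) - b (r k) \<bullet> (z - y (r k))\<bar> \<le> C * (norm (z - y (r k)))\<^sup>2"
       and i3: "\<forall>\<^sub>F k in sequentially. f (s (r k + N)) z + g (s (r k + N)) z - f (s (r k + N)) (y (r k)) - g (s (r k + N)) (y (r k)) - (a (r k) + b (r k)) \<bullet> (z - y (r k)) \<le> - \<eta> * (norm (z - y (r k)))\<^sup>2"
        using c unfolding contact_at_def by (auto intro: eventually_mono[OF ev])
      show "\<bar>u z - u x - al \<bullet> (z - x)\<bar> \<le> C * (norm (z - x))\<^sup>2 \<and>
         \<bar>v z - v x - bl \<bullet> (z - x)\<bar> \<le> C * (norm (z - x))\<^sup>2 \<and>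
         u z + v z - u x - v x - (al + bl) \<bullet> (z - x) \<le> - \<eta> * (norm (z - x))\<^sup>2"
        using tendsto_le[OF trivial_limit_sequentially n2(1) e1 i1] tendsto_le[OF trivial_limit_sequentially n2(1) e2 i2]
          tendsto_le[OF trivial_limit_sequentially n2(2) e3 i3] by blast
    qed
    then show ?thesis by blast
  qed
  then have "c11_family C \<eta> F F' u v" unfolding c11_family_def using growth tu by blast
  with s lu lv show thesis by (rule that)
qed

section \<open>Extremal blow-ups are quadratic\<close>

text \<open>Says without derivatives that the derivative of u along e is an affine function with
  linear part p; the same p and m serve every line parallel to e. Across e nothing is required of
  u.\<close>

definition quadratic_along :: "('a::real_inner \<Rightarrow> real) \<Rightarrow> 'a \<Rightarrow> bool" where
  "quadratic_along u e \<longleftrightarrow> (\<exists>p c m. \<forall>x s. u (x + s *\<^sub>R e) = u x + s * (p \<bullet> x + c) + m * s\<^sup>2)"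

lemma quadratic_along_rescale:
  assumes t: "t \<noteq> 0" and "quadratic_along u e"
  shows "quadratic_along (rescale t x0 a u) e"
proof -
  obtain p c m where u: "\<And>x s. u (x + s *\<^sub>R e) = u x + s * (p \<bullet> x + c) + m * s\<^sup>2"
    using assms(2) unfolding quadratic_along_def by blast
  have "rescale t x0 a u (x + s *\<^sub>R e) = rescale t x0 a u x + s * (p \<bullet> x + (p \<bullet> x0 + c - a \<bullet> e) / t) + m * s\<^sup>2" for x s
  proof -
    have "x0 + t *\<^sub>R (x + s *\<^sub>R e) = (x0 + t *\<^sub>R x) + (t * s) *\<^sub>R e" by (simp add: algebra_simps)
    then have "u (x0 + t *\<^sub>R (x + s *\<^sub>R e)) = u (x0 + t *\<^sub>R x) + (t * s) * (p \<bullet> (x0 + t *\<^sub>R x) + c) + m * (t * s)\<^sup>2"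
      using u[of "x0 + t *\<^sub>R x" "t * s"] by metis
    then show ?thesis using t unfolding rescale_def
      by (simp add: inner_add_right field_simps power2_eq_square)
  qed
  then show ?thesis unfolding quadratic_along_def by blast
qed

text \<open>The coefficients are linear combinations of finitely many values of f k, so they
  converge as soon as f k converges pointwise.\<close>

lemma quadratic_along_lim:
  fixes f :: "nat \<Rightarrow> 'a::euclidean_space \<Rightarrow> real"
  assumes q: "\<And>k. quadratic_along (f k) e" and l: "\<And>z. (\<lambda>k. f k z) \<longlonglongrightarrow> u z"
  shows "quadratic_along u e"
proof -
  obtain p c m where f: "\<And>k x s. f k (x + s *\<^sub>R e) = f k x + s * (p k \<bullet> x + c k) + m k * s\<^sup>2"
    using q unfolding quadratic_along_def by metis
  have m: "m k = (f k e + f k (- e)) / 2 - f k 0" and c: "c k = (f k e - f k (- e)) / 2" for k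
    using f[of k 0 1] f[of k 0 "-1"] by (simp_all add: field_simps)
  have p: "p k \<bullet> x = f k (x + e) - f k x - f k e + f k 0" for k x
    using f[of k x 1] f[of k 0 1] by simp
  define P where "P = (\<Sum>b\<in>Basis. (u (b + e) - u b - u e + u 0) *\<^sub>R b)"
  have ml: "m \<longlonglongrightarrow> (u e + u (- e)) / 2 - u 0" unfolding m[abs_def] by (intro tendsto_intros l) simp
  have cl: "c \<longlonglongrightarrow> (u e - u (- e)) / 2" unfolding c[abs_def] by (intro tendsto_intros l) simp
  have pl: "p \<longlonglongrightarrow> P"
  proof -
    have "p = (\<lambda>k. \<Sum>b\<in>Basis. (f k (b + e) - f k b - f k e + f k 0) *\<^sub>R b)"
      using euclidean_representation[of "p _"] p by simp
    then show ?thesis unfolding P_def by (auto intro!: tendsto_intros l)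
  qed
  have "u (x + s *\<^sub>R e) = u x + s * (P \<bullet> x + (u e - u (- e)) / 2) + ((u e + u (- e)) / 2 - u 0) * s\<^sup>2" for x s
  proof (rule LIMSEQ_unique[OF l[of "x + s *\<^sub>R e"]])
    show "(\<lambda>k. f k (x + s *\<^sub>R e)) \<longlonglongrightarrow> u x + s * (P \<bullet> x + (u e - u (- e)) / 2) + ((u e + u (- e)) / 2 - u 0) * s\<^sup>2"
      unfolding f by (intro tendsto_intros l ml pl cl)
  qed
  then show ?thesis unfolding quadratic_along_def by blast
qed

lemma eq_0_of_inner_le_square_local:
  fixes a :: "'a::real_inner"
  assumes le: "\<And>z. norm z < \<rho> \<Longrightarrow> a \<bullet> z \<le> K * (norm z)\<^sup>2" and \<rho>: "0 < \<rho>"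
  shows "a = 0"
proof (rule ccontr)
  assume a: "a \<noteq> 0"
  \<comment> \<open>Small enough for t * a to lie in the ball and for K * t to be below 1, so that
    the linear term dominates.\<close>
  define t where "t = min (1 / (\<bar>K\<bar> + 1)) (\<rho> / (2 * norm a))"
  have t: "t > 0" unfolding t_def using a \<rho> by simp
  have "t * norm a \<le> \<rho> / (2 * norm a) * norm a" unfolding t_def by (intro mult_right_mono) auto
  then have "norm (t *\<^sub>R a) < \<rho>" using a \<rho> t by simp
  from le[OF this] have "t * (a \<bullet> a) \<le> K * t\<^sup>2 * (a \<bullet> a)"
    by (simp add: power_mult_distrib power2_norm_eq_inner)
  then have "t \<le> K * t\<^sup>2" using a by simp
  then have "1 \<le> K * t" using t by (simp add: power2_eq_square)
  also have "\<dots> \<le> \<bar>K\<bar> * t" using t by (intro mult_right_mono) auto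
  also have "\<dots> \<le> \<bar>K\<bar> * (1 / (\<bar>K\<bar> + 1))" unfolding t_def by (intro mult_left_mono) auto
  also have "\<dots> < 1" by (simp add: divide_simps)
  finally show False by simp
qed

lemma eq_0_of_inner_le_square:
  fixes a :: "'a::real_inner"
  assumes "\<And>z. a \<bullet> z \<le> K * (norm z)\<^sup>2"
  shows "a = 0"
  by (rule eq_0_of_inner_le_square_local[OF _ zero_less_one]) (rule assms)

text \<open>Only u is made quadratic: in the end v is compared with - u through the third clause of
  \<open>contact_at\<close>.\<close>

definition quadratic_family ::
  "real \<Rightarrow> real \<Rightarrow> (real^'n^'n) set \<Rightarrow> (real^'n^'n) set \<Rightarrow> (real^'n) set \<Rightarrow> (real^'n \<Rightarrow> real) \<Rightarrow> (real^'n \<Rightarrow> real) \<Rightarrow> bool" where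
  "quadratic_family C \<eta> F F' B u v \<longleftrightarrow> c11_family C \<eta> F F' u v \<and> (\<forall>e\<in>B. quadratic_along u e)"

text \<open>The contact inequalities at x become the growth bounds around the new origin, so blowing
  up at a contact point never leaves the family.\<close>

lemma quadratic_family_rescale:
  assumes qf: "quadratic_family C \<eta> F F' B u v" and c: "contact_at C \<eta> UNIV u v x a b" and t: "t \<noteq> 0"
  shows "quadratic_family C \<eta> F F' B (rescale t x a u) (rescale t x b v)"
proof -
  have "\<bar>rescale t x a u z\<bar> \<le> C * (norm z)\<^sup>2 \<and> \<bar>rescale t x b v z\<bar> \<le> C * (norm z)\<^sup>2" for z
    using rescale_contact_at[where y=0 and T=UNIV, OF t, of C \<eta> UNIV u v x a b a b] c
    unfolding contact_at_def by (force simp: rescale_def)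
  moreover have "\<exists>a' b'. contact_at C \<eta> UNIV (rescale t x a u) (rescale t x b v) y a' b'" for y
  proof -
    obtain a' b' where "contact_at C \<eta> UNIV u v (x + t *\<^sub>R y) a' b'"
      using qf unfolding quadratic_family_def c11_family_def by blast
    from rescale_contact_at[OF t this, of UNIV] show ?thesis by blast
  qed
  ultimately show ?thesis
    using qf rescale_touch_sphere[OF t, of F UNIV u UNIV x a] rescale_touch_sphere[OF t, of F' UNIV v UNIV x b] quadratic_along_rescale[OF t]
    unfolding quadratic_family_def c11_family_def by blast
qed

lemma quadratic_family_lim:
  fixes f g :: "nat \<Rightarrow> real^'n \<Rightarrow> real" and F F' :: "(real^'n^'n) set"
  assumes C: "0 \<le> C" and qf: "\<And>k. quadratic_family C \<eta> F F' B (f k) (g k)"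
  obtains s u v where "strict_mono s" "\<And>z. (\<lambda>k. f (s k) z) \<longlonglongrightarrow> u z" "quadratic_family C \<eta> F F' B u v"
proof -
  have "near_family C \<eta> F F' k (f k) (g k)" for k
    using qf[of k] c11_family_near unfolding quadratic_family_def by blast
  then obtain s u v where s: "strict_mono s" "equi_lim (\<lambda>k. f (s k)) u" "c11_family C \<eta> F F' u v"
    using near_family_lim[OF C] by metis
  have l: "\<And>z. (\<lambda>k. f (s k) z) \<longlonglongrightarrow> u z" using s(2) unfolding equi_lim_def by blast
  have "quadratic_along u e" if "e \<in> B" for e
    by (rule quadratic_along_lim[OF _ l]) (use qf that in \<open>auto simp: quadratic_family_def\<close>)
  then show thesis using that[OF s(1) l] s(3) unfolding quadratic_family_def by blast
qed

lemma quadratic_family_contact_0: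
  assumes "quadratic_family C \<eta> F F' B u v" "contact_at C \<eta> UNIV u v 0 a b"
  shows "a = 0" "b = 0" "u 0 = 0" "v 0 = 0"
proof -
  have g: "\<bar>u z\<bar> \<le> C * (norm z)\<^sup>2" "\<bar>v z\<bar> \<le> C * (norm z)\<^sup>2" for z
    using assms(1) unfolding quadratic_family_def c11_family_def by auto
  show z: "u 0 = 0" "v 0 = 0" using g[of 0] by auto
  have "\<bar>u z - u 0 - a \<bullet> (z - 0)\<bar> \<le> C * (norm (z - 0))\<^sup>2" "\<bar>v z - v 0 - b \<bullet> (z - 0)\<bar> \<le> C * (norm (z - 0))\<^sup>2" for z
    using assms(2) unfolding contact_at_def by blast+
  then have *: "\<bar>u z - a \<bullet> z\<bar> \<le> C * (norm z)\<^sup>2" "\<bar>v z - b \<bullet> z\<bar> \<le> C * (norm z)\<^sup>2" for z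
    using z by simp_all
  have "a \<bullet> z \<le> (2 * C) * (norm z)\<^sup>2" "b \<bullet> z \<le> (2 * C) * (norm z)\<^sup>2" for z
    using *(1)[of z] *(2)[of z] g(1)[of z] g(2)[of z] by linarith+
  then show "a = 0" "b = 0" using eq_0_of_inner_le_square by blast+
qed

text \<open>Average the supporting line at the intermediate point over the two ends.\<close>

lemma supergradient_concave:
  fixes w :: "real \<Rightarrow> real"
  assumes "\<And>s. \<exists>c. \<forall>r. w r \<le> w s + c * (r - s)" and "0 \<le> \<tau>" "\<tau> \<le> 1"
  shows "(1 - \<tau>) * w s0 + \<tau> * w s1 \<le> w ((1 - \<tau>) * s0 + \<tau> * s1)"
proof -
  define s where "s = (1 - \<tau>) * s0 + \<tau> * s1"
  obtain c where c: "\<And>r. w r \<le> w s + c * (r - s)" using assms(1) by blast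
  have "(1 - \<tau>) * w s0 \<le> (1 - \<tau>) * (w s + c * (s0 - s))" "\<tau> * w s1 \<le> \<tau> * (w s + c * (s1 - s))"
    using c[of s0] c[of s1] assms(2,3) by (intro mult_left_mono; simp)+
  moreover have "(1 - \<tau>) * (w s + c * (s0 - s)) + \<tau> * (w s + c * (s1 - s)) = w s"
    unfolding s_def by (simp add: algebra_simps)
  ultimately show ?thesis unfolding s_def[symmetric] by linarith
qed

lemma supergradient_bounded_constant:
  fixes w :: "real \<Rightarrow> real"
  assumes sg: "\<And>s. \<exists>c. \<forall>r. w r \<le> w s + c * (r - s)" and b: "\<And>r. - K \<le> w r"
  shows "w r = w s"
proof -
  have *: "w r \<le> w s" for r s
  proof -
    obtain c where c: "\<And>r. w r \<le> w s + c * (r - s)" using sg by blast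
    have "c = 0"
    proof (rule ccontr)
      assume "c \<noteq> 0"
      \<comment> \<open>At this point the supporting line takes the value - K - 1, below the lower
        bound.\<close>
      then show False
        using c[of "s - (w s + K + 1) / c"] b[of "s - (w s + K + 1) / c"] by simp
    qed
    then show ?thesis using c[of r] by simp
  qed
  show ?thesis using *[of r s] *[of s r] by simp
qed

text \<open>On every line parallel to e the function u - m s^2 is concave. Comparing it with its gradient along
  the extremal line shows that this gradient is affine in s; what remains after subtracting the resulting
  linear term is concave and bounded, hence constant.\<close>
lemma quadratic_along_extremal:
  fixes u :: "'a::real_inner \<Rightarrow> real"
  assumes G: "\<And>x z. \<bar>u z - u x - G x \<bullet> (z - x)\<bar> \<le> C * (norm (z - x))\<^sup>2"
    and ext: "\<And>x t. u (x + t *\<^sub>R e) \<le> u x + t * (G x \<bullet> e) + m * t\<^sup>2"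
    and line: "\<And>t. u (t *\<^sub>R e) = m * t\<^sup>2" and G0: "G 0 = 0"
  shows "quadratic_along u e"
proof -
  define W where "W y s = u (s *\<^sub>R e + y) - m * s\<^sup>2" for y s
  have sg: "\<exists>c. \<forall>r. W y r \<le> W y s + c * (r - s)" for y s
  proof (intro exI allI)
    fix r
    have "u ((s *\<^sub>R e + y) + (r - s) *\<^sub>R e) \<le> u (s *\<^sub>R e + y) + (r - s) * (G (s *\<^sub>R e + y) \<bullet> e) + m * (r - s)\<^sup>2" by (rule ext)
    moreover have "(s *\<^sub>R e + y) + (r - s) *\<^sub>R e = r *\<^sub>R e + y" by (simp add: algebra_simps)
    ultimately show "W y r \<le> W y s + (G (s *\<^sub>R e + y) \<bullet> e - 2 * m * s) * (r - s)"
      unfolding W_def by (simp add: algebra_simps power2_eq_square)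
  qed
  have near: "\<bar>W y s - G (s *\<^sub>R e) \<bullet> y\<bar> \<le> C * (norm y)\<^sup>2" for y s
    using G[of "s *\<^sub>R e + y" "s *\<^sub>R e"] unfolding W_def line by simp
  have aff: "G (((1 - \<tau>) * s0 + \<tau> * s1) *\<^sub>R e) = (1 - \<tau>) *\<^sub>R G (s0 *\<^sub>R e) + \<tau> *\<^sub>R G (s1 *\<^sub>R e)" if \<tau>: "0 \<le> \<tau>" "\<tau> \<le> 1" for \<tau> s0 s1
  proof -
    define s where "s = (1 - \<tau>) * s0 + \<tau> * s1"
    define d where "d = (1 - \<tau>) *\<^sub>R G (s0 *\<^sub>R e) + \<tau> *\<^sub>R G (s1 *\<^sub>R e) - G (s *\<^sub>R e)"
    \<comment> \<open>Near the extremal line \<open>W y s\<close> is the linear form of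
      \<open>G (s *\<^sub>R e)\<close> at y up to an error C |y|^2. Concavity in s holds for y and
      for - y alike, and a linear form that is at most quadratic for all y vanishes.\<close>
    have "d \<bullet> y \<le> (2 * C) * (norm y)\<^sup>2" for y
    proof -
      have "(1 - \<tau>) * W y s0 + \<tau> * W y s1 \<le> W y s"
        unfolding s_def by (rule supergradient_concave[OF sg \<tau>])
      moreover have "(1 - \<tau>) * (G (s0 *\<^sub>R e) \<bullet> y - C * (norm y)\<^sup>2) \<le> (1 - \<tau>) * W y s0"
        using near[of y s0] \<tau> by (intro mult_left_mono) (auto simp: abs_le_iff)
      moreover have "\<tau> * (G (s1 *\<^sub>R e) \<bullet> y - C * (norm y)\<^sup>2) \<le> \<tau> * W y s1"
        using near[of y s1] \<tau> by (intro mult_left_mono) (auto simp: abs_le_iff)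
      moreover have "W y s \<le> G (s *\<^sub>R e) \<bullet> y + C * (norm y)\<^sup>2" using near[of y s] by linarith
      moreover have "(1 - \<tau>) * (G (s0 *\<^sub>R e) \<bullet> y - C * (norm y)\<^sup>2) + \<tau> * (G (s1 *\<^sub>R e) \<bullet> y - C * (norm y)\<^sup>2) = d \<bullet> y + G (s *\<^sub>R e) \<bullet> y - C * (norm y)\<^sup>2"
        unfolding d_def by (simp add: inner_add_left inner_diff_left algebra_simps)
      ultimately show ?thesis by linarith
    qed
    then have "d = 0" by (rule eq_0_of_inner_le_square)
    then show ?thesis unfolding d_def s_def by simp
  qed
  have lin: "G (s *\<^sub>R e) = s *\<^sub>R G e" for s
  proof -
    \<comment> \<open>Interpolate between 0 and e for s at most 1, and between 0 and s e beyond;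
      negative s will follow from the midpoint 0.\<close>
    have p: "G (s *\<^sub>R e) = s *\<^sub>R G e" if s: "0 \<le> s" for s
    proof (cases "s \<le> 1")
      case True
      then show ?thesis using aff[of s 0 1] s G0 by simp
    next
      case False
      then have "G e = (1 / s) *\<^sub>R G (s *\<^sub>R e)" using aff[of "1/s" 0 s] G0 by simp
      then show ?thesis using False by simp
    qed
    have "0 = (1/2) *\<^sub>R G (s *\<^sub>R e) + (1/2) *\<^sub>R G ((- s) *\<^sub>R e)"
      using aff[of "1/2" s "- s"] G0 by simp
    then have "(1/2) *\<^sub>R (G (s *\<^sub>R e) + G ((- s) *\<^sub>R e)) = 0" by (simp add: scaleR_add_right)
    then have "G (s *\<^sub>R e) = - G ((- s) *\<^sub>R e)" by (simp add: eq_neg_iff_add_eq_0)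
    then show ?thesis using p[of s] p[of "- s"] by (cases "0 \<le> s") auto
  qed
  have "u (x + s *\<^sub>R e) = u x + s * (G e \<bullet> x + 0) + m * s\<^sup>2" for x s
  proof -
    define w where "w s = W x s - s * (G e \<bullet> x)" for s
    have "\<exists>c. \<forall>r. w r \<le> w s + c * (r - s)" for s
    proof -
      obtain c where c: "\<And>r. W x r \<le> W x s + c * (r - s)" using sg by blast
      have "w r \<le> w s + (c - G e \<bullet> x) * (r - s)" for r
        using c[of r] unfolding w_def by (simp add: algebra_simps)
      then show ?thesis by blast
    qed
    moreover have "- (C * (norm x)\<^sup>2) \<le> w r" for r
      using near[of x r] unfolding w_def lin by (simp add: abs_le_iff)
    ultimately have "w s = w 0" by (rule supergradient_bounded_constant)
    then show ?thesis unfolding w_def W_def by (simp add: algebra_simps)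
  qed
  then show ?thesis unfolding quadratic_along_def by blast
qed

text \<open>The supremum m of u e over the family is attained, and then u (t e) = m t^2 for t between 0 and 1.
  Zooming in at the midpoint of this segment extends the identity to the whole line.\<close>
lemma quadratic_family_extend:
  fixes e :: "real^'n"
  assumes C: "0 \<le> C" and ex: "\<exists>u v. quadratic_family C \<eta> F F' B u v"
  shows "\<exists>u v. quadratic_family C \<eta> F F' (insert e B) u v"
proof -
  define S where "S = {u e | u v. quadratic_family C \<eta> F F' B u v}"
  define m where "m = Sup S"
  have ne: "S \<noteq> {}" using ex unfolding S_def by auto
  have "r \<le> C * (norm e)\<^sup>2" if "r \<in> S" for r
  proof -
    obtain u v where "r = u e" "quadratic_family C \<eta> F F' B u v" using \<open>r \<in> S\<close> unfolding S_def by blast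
    then have "\<bar>r\<bar> \<le> C * (norm e)\<^sup>2" unfolding quadratic_family_def c11_family_def by blast
    then show ?thesis by simp
  qed
  then have bdd: "bdd_above S" unfolding bdd_above_def by blast
  have le_m: "u e \<le> m" if "quadratic_family C \<eta> F F' B u v" for u v
    unfolding m_def by (rule cSup_upper[OF _ bdd]) (use that in \<open>auto simp: S_def\<close>)
  \<comment> \<open>The maximal value m bounds every blow-up at e, whatever the contact point and
    the scale; unfolding the blow-up gives a second-order upper bound along e at all points and for
    both signs of t.\<close>
  have ext: "u (x + t *\<^sub>R e) \<le> u x + t * (a \<bullet> e) + m * t\<^sup>2"
    if q: "quadratic_family C \<eta> F F' B u v" and c: "contact_at C \<eta> UNIV u v x a b" for u v x a b t
  proof (cases "t = 0")
    case False
    from le_m[OF quadratic_family_rescale[OF q c False]] show ?thesis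
      using False unfolding rescale_def by (simp add: divide_le_eq algebra_simps)
  qed simp
  have "\<exists>u v. quadratic_family C \<eta> F F' B u v \<and> m - 1 / (real k + 1) < u e" for k
  proof -
    have "m - 1 / (real k + 1) < Sup S" unfolding m_def by simp
    then obtain r where "r \<in> S" "m - 1 / (real k + 1) < r" using less_cSup_iff[OF ne bdd] by blast
    then show ?thesis unfolding S_def by blast
  qed
  then obtain f g where f: "\<And>k. quadratic_family C \<eta> F F' B (f k) (g k)" "\<And>k. m - 1 / (real k + 1) < f k e" by metis
  obtain s u v where s: "strict_mono s" "\<And>z. (\<lambda>k. f (s k) z) \<longlonglongrightarrow> u z" and uv: "quadratic_family C \<eta> F F' B u v"
    by (rule quadratic_family_lim[of C \<eta> F F' B f g], rule C, rule f(1), rule that)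
  have ue: "u e = m"
  proof (rule antisym[OF le_m[OF uv]])
    have "(\<lambda>k. m - 1 / (real k + 1)) \<longlonglongrightarrow> m - 0"
      using LIMSEQ_inverse_real_of_nat by (intro tendsto_diff tendsto_const) (simp add: inverse_eq_divide add.commute)
    moreover have "m - 1 / (real k + 1) \<le> f (s k) e" for k
    proof -
      have "1 / (real (s k) + 1) \<le> 1 / (real k + 1)" using seq_suble[OF s(1), of k] by (intro divide_left_mono) (auto intro!: mult_pos_pos)
      then show ?thesis using f(2)[of "s k"] by linarith
    qed
    ultimately show "m \<le> u e" using LIMSEQ_le[OF _ s(2)[of e]] by auto
  qed
  have c11: "\<exists>a b. contact_at C \<eta> UNIV u v x a b" if "quadratic_family C \<eta> F F' B u v" for u v x
    using that unfolding quadratic_family_def c11_family_def by blast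
  obtain a0 b0 where ab0: "contact_at C \<eta> UNIV u v 0 a0 b0" using c11[OF uv] by blast
  note z0 = quadratic_family_contact_0[OF uv ab0]
  \<comment> \<open>The upper bound is the extremal inequality at 0. For the lower one it is applied
    at t e towards both ends of the segment, with weights 1 - t and t, so that the unknown slope
    cancels.\<close>
  have seg: "u (t *\<^sub>R e) = m * t\<^sup>2" if t: "0 \<le> t" "t \<le> 1" for t
  proof (rule antisym)
    show "u (t *\<^sub>R e) \<le> m * t\<^sup>2" using ext[OF uv ab0, of t] z0 by simp
    obtain a b where ab: "contact_at C \<eta> UNIV u v (t *\<^sub>R e) a b" using c11[OF uv] by blast
    have "u (t *\<^sub>R e + (- t) *\<^sub>R e) \<le> u (t *\<^sub>R e) + (- t) * (a \<bullet> e) + m * (- t)\<^sup>2" by (rule ext[OF uv ab])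
    then have 1: "0 \<le> u (t *\<^sub>R e) - t * (a \<bullet> e) + m * t\<^sup>2" using z0(3) by simp
    have "u (t *\<^sub>R e + (1 - t) *\<^sub>R e) \<le> u (t *\<^sub>R e) + (1 - t) * (a \<bullet> e) + m * (1 - t)\<^sup>2" by (rule ext[OF uv ab])
    then have 2: "0 \<le> u (t *\<^sub>R e) + (1 - t) * (a \<bullet> e) + m * (1 - t)\<^sup>2 - m" using ue by (simp add: algebra_simps)
    have "0 \<le> (1 - t) * (u (t *\<^sub>R e) - t * (a \<bullet> e) + m * t\<^sup>2) + t * (u (t *\<^sub>R e) + (1 - t) * (a \<bullet> e) + m * (1 - t)\<^sup>2 - m)"
      by (rule add_nonneg_nonneg[OF mult_nonneg_nonneg[OF _ 1] mult_nonneg_nonneg[OF _ 2]]) (use t in auto)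
    also have "\<dots> = u (t *\<^sub>R e) - m * t\<^sup>2" by (simp add: algebra_simps power2_eq_square)
    finally show "m * t\<^sup>2 \<le> u (t *\<^sub>R e)" by simp
  qed
  obtain a b where ab: "contact_at C \<eta> UNIV u v ((1/2) *\<^sub>R e) a b" using c11[OF uv] by blast
  define u1 v1 where "u1 = rescale 1 ((1/2) *\<^sub>R e) a u" and "v1 = rescale 1 ((1/2) *\<^sub>R e) b v"
  have uv1: "quadratic_family C \<eta> F F' B u1 v1" unfolding u1_def v1_def by (rule quadratic_family_rescale[OF uv ab]) simp
  have half: "u ((1/2) *\<^sub>R e + t *\<^sub>R e) = m * (1/2 + t)\<^sup>2" if "\<bar>t\<bar> \<le> 1/2" for t
    using seg[of "1/2 + t"] that by (simp add: scaleR_add_left)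
  have u1: "u1 (t *\<^sub>R e) = m * t\<^sup>2" if t: "\<bar>t\<bar> \<le> 1/2" for t
  proof -
    \<comment> \<open>The extremal inequalities from the midpoint to the two ends bound the slope
      along e from both sides.\<close>
    have ae: "a \<bullet> e = m"
    proof -
      have "u ((1/2) *\<^sub>R e + (1/2) *\<^sub>R e) \<le> u ((1/2) *\<^sub>R e) + (1/2) * (a \<bullet> e) + m * (1/2)\<^sup>2"
        "u ((1/2) *\<^sub>R e + (- (1/2)) *\<^sub>R e) \<le> u ((1/2) *\<^sub>R e) + (- (1/2)) * (a \<bullet> e) + m * (- (1/2))\<^sup>2"
        by (rule ext[OF uv ab])+
      then show ?thesis using half[of "1/2"] half[of "-(1/2)"] half[of 0] by (simp add: power2_eq_square)
    qed
    show ?thesis using half[OF t] half[of 0] ae unfolding u1_def rescale_def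
      by (simp add: power2_eq_square algebra_simps)
  qed
  obtain a1 b1 where ab1: "contact_at C \<eta> UNIV u1 v1 0 a1 b1" using c11[OF uv1] by blast
  note z1 = quadratic_family_contact_0[OF uv1 ab1]
  \<comment> \<open>The identity is known for |t| at most 1/2 around the origin; scale 1 / (k + 1)
    stretches this interval so that it contains |t| at most k / 2.\<close>
  have qk: "quadratic_family C \<eta> F F' B (rescale (1 / (real k + 1)) 0 0 u1) (rescale (1 / (real k + 1)) 0 0 v1)" for k
    by (rule quadratic_family_rescale[OF uv1]) (use ab1 z1 in auto)
  have uk: "rescale (1 / (real k + 1)) 0 0 u1 (t *\<^sub>R e) = m * t\<^sup>2" if "\<bar>t\<bar> \<le> real k / 2" for k t
  proof -
    have "\<bar>1 / (real k + 1) * t\<bar> \<le> 1/2" using that by (simp add: abs_mult field_simps)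
    from u1[OF this] show ?thesis using z1(3) unfolding rescale_def by (simp add: power_mult_distrib power_divide)
  qed
  obtain s2 u2 v2 where s2: "strict_mono s2" "\<And>z. (\<lambda>k. rescale (1 / (real (s2 k) + 1)) 0 0 u1 z) \<longlonglongrightarrow> u2 z" and uv2: "quadratic_family C \<eta> F F' B u2 v2"
    by (rule quadratic_family_lim[of C \<eta> F F' B "\<lambda>k. rescale (1 / (real k + 1)) 0 0 u1" "\<lambda>k. rescale (1 / (real k + 1)) 0 0 v1"], rule C, rule qk, rule that)
  have line: "u2 (t *\<^sub>R e) = m * t\<^sup>2" for t
  proof (rule LIMSEQ_unique[OF s2(2)])
    obtain N where N: "2 * \<bar>t\<bar> \<le> real N" using real_arch_simple by blast
    have "\<forall>\<^sub>F k in sequentially. m * t\<^sup>2 = rescale (1 / (real (s2 k) + 1)) 0 0 u1 (t *\<^sub>R e)"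
      unfolding eventually_sequentially
    proof (intro exI allI impI)
      fix k assume "N \<le> k"
      then have "\<bar>t\<bar> \<le> real (s2 k) / 2" using N seq_suble[OF s2(1), of k] by linarith
      then show "m * t\<^sup>2 = rescale (1 / (real (s2 k) + 1)) 0 0 u1 (t *\<^sub>R e)" using uk by simp
    qed
    then show "(\<lambda>k. rescale (1 / (real (s2 k) + 1)) 0 0 u1 (t *\<^sub>R e)) \<longlonglongrightarrow> m * t\<^sup>2"
      using tendsto_eventually[of "\<lambda>k. rescale (1 / (real (s2 k) + 1)) 0 0 u1 (t *\<^sub>R e)"] by (simp add: eq_commute)
  qed
  obtain G H where GH: "\<And>x. contact_at C \<eta> UNIV u2 v2 x (G x) (H x)" using c11[OF uv2] by metis
  have "quadratic_along u2 e"
  proof (rule quadratic_along_extremal[where G=G and m=m])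
    show "\<bar>u2 z - u2 x - G x \<bullet> (z - x)\<bar> \<le> C * (norm (z - x))\<^sup>2" for x z
      using GH[of x] unfolding contact_at_def by blast
    show "u2 (x + t *\<^sub>R e) \<le> u2 x + t * (G x \<bullet> e) + m * t\<^sup>2" for x t by (rule ext[OF uv2 GH])
    show "G 0 = 0" using quadratic_family_contact_0[OF uv2 GH] by blast
  qed (rule line)
  then show ?thesis using uv2 unfolding quadratic_family_def by blast
qed

section \<open>Symmetric matrices and the matrix of a quadratic blow-up\<close>

lemma Sym_iff: "A \<in> Sym \<longleftrightarrow> (\<forall>x y. x \<bullet> (A *v y) = y \<bullet> (A *v x))"
proof
  assume A: "A \<in> Sym"
  have "x \<bullet> (A *v y) = y \<bullet> (transpose A *v x)" for x y
    by (metis dot_lmul_matrix inner_commute transpose_matrix_vector)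
  then show "\<forall>x y. x \<bullet> (A *v y) = y \<bullet> (A *v x)" using A unfolding Sym_def mem_Collect_eq by metis
next
  assume *: "\<forall>x y. x \<bullet> (A *v y) = y \<bullet> (A *v x)"
  have e: "A $ i $ j = axis i 1 \<bullet> (A *v axis j 1)" for i j
    by (simp add: inner_axis' matrix_vector_mul_component inner_axis)
  have "A $ i $ j = A $ j $ i" for i j using * unfolding e by blast
  then show "A \<in> Sym" unfolding Sym_def transpose_def by (simp add: vec_eq_iff)
qed

lemma Sym_add: "A \<in> Sym \<Longrightarrow> B \<in> Sym \<Longrightarrow> A + B \<in> Sym"
  and Sym_diff: "A \<in> Sym \<Longrightarrow> B \<in> Sym \<Longrightarrow> A - B \<in> Sym"
  and Sym_minus: "A \<in> Sym \<Longrightarrow> - A \<in> Sym"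
  and Sym_scaleR: "A \<in> Sym \<Longrightarrow> c *\<^sub>R A \<in> Sym"
  and Sym_mat: "mat k \<in> Sym"
  unfolding Sym_def by (auto simp: transpose_def vec_eq_iff mat_def)

lemma quadratic_family_Basis:
  fixes B :: "(real^'n) set"
  assumes "0 \<le> C" "c11_family C \<eta> F F' u v" "finite B"
  shows "\<exists>u v. quadratic_family C \<eta> F F' B u v"
  using assms(3)
proof induction
  case empty
  show ?case using assms(2) unfolding quadratic_family_def by blast
next
  case (insert e B)
  then show ?case using quadratic_family_extend[OF assms(1)] by blast
qed

lemma matrix_vector_mult_minus: "(- A) *v x = - (A *v (x::real^'n))"
  by (simp add: matrix_vector_mult_def vec_eq_iff sum_negf)

lemma matrix_scaleR_vector_mult: "(c *\<^sub>R A) *v x = c *\<^sub>R (A *v (x::real^'n))"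
  by (simp add: matrix_vector_mult_def vec_eq_iff sum_distrib_left algebra_simps)

text \<open>Being quadratic along each basis vector makes u (x + y) - u x - u y bilinear, so u is a
  quadratic form. Contact at 0 places v below - u - \<eta> |x|^2. Half of this margin is spent on
  strictness of the two contacts, \<eta> / 4 each on the unit sphere, which leaves exactly \<eta>
  between the matrices.\<close>

lemma c11_family_matrices:
  fixes F F' :: "(real^'n^'n) set"
  assumes C: "0 \<le> C" and \<eta>: "0 < \<eta>" and c11: "c11_family C \<eta> F F' u0 v0"
  shows "\<exists>A. A \<in> F \<and> - A - \<eta> *\<^sub>R mat 1 \<in> F'"
proof -
  obtain u v where qf: "quadratic_family C \<eta> F F' Basis u v"
    using quadratic_family_Basis[OF C c11 finite_Basis] by blast
  then have "\<exists>p c m. \<forall>x s. u (x + s *\<^sub>R e) = u x + s * (p \<bullet> x + c) + m * s\<^sup>2" if "e \<in> Basis" for e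
    using that unfolding quadratic_family_def quadratic_along_def by blast
  then obtain p c m where u: "\<And>e x s. e \<in> Basis \<Longrightarrow> u (x + s *\<^sub>R e) = u x + s * (p e \<bullet> x + c e) + m e * s\<^sup>2"
    by metis
  obtain a b where ab: "contact_at C \<eta> UNIV u v 0 a b"
    using qf unfolding quadratic_family_def c11_family_def by blast
  note z = quadratic_family_contact_0[OF qf ab]
  define B where "B x y = u (x + y) - u x - u y" for x y
  have step: "B x (y + s *\<^sub>R e) = B x y + s * (p e \<bullet> x)" if e: "e \<in> Basis" for x y s e
    using u[OF e, of "x + y" s] u[OF e, of y s] unfolding B_def by (simp add: add.assoc inner_add_right algebra_simps)
  have Bsum: "B x (\<Sum>e\<in>S. k e *\<^sub>R e) = (\<Sum>e\<in>S. k e * (p e \<bullet> x))" if "finite S" "S \<subseteq> Basis" for S k x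
    using that
  proof (induction S)
    case empty
    then show ?case using z unfolding B_def by simp
  next
    case (insert e S)
    then show ?case using step[of e x "\<Sum>e\<in>S. k e *\<^sub>R e" "k e"] by (simp add: add.commute)
  qed
  define T where "T x = (\<Sum>e\<in>Basis. (p e \<bullet> x) *\<^sub>R e)" for x
  have linT: "linear T" unfolding T_def
    by (intro linear_compose_sum ballI) (auto intro!: linearI simp: inner_add_right scaleR_add_left)
  define M where "M = matrix T"
  have M: "M *v x = T x" for x unfolding M_def using linT by (simp add: matrix_works)
  have B: "B x y = y \<bullet> (M *v x)" for x y
  proof -
    have "B x y = B x (\<Sum>e\<in>Basis. (y \<bullet> e) *\<^sub>R e)" by (simp add: euclidean_representation)
    also have "\<dots> = (\<Sum>e\<in>Basis. (y \<bullet> e) * (p e \<bullet> x))" by (rule Bsum) auto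
    also have "\<dots> = y \<bullet> T x" unfolding T_def by (simp add: inner_sum_right mult.commute)
    finally show ?thesis unfolding M .
  qed
  have symM: "M \<in> Sym"
    unfolding Sym_iff B[symmetric] B_def by (simp add: add.commute)
  \<comment> \<open>The defect D doubles when x is doubled, yet it is bounded by a multiple of
    |x|^2; repeated halving shows that it vanishes.\<close>
  have uM: "u x = (x \<bullet> (M *v x)) / 2" for x
  proof -
    define D where "D x = u x - (x \<bullet> (M *v x)) / 2" for x
    have D2: "D (2 *\<^sub>R x) = 2 * D x" for x
      using B[of x x] unfolding D_def B_def by (simp add: matrix_vector_mult_scaleR scaleR_2[symmetric])
    have "D x = 2 ^ n * D ((1 / 2 ^ n) *\<^sub>R x)" for n
    proof (induction n)
      case (Suc n)
      have "2 *\<^sub>R ((1 / 2 ^ Suc n) *\<^sub>R x) = (1 / 2 ^ n) *\<^sub>R x" by simp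
      then show ?case using Suc D2[of "(1 / 2 ^ Suc n) *\<^sub>R x"] by simp
    qed simp
    moreover
    obtain K where K: "\<And>x. \<bar>D x\<bar> \<le> K * (norm x)\<^sup>2"
    proof
      fix x
      have g: "\<bar>u x\<bar> \<le> C * (norm x)\<^sup>2" for x using qf unfolding quadratic_family_def c11_family_def by blast
      have "\<bar>x \<bullet> (M *v x)\<bar> \<le> 6 * C * (norm x)\<^sup>2"
        using g[of x] g[of "2 *\<^sub>R x"] B[of x x] unfolding B_def scaleR_2[symmetric] by (simp add: power_mult_distrib)
      then show "\<bar>D x\<bar> \<le> (4 * C) * (norm x)\<^sup>2" using g[of x] unfolding D_def by linarith
    qed
    ultimately have "\<bar>D x\<bar> \<le> 2 ^ n * (K * (norm ((1 / 2 ^ n) *\<^sub>R x))\<^sup>2)" for n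
    proof -
      have "\<bar>D x\<bar> = 2 ^ n * \<bar>D ((1 / 2 ^ n) *\<^sub>R x)\<bar>"
        using \<open>\<And>n. D x = 2 ^ n * D ((1 / 2 ^ n) *\<^sub>R x)\<close>[of n] by (metis abs_mult abs_numeral power_abs)
      then show ?thesis using K[of "(1 / 2 ^ n) *\<^sub>R x"] by simp
    qed
    then have "\<bar>D x\<bar> \<le> (1 / 2) ^ n * (K * (norm x)\<^sup>2)" for n
      by (simp add: power_mult_distrib power_divide power2_eq_square field_simps)
    moreover have "(\<lambda>n. (1 / 2) ^ n * (K * (norm x)\<^sup>2)) \<longlonglongrightarrow> 0 * (K * (norm x)\<^sup>2)"
      by (intro tendsto_mult tendsto_const LIMSEQ_power_zero) simp
    ultimately have "\<bar>D x\<bar> \<le> 0" using LIMSEQ_le_const[of _ "0 * (K * (norm x)\<^sup>2)" "\<bar>D x\<bar>"] by auto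
    then show ?thesis unfolding D_def by simp
  qed
  have one: "x \<bullet> ((M + k *\<^sub>R mat 1) *v x) = x \<bullet> (M *v x) + k * (norm x)\<^sup>2" for x k
    by (simp add: matrix_vector_mult_add_rdistrib matrix_scaleR_vector_mult inner_add_right power2_norm_eq_inner)
  have touch: "A \<in> G" if "touch_sphere G UNIV w" "A \<in> Sym" "w 0 = 0"
    "\<And>x. w x \<le> (x \<bullet> (A *v x)) / 2 - (\<eta> / 4) * (norm x)\<^sup>2" for G w and A :: "real^'n^'n"
  proof -
    have "quad_poly A (\<lambda>x. (x \<bullet> (A *v x)) / 2)"
      unfolding quad_poly_def by (intro exI[of _ 0] allI) simp
    moreover have "\<forall>x\<in>sphere 0 1. w x - (x \<bullet> (A *v x)) / 2 < w 0 - (0 \<bullet> (A *v 0)) / 2"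
    proof
      fix x :: "real^'n" assume "x \<in> sphere 0 1"
      then show "w x - (x \<bullet> (A *v x)) / 2 < w 0 - (0 \<bullet> (A *v 0)) / 2" using that(3) that(4)[of x] \<eta> by simp
    qed
    moreover have "(0::real^'n) \<in> ball 0 1" by simp
    ultimately show ?thesis
      using that(1)[unfolded touch_sphere_def, rule_format, OF that(2), of "\<lambda>x. (x \<bullet> (A *v x)) / 2" 0 1 0] by simp
  qed
  have "M + (\<eta> / 2) *\<^sub>R mat 1 \<in> F"
  proof (rule touch)
    show "touch_sphere F UNIV u" using qf unfolding quadratic_family_def c11_family_def by blast
    show "u x \<le> x \<bullet> ((M + (\<eta> / 2) *\<^sub>R mat 1) *v x) / 2 - \<eta> / 4 * (norm x)\<^sup>2" for x
      unfolding one uM by (simp add: field_simps)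
  qed (use z symM in \<open>auto intro: Sym_add Sym_scaleR Sym_mat\<close>)
  moreover have "- (M + (3 * \<eta> / 2) *\<^sub>R mat 1) \<in> F'"
  proof (rule touch)
    show "touch_sphere F' UNIV v" using qf unfolding quadratic_family_def c11_family_def by blast
    fix x
    have "u x + v x - u 0 - v 0 - (a + b) \<bullet> (x - 0) \<le> - \<eta> * (norm (x - 0))\<^sup>2"
      using ab unfolding contact_at_def by blast
    then have "v x \<le> - u x - \<eta> * (norm x)\<^sup>2" using z by simp
    then show "v x \<le> x \<bullet> (- (M + (3 * \<eta> / 2) *\<^sub>R mat 1) *v x) / 2 - \<eta> / 4 * (norm x)\<^sup>2"
      unfolding matrix_vector_mult_minus inner_minus_right one uM by (simp add: field_simps)
  qed (use z symM in \<open>auto intro: Sym_add Sym_scaleR Sym_mat Sym_minus simp del: minus_add_distrib\<close>)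
  moreover have "- (M + (3 * \<eta> / 2) *\<^sub>R mat 1) = - (M + (\<eta> / 2) *\<^sub>R mat 1) - \<eta> *\<^sub>R mat 1"
  proof -
    have "(3 * \<eta> / 2) *\<^sub>R mat 1 = (\<eta> / 2) *\<^sub>R mat 1 + \<eta> *\<^sub>R (mat 1 :: real^'n^'n)"
      unfolding scaleR_add_left[symmetric] by simp
    then show ?thesis by simp
  qed
  ultimately show ?thesis by metis
qed

section \<open>Contact points of semiconvex functions\<close>

text \<open>Otherwise every small ball about a point of E contains a proportional hole. For a disjoint Vitali
  subfamily of balls inside a thin neighbourhood of E, the holes have total measure at least a fixed
  fraction of that of E, but they lie in the thin remainder.\<close>
lemma dense_at_some_scale:
  fixes E :: "'a::euclidean_space set"
  assumes E: "compact E" "\<not> negligible E" and \<delta>: "0 < \<delta>" "\<delta> \<le> 1/2" and r0: "0 < r0"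
  shows "\<exists>x\<in>E. \<exists>d. 0 < d \<and> d < r0 \<and> (\<forall>z\<in>cball x (d / 2). \<exists>y\<in>E. dist z y < \<delta> * d)"
proof (rule ccontr)
  assume contr: "\<not> ?thesis"
  define n where "n = DIM('a)"
  define V where "V = unit_ball_vol (real DIM('a))"
  have V: "V > 0" unfolding V_def by (rule unit_ball_vol_pos) simp
  have lmE: "E \<in> lmeasurable" using lmeasurable_compact[OF E(1)] .
  have mE: "measure lebesgue E > 0"
    using E(2) negligible_iff_measure[of E] lmE by (simp add: zero_less_measure_iff) 
  \<comment> \<open>Vitali enlargement by 5 and shrinking each ball to its hole together cost the
    factor (5 / \<delta>)^n; \<epsilon> is calibrated so that this factor times the measure of W - E
    stays below the measure of E.\<close>
  define \<epsilon> where "\<epsilon> = (\<delta> / 5) ^ n * measure lebesgue E"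
  have \<epsilon>: "\<epsilon> > 0" unfolding \<epsilon>_def using \<delta> mE by simp
  obtain W where W: "open W" "E \<subseteq> W" "W - E \<in> lmeasurable" "emeasure lebesgue (W - E) < ennreal \<epsilon>"
    using sets_lebesgue_outer_open[of E \<epsilon>] lmE \<epsilon> by (auto simp: fmeasurable_def)
  have "measure lebesgue (W - E) < \<epsilon>"
    using W(3,4) \<epsilon> by (metis emeasure_eq_measure2 ennreal_less_iff measure_nonneg)
  have "\<exists>d. 0 < d \<and> d < r0 \<and> ball x d \<subseteq> W" if "x \<in> E" for x
  proof -
    obtain e where e: "e > 0" "ball x e \<subseteq> W" using W(1,2) \<open>x \<in> E\<close> open_contains_ball by blast
    have "ball x (min e (r0 / 2)) \<subseteq> W" using e by auto
    then show ?thesis using e(1) r0 by (intro exI[of _ "min e (r0 / 2)"]) auto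
  qed
  then obtain d where d: "\<And>x. x \<in> E \<Longrightarrow> 0 < d x" "\<And>x. x \<in> E \<Longrightarrow> d x < r0" "\<And>x. x \<in> E \<Longrightarrow> ball x (d x) \<subseteq> W"
    by metis
  have "\<exists>z\<in>cball x (d x / 2). \<forall>y\<in>E. \<delta> * d x \<le> dist z y" if "x \<in> E" for x
    using contr d(1,2)[OF that] that by (metis not_less)
  then obtain h where h: "\<And>x. x \<in> E \<Longrightarrow> dist x (h x) \<le> d x / 2" "\<And>x y. x \<in> E \<Longrightarrow> y \<in> E \<Longrightarrow> \<delta> * d x \<le> dist (h x) y"
    by (metis mem_cball)
  obtain T where T: "T \<subseteq> E" "finite T" "E \<subseteq> (\<Union>x\<in>T. ball x (d x))"
    by (rule compactE_image[OF E(1), of E "\<lambda>x. ball x (d x)"]) (use d(1) in auto)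
  obtain C where C: "C \<subseteq> T" "pairwise (\<lambda>i j. disjnt (ball i (d i)) (ball j (d j))) C" "E \<subseteq> (\<Union>i\<in>C. ball i (5 * d i))"
  proof (rule Vitali_covering_lemma_balls[of E "\<lambda>x. x" d T r0])
    show "0 < d i \<and> d i \<le> r0" if "i \<in> T" for i using that T(1) d(1,2)[of i] by auto
  qed (use T in auto)
  have fC: "finite C" "C \<subseteq> E" using C(1) T finite_subset by blast+
  \<comment> \<open>The hole is centred within half a radius of i and \<delta> is at most 1/2, so it
    stays in its ball; the holes thus inherit disjointness and lie in W.\<close>
  have sub: "ball (h i) (\<delta> * d i) \<subseteq> ball i (d i)" if "i \<in> C" for i
  proof
    fix y assume "y \<in> ball (h i) (\<delta> * d i)"
    moreover have "\<delta> * d i \<le> (1/2) * d i" using \<delta> d(1)[of i] that fC by (intro mult_right_mono) (auto intro: less_imp_le)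
    moreover have "dist i (h i) \<le> d i / 2" using h(1) that fC by auto
    ultimately show "y \<in> ball i (d i)" using dist_triangle[of i y "h i"] by simp
  qed
  have "measure lebesgue E \<le> measure lebesgue (\<Union>i\<in>C. ball i (5 * d i))"
    by (rule measure_mono_fmeasurable[OF C(3)]) (use fmeasurableD[OF lmE] fC in \<open>auto intro!: fmeasurable.finite_UN\<close>)
  also have "\<dots> \<le> (\<Sum>i\<in>C. measure lebesgue (ball i (5 * d i)))"
    by (rule measure_UNION_le) (use fC in auto)
  also have "\<dots> = (\<Sum>i\<in>C. (5 / \<delta>) ^ n * measure lebesgue (ball (h i) (\<delta> * d i)))"
  proof (rule sum.cong[OF refl])
    fix i assume i: "i \<in> C"
    then have di: "d i > 0" using d(1) fC by auto
    have "measure lebesgue (ball i (5 * d i)) = V * (5 * d i) ^ n" "measure lebesgue (ball (h i) (\<delta> * d i)) = V * (\<delta> * d i) ^ n"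
      using di \<delta> unfolding V_def n_def by (simp_all add: content_ball)
    then show "measure lebesgue (ball i (5 * d i)) = (5 / \<delta>) ^ n * measure lebesgue (ball (h i) (\<delta> * d i))"
      using \<delta> by (simp add: power_mult_distrib power_divide)
  qed
  also have "\<dots> = (5 / \<delta>) ^ n * measure lebesgue (\<Union>i\<in>C. ball (h i) (\<delta> * d i))"
  proof -
    have "pairwise (\<lambda>i j. disjnt (ball (h i) (\<delta> * d i)) (ball (h j) (\<delta> * d j))) C"
      using C(2) sub unfolding pairwise_def by (meson disjnt_subset1 disjnt_subset2)
    then have "measure lebesgue (\<Union>i\<in>C. ball (h i) (\<delta> * d i)) = (\<Sum>i\<in>C. measure lebesgue (ball (h i) (\<delta> * d i)))"
      by (intro measure_UNION') (use fC in auto)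
    then show ?thesis by (simp add: sum_distrib_left)
  qed
  also have "\<dots> \<le> (5 / \<delta>) ^ n * measure lebesgue (W - E)"
  proof (intro mult_left_mono measure_mono_fmeasurable)
    show "(\<Union>i\<in>C. ball (h i) (\<delta> * d i)) \<subseteq> W - E"
    proof
      fix y assume "y \<in> (\<Union>i\<in>C. ball (h i) (\<delta> * d i))"
      then obtain i where i: "i \<in> C" "y \<in> ball (h i) (\<delta> * d i)" by blast
      then have "y \<in> W" using sub d(3) fC by blast
      moreover have "y \<notin> E" using h(2)[of i y] i fC by auto
      ultimately show "y \<in> W - E" by blast
    qed
  qed (use W \<delta> fC in \<open>auto intro!: sets.finite_UN\<close>)
  also have "\<dots> < (5 / \<delta>) ^ n * \<epsilon>" using \<open>measure lebesgue (W - E) < \<epsilon>\<close> \<delta> by (intro mult_strict_left_mono) auto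
  also have "\<dots> = measure lebesgue E" unfolding \<epsilon>_def using \<delta> by (simp add: power_divide)
  finally show False by simp
qed

lemma norm_shift_square:
  fixes x :: "'a::real_inner"
  shows "(norm (z - x0))\<^sup>2 - (norm (x - x0))\<^sup>2 = 2 * ((x - x0) \<bullet> (z - x)) + (norm (z - x))\<^sup>2"
  by (simp add: power2_norm_eq_inner inner_diff_left inner_diff_right inner_commute)

text \<open>The two lower paraboloids and the upper bound on the sum trap each function from both
  sides. As x is interior to K, the linear terms at the maximum must balance, so the perturbation p
  is recovered from the slopes.\<close>

lemma contact_at_max:
  fixes u v :: "'a::real_inner \<Rightarrow> real"
  assumes \<rho>: "0 < \<rho>" "ball x \<rho> \<subseteq> K" and \<eta>: "0 \<le> \<eta>"
    and a: "paraboloid_below N K u x a" and b: "paraboloid_below N K v x b"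
    and mx: "\<And>z. z \<in> K \<Longrightarrow> u z + v z + \<eta> * (norm (z - x0))\<^sup>2 - p \<bullet> z \<le> u x + v x + \<eta> * (norm (x - x0))\<^sup>2 - p \<bullet> x"
  shows "contact_at N \<eta> K u v x a b" and "p = a + b + (2 * \<eta>) *\<^sub>R (x - x0)"
proof -
  have m: "u z + v z - u x - v x + \<eta> * (2 * ((x - x0) \<bullet> (z - x)) + (norm (z - x))\<^sup>2) - p \<bullet> (z - x) \<le> 0" if "z \<in> K" for z
    using mx[OF that] unfolding norm_shift_square[symmetric] by (simp add: algebra_simps)
  have la: "u x + a \<bullet> (z - x) - N * (norm (z - x))\<^sup>2 \<le> u z" and lb: "v x + b \<bullet> (z - x) - N * (norm (z - x))\<^sup>2 \<le> v z" if "z \<in> K" for z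
    using a b that unfolding paraboloid_below_def by blast+
  have "a + b + (2 * \<eta>) *\<^sub>R (x - x0) - p = 0"
  proof (rule eq_0_of_inner_le_square_local[OF _ \<rho>(1)])
    fix z :: 'a assume "norm z < \<rho>"
    then have "x + z \<in> K" using \<rho>(2) by (auto simp: dist_norm)
    from m[OF this] la[OF this] lb[OF this]
    show "(a + b + (2 * \<eta>) *\<^sub>R (x - x0) - p) \<bullet> z \<le> (2 * N - \<eta>) * (norm z)\<^sup>2"
      by (simp add: inner_add_left inner_diff_left algebra_simps)
  qed
  then show p: "p = a + b + (2 * \<eta>) *\<^sub>R (x - x0)" by simp
  show "contact_at N \<eta> K u v x a b"
    unfolding contact_at_def
  proof
    fix z assume z: "z \<in> K"
    have "u z + v z - u x - v x - (a + b) \<bullet> (z - x) \<le> - \<eta> * (norm (z - x))\<^sup>2"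
      using m[OF z] unfolding p by (simp add: inner_add_left algebra_simps)
    moreover have "0 \<le> \<eta> * (norm (z - x))\<^sup>2" using \<eta> by simp
    ultimately show "\<bar>u z - u x - a \<bullet> (z - x)\<bar> \<le> N * (norm (z - x))\<^sup>2 \<and>
       \<bar>v z - v x - b \<bullet> (z - x)\<bar> \<le> N * (norm (z - x))\<^sup>2 \<and>
       u z + v z - u x - v x - (a + b) \<bullet> (z - x) \<le> - \<eta> * (norm (z - x))\<^sup>2"
      using la[OF z] lb[OF z] by (auto simp: abs_le_iff inner_add_left)
  qed
qed

text \<open>Compare the expansions of u + v about x and about y at a point displaced from x by h =
  |y - x| along the difference of the slopes. The squared distances involved are at most h^2, 4 h^2
  and h^2, each with constant 2 * N, whence 12.\<close>

lemma contact_at_slope_lipschitz: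
  fixes u v :: "'a::real_inner \<Rightarrow> real"
  assumes x: "contact_at N \<eta> K u v x a b" and y: "contact_at N \<eta> K u v y a' b'" and N: "0 \<le> N"
    and K: "ball x \<rho> \<subseteq> K" "dist x y < \<rho>"
  shows "norm ((a' + b') - (a + b)) \<le> 12 * N * norm (y - x)"
\<comment> \<open>For y = x the two pairs are separate witnesses at one point; their sums agree
  because x is interior to K.\<close>
proof (cases "y = x")
  case True
  then have "\<bar>u z - u x - a \<bullet> (z - x)\<bar> \<le> N * (norm (z - x))\<^sup>2 \<and> \<bar>v z - v x - b \<bullet> (z - x)\<bar> \<le> N * (norm (z - x))\<^sup>2 \<and> 
    \<bar>u z - u x - a' \<bullet> (z - x)\<bar> \<le> N * (norm (z - x))\<^sup>2 \<and> \<bar>v z - v x - b' \<bullet> (z - x)\<bar> \<le> N * (norm (z - x))\<^sup>2" if "z \<in> K" for z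
    using x y that unfolding contact_at_def by blast
  note * = this
  have *: "((a' + b') - (a + b)) \<bullet> (z - x) \<le> 4 * (N * (norm (z - x))\<^sup>2)" if "z \<in> K" for z
    using *[OF that] \<open>z \<in> K\<close> unfolding abs_le_iff inner_add_left inner_diff_left by linarith
  have "((a' + b') - (a + b)) = 0"
  proof (rule eq_0_of_inner_le_square_local)
    show "0 < \<rho>" using K(2) True by simp
    fix z :: 'a assume "norm z < \<rho>"
    then have "x + z \<in> K" using K(1) by (auto simp: dist_norm)
    from *[OF this] show "((a' + b') - (a + b)) \<bullet> z \<le> (4 * N) * (norm z)\<^sup>2" by simp
  qed
  then show ?thesis using N by simp
next
  case False
  define s where "s z = u z + v z" for z
  define c c' where "c = a + b" and "c' = a' + b'"
  define h where "h = norm (y - x)"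
  have h: "h > 0" "h < \<rho>" unfolding h_def using False K(2) by (auto simp: dist_norm norm_minus_commute)
  define z where "z = x + h *\<^sub>R sgn (c' - c)"
  have zx: "norm (z - x) \<le> h" unfolding z_def using h by (simp add: norm_sgn)
  have zy: "norm (z - y) \<le> 2 * h" using norm_triangle_ineq4[of "z - x" "y - x"] zx unfolding h_def by simp
  have zK: "z \<in> K" using K(1) zx h by (auto simp: dist_norm norm_minus_commute)
  have xK: "x \<in> K" using K(1) h by auto
  have sx: "\<bar>s w - s x - c \<bullet> (w - x)\<bar> \<le> 2 * (N * (norm (w - x))\<^sup>2)" and sy: "\<bar>s w - s y - c' \<bullet> (w - y)\<bar> \<le> 2 * (N * (norm (w - y))\<^sup>2)"
    if "w \<in> K" for w
    using x y that unfolding contact_at_def s_def c_def c'_def inner_add_left abs_le_iff by (smt (verit, best))+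
  have N1: "N * (norm (z - x))\<^sup>2 \<le> N * h\<^sup>2" using zx N by (intro mult_left_mono power_mono) auto
  have N2: "N * (norm (z - y))\<^sup>2 \<le> N * (4 * h\<^sup>2)" using power_mono[OF zy, of 2] N by (intro mult_left_mono) (auto simp: power_mult_distrib)
  have N3: "N * (norm (x - y))\<^sup>2 = N * h\<^sup>2" unfolding h_def by (simp add: norm_minus_commute)
  have "(c' - c) \<bullet> (z - x) = c' \<bullet> (z - y) - c' \<bullet> (x - y) - c \<bullet> (z - x)" by (simp add: inner_diff_left inner_diff_right)
  then have "(c' - c) \<bullet> (z - x) \<le> 12 * (N * h\<^sup>2)"
    using sx[OF zK] sy[OF zK] sy[OF xK] N1 N2 unfolding N3 by (simp add: abs_le_iff)
  moreover have "(c' - c) \<bullet> (z - x) = h * norm (c' - c)"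
    unfolding z_def by (cases "c' - c = 0") (simp_all add: sgn_div_norm power2_eq_square dot_square_norm)
  ultimately have "h * norm (c' - c) \<le> h * (12 * N * h)" by (simp add: power2_eq_square algebra_simps)
  then show ?thesis using h unfolding c_def c'_def h_def by simp
qed

text \<open>The slope p is a Lipschitz function of the maximum point and takes all values in a ball, so the set
  E of maximum points is not negligible.\<close>
lemma jensen_matrices:
  fixes u v :: "real^'n \<Rightarrow> real"
  assumes \<eta>: "0 < \<eta>" and N: "0 \<le> N" and K: "compact K" "K \<noteq> {}" and G: "open G" "G \<subseteq> K" and r: "0 < r"
    and cu: "continuous_on K u" and cv: "continuous_on K v"
    and pu: "\<And>x. x \<in> K \<Longrightarrow> \<exists>a. paraboloid_below N K u x a"
    and pv: "\<And>x. x \<in> K \<Longrightarrow> \<exists>b. paraboloid_below N K v x b"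
    and inG: "\<And>p x. norm p \<le> r \<Longrightarrow> x \<in> K \<Longrightarrow>
        (\<And>z. z \<in> K \<Longrightarrow> u z + v z + \<eta> * (norm (z - x0))\<^sup>2 - p \<bullet> z \<le> u x + v x + \<eta> * (norm (x - x0))\<^sup>2 - p \<bullet> x) \<Longrightarrow> x \<in> G"
    and tu: "touch_sphere F G u" and tv: "touch_sphere F' G v"
  shows "\<exists>A. A \<in> F \<and> - A - \<eta> *\<^sub>R mat 1 \<in> F'"
proof -
  define f where "f z = u z + v z + \<eta> * (norm (z - x0))\<^sup>2" for z
  have cf: "continuous_on K f" unfolding f_def by (intro continuous_intros cu cv)
  define E where "E = {x\<in>K. \<exists>p. norm p \<le> r \<and> (\<forall>z\<in>K. f z - p \<bullet> z \<le> f x - p \<bullet> x)}"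
  have EG: "E \<subseteq> G" unfolding E_def f_def using inG by blast
  \<comment> \<open>E is the projection of a compact set of pairs of a maximum point and a
    perturbation.\<close>
  have cE: "compact E"
  proof -
    define S where "S z = {w \<in> K \<times> cball 0 r. f z - snd w \<bullet> z \<le> f (fst w) - snd w \<bullet> fst w}" for z
    have cl: "closed (K \<times> cball (0::real^'n) r)" using K(1) by (intro closed_Times compact_imp_closed) auto
    have "closed (S z)" for z
      unfolding S_def
      by (rule continuous_on_closed_Collect_le[OF _ _ cl])
         (intro continuous_intros continuous_on_compose2[OF cf]; force)+
    then have "compact (K \<times> cball (0::real^'n) r \<inter> (\<Inter>z\<in>K. S z))"
      using K(1) by (intro compact_Int_closed compact_Times closed_INT) auto
    then have "compact (fst ` (K \<times> cball (0::real^'n) r \<inter> (\<Inter>z\<in>K. S z)))"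
      by (intro compact_continuous_image continuous_intros)
    moreover have "fst ` (K \<times> cball (0::real^'n) r \<inter> (\<Inter>z\<in>K. S z)) = E"
      unfolding E_def S_def by (force simp: image_iff)
    ultimately show ?thesis by simp
  qed
  have exE: "\<exists>x\<in>E. \<forall>z\<in>K. f z - p \<bullet> z \<le> f x - p \<bullet> x" if p: "norm p \<le> r" for p
  proof -
    obtain x where "x \<in> K" "\<forall>z\<in>K. f z - p \<bullet> z \<le> f x - p \<bullet> x"
      using continuous_attains_sup[OF K(1,2), of "\<lambda>z. f z - p \<bullet> z"] cf
        continuous_on_diff[OF cf continuous_on_inner[OF continuous_on_const continuous_on_id], of p] by (auto simp: id_def)
    then show ?thesis unfolding E_def using p by blast
  qed
  obtain \<rho> where \<rho>: "0 < \<rho>" "(\<Union>x\<in>E. ball x \<rho>) \<subseteq> G"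
    by (rule compact_subset_open_imp_ball_epsilon_subset[OF cE G(1) EG])
  have ballG: "ball x \<rho> \<subseteq> G" if "x \<in> E" for x using \<rho>(2) that by blast
  have EK: "E \<subseteq> K" unfolding E_def by blast
  have "\<exists>a b. contact_at N \<eta> K u v x a b \<and> (\<forall>p. norm p \<le> r \<longrightarrow> (\<forall>z\<in>K. f z - p \<bullet> z \<le> f x - p \<bullet> x) \<longrightarrow> p = a + b + (2 * \<eta>) *\<^sub>R (x - x0))"
    if x: "x \<in> E" for x
  proof -
    obtain a b where ab: "paraboloid_below N K u x a" "paraboloid_below N K v x b" using pu pv x EK by blast
    have bK: "ball x \<rho> \<subseteq> K" using ballG[OF x] G(2) by blast
    have "contact_at N \<eta> K u v x a b \<and> p = a + b + (2 * \<eta>) *\<^sub>R (x - x0)" if "\<forall>z\<in>K. f z - p \<bullet> z \<le> f x - p \<bullet> x" for p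
      using contact_at_max[OF \<rho>(1) bK less_imp_le[OF \<eta>] ab, of x0 p] that unfolding f_def by blast
    then show ?thesis using x unfolding E_def by blast
  qed
  then obtain a b where ab: "\<And>x. x \<in> E \<Longrightarrow> contact_at N \<eta> K u v x (a x) (b x)"
    and p: "\<And>x p. x \<in> E \<Longrightarrow> norm p \<le> r \<Longrightarrow> \<forall>z\<in>K. f z - p \<bullet> z \<le> f x - p \<bullet> x \<Longrightarrow> p = a x + b x + (2 * \<eta>) *\<^sub>R (x - x0)"
    by metis
  \<comment> \<open>The inverse of the relation between perturbations and maximum points: a point of
    E determines its p.\<close>
  define g where "g x = a x + b x + (2 * \<eta>) *\<^sub>R (x - x0)" for x
  have nE: "\<not> negligible E"
  proof
    assume "negligible E"
    then have "negligible (g ` E)"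
    proof (rule negligible_locally_Lipschitz_image[rotated])
      fix x assume x: "x \<in> E"
      show "\<exists>T B. open T \<and> x \<in> T \<and> (\<forall>y\<in>E \<inter> T. norm (g y - g x) \<le> B * norm (y - x))"
      proof (intro exI conjI ballI)
        show "open (ball x \<rho>)" "x \<in> ball x \<rho>" using \<rho>(1) by auto
        fix y assume y: "y \<in> E \<inter> ball x \<rho>"
        have "norm ((a y + b y) - (a x + b x)) \<le> 12 * N * norm (y - x)"
          by (rule contact_at_slope_lipschitz[OF ab[OF x] ab N, of y \<rho>]) (use y ballG[OF x] G(2) in auto)
        moreover have eq: "g y - g x = ((a y + b y) - (a x + b x)) + (2 * \<eta>) *\<^sub>R (y - x)"
          unfolding g_def by (simp add: algebra_simps)
        ultimately have "norm (g y - g x) \<le> 12 * N * norm (y - x) + norm ((2 * \<eta>) *\<^sub>R (y - x))"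
          unfolding eq
          using norm_triangle_ineq[of "(a y + b y) - (a x + b x)" "(2 * \<eta>) *\<^sub>R (y - x)"] by linarith
        then show "norm (g y - g x) \<le> (12 * N + 2 * \<eta>) * norm (y - x)"
          using \<eta> by (simp add: distrib_right)
      qed
    qed simp
    moreover have "ball 0 r \<subseteq> g ` E"
    proof
      fix q :: "real^'n" assume "q \<in> ball 0 r"
      then have q: "norm q \<le> r" by simp
      obtain x where "x \<in> E" "\<forall>z\<in>K. f z - q \<bullet> z \<le> f x - q \<bullet> x" using exE[OF q] by blast
      then show "q \<in> g ` E" using p[OF _ q] unfolding g_def by blast
    qed
    ultimately have "negligible (ball (0::real^'n) r)" using negligible_subset by blast
    then show False using open_not_negligible[of "ball (0::real^'n) r"] r by simp
  qed
  have "\<exists>U V. near_family N \<eta> F F' k U V" for k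
  proof -
    \<comment> \<open>With t = d / (2 * (k + 1)) the ball of radius k is carried into that of radius
      d / 2, and a distance \<delta> * d becomes 1 / (k + 1) after rescaling.\<close>
    define \<delta> where "\<delta> = 1 / (2 * (real k + 1)\<^sup>2)"
    have k1: "1 \<le> (real k + 1)\<^sup>2" by simp
    have \<delta>: "0 < \<delta>" "\<delta> \<le> 1/2" unfolding \<delta>_def using k1 by (auto simp: divide_simps)
    obtain x d where x: "x \<in> E" "0 < d" "d < \<rho>" and dense: "\<forall>z\<in>cball x (d / 2). \<exists>y\<in>E. dist z y < \<delta> * d"
      using dense_at_some_scale[OF cE nE \<delta> \<rho>(1)] by blast
    define t where "t = d / (2 * (real k + 1))"
    have t: "t > 0" unfolding t_def using x by simp
    have inb: "x + t *\<^sub>R z \<in> cball x (d / 2)" if "z \<in> cball 0 (real k)" for z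
    proof -
      have "t * norm z \<le> t * (real k + 1)" using that t by (intro mult_left_mono) auto
      also have "\<dots> = d / 2" unfolding t_def by (simp add: field_simps)
      finally show ?thesis using t by (simp add: dist_norm)
    qed
    have GG: "x + t *\<^sub>R z \<in> G" if "z \<in> cball 0 (real k)" for z
      using inb[OF that] ballG[OF x(1)] x by auto
    then have KK: "x + t *\<^sub>R z \<in> K" if "z \<in> cball 0 (real k)" for z using that G(2) by blast
    have t0: "t \<noteq> 0" using t by simp
    define U V where "U = rescale t x (a x) u" and "V = rescale t x (b x) v"
    have "contact_at N \<eta> (cball 0 (real k)) U V 0 ((a x - a x) /\<^sub>R t) ((b x - b x) /\<^sub>R t)"
      unfolding U_def V_def by (rule rescale_contact_at[OF t0 _ KK]) (use ab[OF x(1)] in auto)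
    moreover have "U 0 = 0" "V 0 = 0" unfolding U_def V_def rescale_def by auto
    ultimately have gr: "\<bar>U z\<bar> \<le> N * (norm z)\<^sup>2 \<and> \<bar>V z\<bar> \<le> N * (norm z)\<^sup>2" if "z \<in> cball 0 (real k)" for z
      using that unfolding contact_at_def by auto
    have pb: "(\<exists>a. paraboloid_below N (cball 0 (real k)) U z a) \<and> (\<exists>b. paraboloid_below N (cball 0 (real k)) V z b)" if z: "z \<in> cball 0 (real k)" for z
    proof -
      obtain a' b' where "paraboloid_below N K u (x + t *\<^sub>R z) a'" "paraboloid_below N K v (x + t *\<^sub>R z) b'" using pu pv KK[OF z] by blast
      then show ?thesis unfolding U_def V_def using rescale_paraboloid_below[OF t0 _ KK] by blast
    qed
    have ct: "\<exists>y a b. dist z y \<le> 1 / (real k + 1) \<and> contact_at N \<eta> (cball 0 (real k)) U V y a b" if z: "z \<in> cball 0 (real k)" for z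
    proof -
      obtain w where w: "w \<in> E" "dist (x + t *\<^sub>R z) w < \<delta> * d" using dense inb[OF z] by blast
      define y where "y = (w - x) /\<^sub>R t"
      have wy: "w = x + t *\<^sub>R y" unfolding y_def using t by simp
      have "(x + t *\<^sub>R z) - w = t *\<^sub>R (z - y)" unfolding wy by (simp add: algebra_simps)
      then have "t * dist z y < \<delta> * d" using w(2) t by (simp add: dist_norm)
      moreover have "\<delta> * d = t * (1 / (real k + 1))" unfolding \<delta>_def t_def by (simp add: power2_eq_square)
      ultimately have "t * dist z y < t * (1 / (real k + 1))" by simp
      then have "dist z y < 1 / (real k + 1)" using t by (simp only: mult_less_cancel_left_pos)
      moreover have "contact_at N \<eta> (cball 0 (real k)) U V y ((a w - a x) /\<^sub>R t) ((b w - b x) /\<^sub>R t)"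
        unfolding U_def V_def by (rule rescale_contact_at[OF t0 _ KK]) (use ab[OF w(1)] wy in auto)
      ultimately show ?thesis by (blast intro: less_imp_le)
    qed
    have "touch_sphere F (cball 0 (real k)) U" "touch_sphere F' (cball 0 (real k)) V"
      unfolding U_def V_def by (rule rescale_touch_sphere[OF t0 tu GG] rescale_touch_sphere[OF t0 tv GG]; assumption)+
    then show ?thesis using gr pb ct unfolding near_family_def by blast
  qed
  then obtain U V where UV: "\<And>k. near_family N \<eta> F F' k (U k) (V k)" by metis
  obtain s u' v' where "c11_family N \<eta> F F' u' v'"
    by (rule near_family_lim[of N \<eta> F F' U V], rule N, rule UV)
  from c11_family_matrices[OF N \<eta> this] show ?thesis .
qed

section \<open>Sup-convolution\<close>

definition usc_real :: "'a::topological_space set \<Rightarrow> ('a \<Rightarrow> real) \<Rightarrow> bool" where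
  "usc_real X u \<longleftrightarrow> (\<forall>x\<in>X. \<forall>c. u x < c \<longrightarrow> (\<forall>\<^sub>F y in at x within X. u y < c))"

text \<open>Testing with quadratic polynomials keeps calculus out of the comparison argument; the
  link with C^2 test functions is made by \<open>F_subharmonic_viscosity_sub\<close> and
  \<open>viscosity_sub_F_subharmonic\<close>.\<close>

definition viscosity_sub :: "(real^'n^'n) set \<Rightarrow> (real^'n) set \<Rightarrow> (real^'n \<Rightarrow> real) \<Rightarrow> bool" where
  "viscosity_sub F X u \<longleftrightarrow> usc_real X u \<and>
     (\<forall>y\<in>X. \<forall>A\<in>Sym. \<forall>q. quad_poly A q \<longrightarrow> q y = u y \<longrightarrow> (\<forall>\<^sub>F z in nhds y. u z \<le> q z) \<longrightarrow> A \<in> F)"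

lemma usc_real_nhds:
  "usc_real X u \<longleftrightarrow> (\<forall>x\<in>X. \<forall>c. u x < c \<longrightarrow> (\<forall>\<^sub>F y in nhds x. y \<in> X \<longrightarrow> u y < c))"
  unfolding usc_real_def eventually_at_filter
  by (intro ball_cong refl all_cong1 imp_cong) (auto elim: eventually_mono)

lemma usc_real_subset: "usc_real X u \<Longrightarrow> Y \<subseteq> X \<Longrightarrow> usc_real Y u"
  unfolding usc_real_nhds by (blast intro: eventually_mono)

lemma usc_real_continuous:
  assumes "continuous_on X u"
  shows "usc_real X u"
  unfolding usc_real_def
proof (intro ballI allI impI)
  fix x c assume "x \<in> X" "u x < c"
  then show "\<forall>\<^sub>F y in at x within X. u y < c"
    using assms unfolding continuous_on_def using order_tendstoD(2) by blast
qed

lemma usc_real_add: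
  assumes u: "usc_real X u" and v: "usc_real X v"
  shows "usc_real X (\<lambda>x. u x + v x)"
  unfolding usc_real_nhds
proof (intro ballI allI impI)
  fix x c assume x: "x \<in> X" and lt: "u x + v x < c"
  define e where "e = (c - u x - v x) / 2"
  have "u x < u x + e" "v x < v x + e" unfolding e_def using lt by auto
  then have "\<forall>\<^sub>F y in nhds x. y \<in> X \<longrightarrow> u y < u x + e" "\<forall>\<^sub>F y in nhds x. y \<in> X \<longrightarrow> v y < v x + e"
    using u v x unfolding usc_real_nhds by blast+
  then show "\<forall>\<^sub>F y in nhds x. y \<in> X \<longrightarrow> u y + v y < c"
    by eventually_elim (auto simp: e_def field_simps)
qed

lemma usc_real_seq:
  assumes "usc_real X u" "x \<in> X" "u x < c" "xs \<longlonglongrightarrow> x" "\<And>n. xs n \<in> X"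
  shows "\<forall>\<^sub>F n in sequentially. u (xs n) < c"
proof -
  have "\<forall>\<^sub>F y in nhds x. y \<in> X \<longrightarrow> u y < c" using assms(1-3) unfolding usc_real_nhds by blast
  then have "\<forall>\<^sub>F n in sequentially. xs n \<in> X \<longrightarrow> u (xs n) < c"
    using assms(4) unfolding filterlim_iff by blast
  then show ?thesis using assms(5) by simp
qed

text \<open>Without a maximum every point has a neighbourhood on which u stays below the value at a
  better point; the best of the better points of a finite subcover would have to beat
  itself.\<close>

lemma usc_real_attains_sup:
  assumes K: "compact K" "K \<noteq> {}" and u: "usc_real K u"
  shows "\<exists>x\<in>K. \<forall>y\<in>K. u y \<le> u x"
proof (rule ccontr)
  assume "\<not> ?thesis"
  then have "\<forall>x\<in>K. \<exists>y\<in>K. u x < u y" by (simp add: not_le)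
  then obtain g where g: "\<And>x. x \<in> K \<Longrightarrow> g x \<in> K" "\<And>x. x \<in> K \<Longrightarrow> u x < u (g x)" by metis
  have "\<exists>S. open S \<and> x \<in> S \<and> (\<forall>y\<in>S. y \<in> K \<longrightarrow> u y < u (g x))" if "x \<in> K" for x
    using u g(2)[OF that] that unfolding usc_real_nhds eventually_nhds by blast
  then obtain S where S: "\<And>x. x \<in> K \<Longrightarrow> open (S x)" "\<And>x. x \<in> K \<Longrightarrow> x \<in> S x"
    "\<And>x y. x \<in> K \<Longrightarrow> y \<in> S x \<Longrightarrow> y \<in> K \<Longrightarrow> u y < u (g x)" by metis
  obtain T where T: "T \<subseteq> K" "finite T" "K \<subseteq> (\<Union>x\<in>T. S x)"
    by (rule compactE_image[OF K(1), of K S]) (use S in auto)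
  have Tne: "T \<noteq> {}" using T(3) K(2) by auto
  define m where "m = Max ((\<lambda>x. u (g x)) ` T)"
  have "m \<in> (\<lambda>x. u (g x)) ` T" unfolding m_def using T(2) Tne by (intro Max_in) auto
  then obtain t where t: "t \<in> T" "m = u (g t)" by auto
  obtain t' where "t' \<in> T" "g t \<in> S t'" using T g(1) t(1) by blast
  then have "u (g t) < u (g t')" using S(3) T(1) g(1) t(1) by blast
  moreover have "u (g t') \<le> m" unfolding m_def using T(2) \<open>t' \<in> T\<close> by (intro Max_ge) auto
  ultimately show False using t(2) by simp
qed

lemma quad_poly_add_const: "quad_poly A q \<Longrightarrow> quad_poly A (\<lambda>z. q z + k)"
  using quad_poly_affine_subst[of 1 A q 0 k 0] by simp

text \<open>The maximum of u - q over the closed ball avoids the sphere, so q raised by a constant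
  touches u at an interior point.\<close>

lemma viscosity_sub_touch_sphere:
  fixes F :: "(real^'n^'n) set"
  assumes u: "viscosity_sub F X u"
  shows "touch_sphere F X u"
  unfolding touch_sphere_def
proof (intro ballI allI impI)
  fix A :: "real^'n^'n" and q y r x
  assume A: "A \<in> Sym" and q: "quad_poly A q" and c: "cball y r \<subseteq> X" and x: "x \<in> ball y r"
    and lt: "\<forall>z\<in>sphere y r. u z - q z < u x - q x"
  have "usc_real X u" using u unfolding viscosity_sub_def by blast
  then have "usc_real (cball y r) (\<lambda>z. u z + - q z)"
    by (intro usc_real_add[OF usc_real_subset[OF _ c] usc_real_continuous[OF continuous_on_minus[OF quad_poly_continuous[OF q]]]])
  moreover have xcb: "x \<in> cball y r" "cball y r \<noteq> {}" using x ball_subset_cball by blast+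
  ultimately obtain z where z: "z \<in> cball y r" "\<And>w. w \<in> cball y r \<Longrightarrow> u w - q w \<le> u z - q z"
    using usc_real_attains_sup[OF compact_cball, of y r "\<lambda>z. u z + - q z"] by auto
  have "z \<notin> sphere y r" using lt z(2)[OF xcb(1)] by (metis linorder_not_less)
  then have zb: "z \<in> ball y r" using z(1) by auto
  have "\<forall>\<^sub>F w in nhds z. w \<in> ball y r" by (rule eventually_nhds_in_open[OF open_ball zb])
  then have "\<forall>\<^sub>F w in nhds z. u w \<le> q w + (u z - q z)"
  proof (rule eventually_mono)
    fix w assume "w \<in> ball y r"
    then have "u w - q w \<le> u z - q z" using z(2) ball_subset_cball by blast
    then show "u w \<le> q w + (u z - q z)" by simp
  qed
  then show "A \<in> F"
    using u A quad_poly_add_const[OF q, of "u z - q z"] zb c unfolding viscosity_sub_def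
    by (elim conjE) (drule bspec[of X _ z], auto)
qed

text \<open>N plays the part of the reciprocal of the usual small parameter. Over a fixed compact K
  the supremum is attained when u is upper semicontinuous.\<close>

definition sup_conv :: "real \<Rightarrow> 'a::real_normed_vector set \<Rightarrow> ('a \<Rightarrow> real) \<Rightarrow> 'a \<Rightarrow> real" where
  "sup_conv N K u x = (SUP y\<in>K. u y - N * (norm (x - y))\<^sup>2)"

lemma sup_conv_attained:
  fixes K :: "'a::real_normed_vector set"
  assumes K: "compact K" "K \<noteq> {}" and u: "usc_real K u"
  shows "\<exists>y\<in>K. sup_conv N K u x = u y - N * (norm (x - y))\<^sup>2"
    and "z \<in> K \<Longrightarrow> u z - N * (norm (x - z))\<^sup>2 \<le> sup_conv N K u x"
proof -
  have "usc_real K (\<lambda>y. u y + - (N * (norm (x - y))\<^sup>2))"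
    by (intro usc_real_add u usc_real_continuous continuous_intros)
  then obtain y where y: "y \<in> K" "\<And>z. z \<in> K \<Longrightarrow> u z - N * (norm (x - z))\<^sup>2 \<le> u y - N * (norm (x - y))\<^sup>2"
    using usc_real_attains_sup[OF K] by force
  then have "sup_conv N K u x = u y - N * (norm (x - y))\<^sup>2"
    unfolding sup_conv_def by (intro cSup_eq_maximum) auto
  then show "\<exists>y\<in>K. sup_conv N K u x = u y - N * (norm (x - y))\<^sup>2"
    and "z \<in> K \<Longrightarrow> u z - N * (norm (x - z))\<^sup>2 \<le> sup_conv N K u x"
    using y by auto
qed

text \<open>The paraboloid with vertex at the maximiser y lies below the convolution by definition
  and meets it at x, where its gradient is 2 * N * (y - x).\<close>

lemma sup_conv_paraboloid_below:
  fixes K :: "'a::real_inner set"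
  assumes K: "compact K" "K \<noteq> {}" and u: "usc_real K u"
    and y: "y \<in> K" "sup_conv N K u x = u y - N * (norm (x - y))\<^sup>2"
  shows "paraboloid_below N S (sup_conv N K u) x ((2 * N) *\<^sub>R (y - x))"
  unfolding paraboloid_below_def
proof
  fix z
  have "u y - N * (norm (z - y))\<^sup>2 \<le> sup_conv N K u z" by (rule sup_conv_attained(2)[OF K u y(1)])
  moreover have "(norm (z - y))\<^sup>2 = (norm (x - y))\<^sup>2 + 2 * ((x - y) \<bullet> (z - x)) + (norm (z - x))\<^sup>2"
    using norm_shift_square[of z y x] by simp
  ultimately show "sup_conv N K u x + ((2 * N) *\<^sub>R (y - x)) \<bullet> (z - x) - N * (norm (z - x))\<^sup>2 \<le> sup_conv N K u z"
    unfolding y(2) by (simp add: algebra_simps inner_diff_left)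
qed

lemma sup_conv_continuous:
  fixes K :: "'a::real_inner set"
  assumes K: "compact K" "K \<noteq> {}" and u: "usc_real K u" and N: "0 \<le> N"
  shows "continuous_on K (sup_conv N K u)"
proof -
  obtain D where D: "D > 0" "\<And>x. x \<in> K \<Longrightarrow> norm x \<le> D" using compact_imp_bounded[OF K(1)] unfolding bounded_pos by blast
  have *: "sup_conv N K u x - sup_conv N K u z \<le> 6 * N * D * norm (x - z)" if xz: "x \<in> K" "z \<in> K" for x z
  proof -
    obtain y where y: "y \<in> K" "sup_conv N K u x = u y - N * (norm (x - y))\<^sup>2" using sup_conv_attained(1)[OF K u] by blast
    have "sup_conv N K u x + ((2 * N) *\<^sub>R (y - x)) \<bullet> (z - x) - N * (norm (z - x))\<^sup>2 \<le> sup_conv N K u z"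
      using sup_conv_paraboloid_below[OF K u y, of UNIV] unfolding paraboloid_below_def by blast
    moreover have "- (((2 * N) *\<^sub>R (y - x)) \<bullet> (z - x)) \<le> 4 * N * D * norm (x - z)"
    proof -
      have "norm (y - x) \<le> 2 * D" using norm_triangle_ineq4[of y x] D(2)[OF xz(1)] D(2)[OF y(1)] by linarith
      then have "norm ((2 * N) *\<^sub>R (y - x)) * norm (z - x) \<le> (2 * N * (2 * D)) * norm (z - x)"
        using N mult_left_mono[of "norm (y - x)" "2 * D" "2 * N"] by (intro mult_right_mono) auto
      then show ?thesis using Cauchy_Schwarz_ineq2[of "(2 * N) *\<^sub>R (y - x)" "z - x"] norm_minus_commute[of z x]
        by (simp only: abs_le_iff) linarith
    qed
    moreover have "N * (norm (z - x))\<^sup>2 \<le> 2 * N * D * norm (x - z)"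
    proof -
      have "norm (z - x) \<le> 2 * D" using norm_triangle_ineq4[of z x] D(2)[OF xz(1)] D(2)[OF xz(2)] by linarith
      then have "norm (z - x) * (N * norm (z - x)) \<le> (2 * D) * (N * norm (z - x))" using N by (intro mult_right_mono) auto
      then show ?thesis by (simp add: power2_eq_square norm_minus_commute algebra_simps)
    qed
    ultimately show ?thesis by linarith
  qed
  have "(6 * N * D)-lipschitz_on K (sup_conv N K u)"
  proof (rule lipschitz_onI)
    fix x z assume xz: "x \<in> K" "z \<in> K"
    show "dist (sup_conv N K u x) (sup_conv N K u z) \<le> 6 * N * D * dist x z"
      using *[OF xz] *[OF xz(2,1)] unfolding dist_norm by (simp add: abs_le_iff norm_minus_commute)
  qed (use N D in auto)
  then show ?thesis by (rule lipschitz_on_continuous_on)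
qed

text \<open>A paraboloid touching the sup-convolution at z touches u, after translation, at the point y
  where the supremum defining the value at z is attained.\<close>
lemma sup_conv_touch_sphere:
  fixes K :: "(real^'n) set"
  assumes K: "compact K" "K \<noteq> {}" and u: "viscosity_sub F X u" and KX: "K \<subseteq> X" and N: "0 \<le> N"
    and G: "open G" "G \<subseteq> K" and G0: "open G0" "G0 \<subseteq> K"
    and mx: "\<And>z y. z \<in> G \<Longrightarrow> y \<in> K \<Longrightarrow> sup_conv N K u z = u y - N * (norm (z - y))\<^sup>2 \<Longrightarrow> y \<in> G0"
  shows "touch_sphere F G (sup_conv N K u)"
  unfolding touch_sphere_def
proof (intro ballI allI impI)
  fix A :: "real^'n^'n" and q y0 r x
  assume A: "A \<in> Sym" and q: "quad_poly A q" and c: "cball y0 r \<subseteq> G" and x: "x \<in> ball y0 r"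
    and lt: "\<forall>z\<in>sphere y0 r. sup_conv N K u z - q z < sup_conv N K u x - q x"
  have usc: "usc_real K u" using u usc_real_subset[OF _ KX] unfolding viscosity_sub_def by blast
  let ?s = "sup_conv N K u"
  have "continuous_on (cball y0 r) (\<lambda>z. ?s z - q z)"
    by (intro continuous_on_diff quad_poly_continuous[OF q] continuous_on_subset[OF sup_conv_continuous[OF K usc N]]) (use c G in blast)
  moreover have xcb: "x \<in> cball y0 r" "cball y0 r \<noteq> {}" using x ball_subset_cball by blast+
  ultimately obtain z where z: "z \<in> cball y0 r" "\<And>w. w \<in> cball y0 r \<Longrightarrow> ?s w - q w \<le> ?s z - q z"
    using continuous_attains_sup[OF compact_cball, of y0 r "\<lambda>z. ?s z - q z"] by blast
  have "z \<notin> sphere y0 r" using lt z(2)[OF xcb(1)] by (metis linorder_not_less)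
  then have zb: "z \<in> ball y0 r" using z(1) by auto
  obtain y where y: "y \<in> K" "?s z = u y - N * (norm (z - y))\<^sup>2" using sup_conv_attained(1)[OF K usc] by blast
  have yG: "y \<in> G0" by (rule mx[OF _ y]) (use z(1) c in auto)
  \<comment> \<open>The translate of q from z to y, raised to the value u y, written in the shape of
    \<open>quad_poly_affine_subst\<close> with t = 1 and slope 0.\<close>
  define q' where "q' = (\<lambda>\<zeta>. 1\<^sup>2 * q ((\<zeta> - (y - z)) /\<^sub>R 1) + (u y - q z) + 0 \<bullet> \<zeta>)"
  have q': "quad_poly A q'" unfolding q'_def by (rule quad_poly_affine_subst[OF _ q]) simp
  have q'_eq: "q' \<zeta> = q (\<zeta> - (y - z)) + (u y - q z)" for \<zeta> unfolding q'_def by simp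
  have "\<forall>\<^sub>F \<zeta> in nhds y. \<zeta> \<in> G0" using G0(1) yG by (simp add: eventually_nhds_in_open)
  moreover have "\<forall>\<^sub>F \<zeta> in nhds y. \<zeta> - (y - z) \<in> ball y0 r"
  proof -
    have "((\<lambda>\<zeta>. \<zeta> - (y - z)) \<longlongrightarrow> y - (y - z)) (nhds y)"
      by (intro tendsto_diff tendsto_const) (simp add: filterlim_ident)
    then show ?thesis using zb by (intro topological_tendstoD[where S="ball y0 r"]) auto
  qed
  ultimately have "\<forall>\<^sub>F \<zeta> in nhds y. u \<zeta> \<le> q' \<zeta>"
  proof eventually_elim
    case (elim \<zeta>)
    have "u \<zeta> - N * (norm ((\<zeta> - (y - z)) - \<zeta>))\<^sup>2 \<le> ?s (\<zeta> - (y - z))"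
      by (rule sup_conv_attained(2)[OF K usc]) (use elim(1) G0 in auto)
    moreover have "?s (\<zeta> - (y - z)) - q (\<zeta> - (y - z)) \<le> ?s z - q z" by (rule z(2)) (use elim(2) in auto)
    ultimately show ?case unfolding q'_eq y(2) by simp
  qed
  moreover have "q' y = u y" unfolding q'_eq by simp
  ultimately show "A \<in> F" using u A q' y(1) KX unfolding viscosity_sub_def by blast
qed

text \<open>One N must serve all points at once. Otherwise there are violating triples for every n;
  the penalty drives y and y' to the limit of x, semicontinuity puts this limit into the superlevel
  set, hence into the open set G0, and the late terms follow.\<close>

lemma sup_conv_localizes:
  fixes K :: "'a::euclidean_space set"
  assumes K: "compact K" and u: "usc_real K u" and v: "usc_real K v" and G0: "open G0"
    and lev: "\<And>x. x \<in> K \<Longrightarrow> \<sigma> \<le> u x + v x \<Longrightarrow> x \<in> G0"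
  shows "\<exists>N\<ge>0. \<forall>x\<in>K. \<forall>y\<in>K. \<forall>y'\<in>K. \<sigma> \<le> u y - N * (norm (x - y))\<^sup>2 + (v y' - N * (norm (x - y'))\<^sup>2) \<longrightarrow> x \<in> G0 \<and> y \<in> G0 \<and> y' \<in> G0"
proof (rule ccontr)
  assume neg: "\<not> ?thesis"
  have "\<exists>x\<in>K. \<exists>y\<in>K. \<exists>y'\<in>K. \<sigma> \<le> u y - (real n + 1) * (norm (x - y))\<^sup>2 + (v y' - (real n + 1) * (norm (x - y'))\<^sup>2) \<and> \<not> (x \<in> G0 \<and> y \<in> G0 \<and> y' \<in> G0)" for n
    using neg[unfolded not_ex, THEN spec, of "real n + 1"] by fastforce
  then obtain x y y' where K3: "\<And>n. x n \<in> K" "\<And>n. y n \<in> K" "\<And>n. y' n \<in> K"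
    and ge: "\<And>n. \<sigma> \<le> u (y n) - (real n + 1) * (norm (x n - y n))\<^sup>2 + (v (y' n) - (real n + 1) * (norm (x n - y' n))\<^sup>2)"
    and out: "\<And>n. \<not> (x n \<in> G0 \<and> y n \<in> G0 \<and> y' n \<in> G0)" by metis
  have Kne: "K \<noteq> {}" using K3 by blast
  obtain mu where mu: "\<And>z. z \<in> K \<Longrightarrow> u z \<le> mu" using usc_real_attains_sup[OF K Kne u] by blast
  obtain mv where mv: "\<And>z. z \<in> K \<Longrightarrow> v z \<le> mv" using usc_real_attains_sup[OF K Kne v] by blast
  define M where "M = mu + mv - \<sigma>"
  obtain l s where l: "l \<in> K" "strict_mono s" "(x \<circ> s) \<longlonglongrightarrow> l"
    using K K3(1) unfolding compact_eq_seq_compact_metric by (elim seq_compactE) auto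
  have close: "(norm (x n - y n))\<^sup>2 \<le> M / (real n + 1) \<and> (norm (x n - y' n))\<^sup>2 \<le> M / (real n + 1)" for n
  proof -
    have "0 \<le> (real n + 1) * (norm (x n - y n))\<^sup>2" "0 \<le> (real n + 1) * (norm (x n - y' n))\<^sup>2" by auto
    then have "(real n + 1) * (norm (x n - y n))\<^sup>2 \<le> M" "(real n + 1) * (norm (x n - y' n))\<^sup>2 \<le> M"
      using ge[of n] mu[OF K3(2), of n] mv[OF K3(3), of n] unfolding M_def by linarith+
    then show ?thesis by (simp add: le_divide_eq mult.commute)
  qed
  have "(\<lambda>n. M * (1 / (real n + 1))) \<longlonglongrightarrow> M * 0"
    using LIMSEQ_inverse_real_of_nat by (intro tendsto_mult tendsto_const) (simp add: inverse_eq_divide add.commute)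
  then have M0: "(\<lambda>n. M / (real n + 1)) \<longlonglongrightarrow> 0" by simp
  have lim: "(\<lambda>n. w (s n)) \<longlonglongrightarrow> l" if "\<And>n. (norm (x n - w n))\<^sup>2 \<le> M / (real n + 1)" for w
  proof -
    have "(\<lambda>n. (norm (x n - w n))\<^sup>2) \<longlonglongrightarrow> 0"
      by (rule tendsto_sandwich[OF _ _ tendsto_const M0]) (use that in auto)
    then have "(\<lambda>n. sqrt ((norm (x n - w n))\<^sup>2)) \<longlonglongrightarrow> sqrt 0" by (rule tendsto_real_sqrt)
    then have "(\<lambda>n. x n - w n) \<longlonglongrightarrow> 0" by (simp add: tendsto_norm_zero_iff)
    then have "(\<lambda>n. x (s n) - w (s n)) \<longlonglongrightarrow> 0" using LIMSEQ_subseq_LIMSEQ[OF _ l(2)] by (force simp: o_def)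
    from tendsto_diff[OF l(3) this] show ?thesis by (simp add: o_def)
  qed
  have yl: "(\<lambda>n. y (s n)) \<longlonglongrightarrow> l" and yl': "(\<lambda>n. y' (s n)) \<longlonglongrightarrow> l" and xl: "(\<lambda>n. x (s n)) \<longlonglongrightarrow> l"
    using lim[of y] lim[of y'] close l(3) by (auto simp: o_def)
  have "\<sigma> \<le> u l + v l"
  proof (rule ccontr)
    assume "\<not> \<sigma> \<le> u l + v l"
    define e where "e = (\<sigma> - u l - v l) / 2"
    have e: "u l < u l + e" "v l < v l + e" using \<open>\<not> \<sigma> \<le> u l + v l\<close> unfolding e_def by auto
    have "\<forall>\<^sub>F n in sequentially. u (y (s n)) < u l + e" "\<forall>\<^sub>F n in sequentially. v (y' (s n)) < v l + e"
      by (rule usc_real_seq[OF u l(1) e(1) yl K3(2)], rule usc_real_seq[OF v l(1) e(2) yl' K3(3)])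
    then have "\<forall>\<^sub>F n in sequentially. False"
    proof eventually_elim
      case (elim n)
      have "0 \<le> (real (s n) + 1) * (norm (x (s n) - y (s n)))\<^sup>2" "0 \<le> (real (s n) + 1) * (norm (x (s n) - y' (s n)))\<^sup>2" by auto
      moreover have "u l + e + (v l + e) = \<sigma>" unfolding e_def by (simp add: field_simps)
      ultimately show ?case using elim ge[of "s n"] by linarith
    qed
    then show False by simp
  qed
  then have lG: "l \<in> G0" using lev l(1) by blast
  have "\<forall>\<^sub>F n in sequentially. x (s n) \<in> G0" "\<forall>\<^sub>F n in sequentially. y (s n) \<in> G0" "\<forall>\<^sub>F n in sequentially. y' (s n) \<in> G0"
    using topological_tendstoD[OF _ G0 lG] xl yl yl' by blast+
  then have "\<forall>\<^sub>F n in sequentially. False" by eventually_elim (use out in blast)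
  then show False by simp
qed

text \<open>Compactness of the superlevel set keeps the maxima of the perturbed sup-convolutions
  away from the boundary of X, in a region where both convolutions still satisfy the sphere form of
  the viscosity condition.\<close>

lemma viscosity_sum_matrices:
  fixes u v :: "real^'n \<Rightarrow> real"
  assumes X: "open X" and u: "viscosity_sub F X u" and v: "viscosity_sub F' X v"
    and x0: "x0 \<in> X" "s < u x0 + v x0" and L: "compact {x\<in>X. s \<le> u x + v x}"
  shows "\<exists>\<eta>>0. \<exists>A. A \<in> F \<and> - A - \<eta> *\<^sub>R mat 1 \<in> F'"
proof -
  define L where "L = {x\<in>X. s \<le> u x + v x}"
  have cL: "compact L" and LX: "L \<subseteq> X" and x0L: "x0 \<in> L" using L x0 unfolding L_def by auto
  obtain e where e: "0 < e" "(\<Union>x\<in>L. cball x e) \<subseteq> X"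
    by (rule compact_subset_open_imp_cball_epsilon_subset[OF cL X LX])
  \<comment> \<open>Closed and open neighbourhoods of the level set: the functions are convolved
    over K, and the maximisers are localised to G0.\<close>
  define K where "K = (\<Union>x\<in>L. cball x e)"
  define G0 where "G0 = (\<Union>x\<in>L. ball x e)"
  have K: "compact K" "K \<noteq> {}" and KX: "K \<subseteq> X" using cL x0L e unfolding K_def by (auto simp: compact_minkowski_sum_cball)
  have G0: "open G0" "G0 \<subseteq> K" "L \<subseteq> G0" unfolding G0_def K_def using e(1) by (auto intro!: open_UN)
  have x0K: "x0 \<in> K" using G0 x0L by blast
  have uu: "usc_real K u" and vv: "usc_real K v" using u v usc_real_subset[OF _ KX] unfolding viscosity_sub_def by blast+
  obtain D0 where D0: "D0 > 0" "\<And>x. x \<in> K \<Longrightarrow> norm x \<le> D0" using compact_imp_bounded[OF K(1)] unfolding bounded_pos by blast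
  define D where "D = 2 * D0"
  have D: "D > 0" "\<And>x. x \<in> K \<Longrightarrow> norm (x - x0) \<le> D"
    using D0 x0K unfolding D_def by (simp, smt (verit) norm_triangle_ineq4)
  define \<tau> where "\<tau> = u x0 + v x0 - s"
  have \<tau>: "\<tau> > 0" unfolding \<tau>_def using x0 by simp
  \<comment> \<open>On K the term with \<eta> changes values by at most \<tau> / 4, and the linear
    perturbation contributes at most \<tau> / 8, so maximum points stay above level s + \<tau> /
    2.\<close>
  define \<eta> where "\<eta> = \<tau> / (4 * D\<^sup>2)"
  have \<eta>: "\<eta> > 0" unfolding \<eta>_def using \<tau> D by simp
  have lev: "x \<in> G0" if "x \<in> K" "s + \<tau> / 2 \<le> u x + v x" for x
    using that KX G0(3) \<tau> unfolding L_def by auto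
  obtain N where N: "N \<ge> 0" and loc: "\<And>x y y'. x \<in> K \<Longrightarrow> y \<in> K \<Longrightarrow> y' \<in> K \<Longrightarrow>
      s + \<tau> / 2 \<le> u y - N * (norm (x - y))\<^sup>2 + (v y' - N * (norm (x - y'))\<^sup>2) \<Longrightarrow> x \<in> G0 \<and> y \<in> G0 \<and> y' \<in> G0"
    using sup_conv_localizes[OF K(1) uu vv G0(1) lev] by metis
  let ?u = "sup_conv N K u" and ?v = "sup_conv N K v"
  have cu: "continuous_on K ?u" and cv: "continuous_on K ?v" by (rule sup_conv_continuous[OF K uu N] sup_conv_continuous[OF K vv N])+
  define G where "G = {x\<in>G0. s + \<tau> / 2 < ?u x + ?v x}"
  have G: "open G" "G \<subseteq> K"
  proof -
    have "continuous_on G0 (\<lambda>x. ?u x + ?v x)" by (intro continuous_on_add continuous_on_subset[OF cu G0(2)] continuous_on_subset[OF cv G0(2)])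
    then have "open (G0 \<inter> (\<lambda>x. ?u x + ?v x) -` {s + \<tau> / 2<..})" by (rule continuous_open_preimage[OF _ G0(1)]) simp
    moreover have "G0 \<inter> (\<lambda>x. ?u x + ?v x) -` {s + \<tau> / 2<..} = G" unfolding G_def by auto
    ultimately show "open G" by simp
    show "G \<subseteq> K" unfolding G_def using G0 by blast
  qed
  have tu: "touch_sphere F G ?u"
  proof (rule sup_conv_touch_sphere[OF K u KX N G G0(1,2)])
    fix z y assume z: "z \<in> G" and y: "y \<in> K" "?u z = u y - N * (norm (z - y))\<^sup>2"
    obtain y' where "y' \<in> K" "?v z = v y' - N * (norm (z - y'))\<^sup>2" using sup_conv_attained(1)[OF K vv] by blast
    then show "y \<in> G0" using loc[of z y y'] z y G unfolding G_def by auto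
  qed
  have tv: "touch_sphere F' G ?v"
  proof (rule sup_conv_touch_sphere[OF K v KX N G G0(1,2)])
    fix z y assume z: "z \<in> G" and y: "y \<in> K" "?v z = v y - N * (norm (z - y))\<^sup>2"
    obtain y' where "y' \<in> K" "?u z = u y' - N * (norm (z - y'))\<^sup>2" using sup_conv_attained(1)[OF K uu] by blast
    then show "y \<in> G0" using loc[of z y' y] z y G unfolding G_def by auto
  qed
  have inG: "x \<in> G" if p: "norm p \<le> \<tau> / (8 * D)" and x: "x \<in> K"
    and mx: "\<And>z. z \<in> K \<Longrightarrow> ?u z + ?v z + \<eta> * (norm (z - x0))\<^sup>2 - p \<bullet> z \<le> ?u x + ?v x + \<eta> * (norm (x - x0))\<^sup>2 - p \<bullet> x" for p x
  proof -
    have "?u x0 + ?v x0 - p \<bullet> x0 \<le> ?u x + ?v x + \<eta> * (norm (x - x0))\<^sup>2 - p \<bullet> x" using mx[OF x0K] by simp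
    moreover have "u x0 \<le> ?u x0" "v x0 \<le> ?v x0"
      using sup_conv_attained(2)[OF K uu x0K, of N x0] sup_conv_attained(2)[OF K vv x0K, of N x0] by auto
    moreover have "\<eta> * (norm (x - x0))\<^sup>2 \<le> \<tau> / 4"
    proof -
      have "\<eta> * (norm (x - x0))\<^sup>2 \<le> \<eta> * D\<^sup>2" using D(2)[OF x] \<eta> by (intro mult_left_mono power_mono) auto
      also have "\<dots> = \<tau> / 4" unfolding \<eta>_def using D by simp
      finally show ?thesis .
    qed
    moreover have "\<bar>p \<bullet> (x - x0)\<bar> \<le> \<tau> / 8"
    proof -
      have "\<bar>p \<bullet> (x - x0)\<bar> \<le> norm p * norm (x - x0)" by (rule Cauchy_Schwarz_ineq2)
      also have "\<dots> \<le> \<tau> / (8 * D) * D" using p D(2)[OF x] \<tau> D by (intro mult_mono) auto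
      also have "\<dots> = \<tau> / 8" using D by simp
      finally show ?thesis .
    qed
    moreover have "p \<bullet> (x - x0) = p \<bullet> x - p \<bullet> x0" by (simp add: inner_diff_right)
    ultimately have gt: "s + \<tau> / 2 < ?u x + ?v x" using x0(2) \<tau> \<tau>_def by linarith
    obtain y where y: "y \<in> K" "?u x = u y - N * (norm (x - y))\<^sup>2" using sup_conv_attained(1)[OF K uu] by blast
    obtain y' where y': "y' \<in> K" "?v x = v y' - N * (norm (x - y'))\<^sup>2" using sup_conv_attained(1)[OF K vv] by blast
    have "x \<in> G0" using loc[OF x y(1) y'(1)] gt y(2) y'(2) by auto
    then show ?thesis unfolding G_def using gt by blast
  qed
  have "\<exists>A. A \<in> F \<and> - A - \<eta> *\<^sub>R mat 1 \<in> F'"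
  proof (rule jensen_matrices[OF \<eta> N K G _ cu cv _ _ inG tu tv])
    show "0 < \<tau> / (8 * D)" using \<tau> D by simp
    show "\<exists>a. paraboloid_below N K ?u x a" for x
      using sup_conv_attained(1)[OF K uu] sup_conv_paraboloid_below[OF K uu] by metis
    show "\<exists>a. paraboloid_below N K ?v x a" for x
      using sup_conv_attained(1)[OF K vv] sup_conv_paraboloid_below[OF K vv] by metis
  qed
  then show ?thesis using \<eta> by blast
qed

section \<open>Subequations and second-order expansions\<close>

text \<open>The last clause is the only instance of closedness that is needed; in this form it also passes to
  the dual.\<close>
definition subeq :: "(real^'n^'n) set \<Rightarrow> bool" where
  "subeq F \<longleftrightarrow> F \<subseteq> Sym
     \<and> (\<forall>A\<in>F. \<forall>B\<in>Sym. (\<forall>z. z \<bullet> (A *v z) \<le> z \<bullet> (B *v z)) \<longrightarrow> B \<in> F)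
     \<and> (\<forall>A\<in>Sym. (\<forall>\<theta>>0. A + \<theta> *\<^sub>R mat 1 \<in> F) \<longrightarrow> A \<in> F)"

lemma quad_form_bound:
  fixes M :: "real^'n^'n"
  shows "\<bar>z \<bullet> (M *v z)\<bar> \<le> (real CARD('n))\<^sup>2 * norm M * (norm z)\<^sup>2"
proof -
  have "onorm (\<lambda>x. M *v x) \<le> real CARD('n) * real CARD('n) * norm M"
  proof (rule onorm_le_matrix_component)
    show "\<bar>M $ i $ j\<bar> \<le> norm M" for i j
      using component_le_norm_cart[of "M $ i" j] Finite_Cartesian_Product.norm_nth_le[of M i] by linarith
  qed
  then have "onorm (\<lambda>x. M *v x) * norm z \<le> real CARD('n) * real CARD('n) * norm M * norm z" by (rule mult_right_mono) simp
  then have "norm (M *v z) \<le> real CARD('n) * real CARD('n) * norm M * norm z"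
    using onorm[OF matrix_vector_mul_bounded_linear[of M], of z] by linarith
  then have "norm z * norm (M *v z) \<le> norm z * (real CARD('n) * real CARD('n) * norm M * norm z)"
    by (rule mult_left_mono) simp
  with Cauchy_Schwarz_ineq2[of z "M *v z"] show ?thesis
    by (simp add: power2_eq_square algebra_simps)
qed

lemma quad_form_add_mat:
  fixes A :: "real^'n^'n"
  shows "z \<bullet> ((A + k *\<^sub>R mat 1) *v z) = z \<bullet> (A *v z) + k * (norm z)\<^sup>2"
  by (simp add: matrix_vector_mult_add_rdistrib matrix_scaleR_vector_mult inner_add_right power2_norm_eq_inner)

lemma psd_diff_iff:
  assumes "A \<in> Sym" "B \<in> Sym"
  shows "psd (B - A) \<longleftrightarrow> (\<forall>z. z \<bullet> (A *v z) \<le> z \<bullet> (B *v z))"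
  using assms unfolding psd_def by (auto simp: Sym_diff matrix_vector_mult_diff_rdistrib inner_diff_right)

lemma cone_subequation_subeq:
  fixes F :: "(real^'n^'n) set"
  assumes F: "cone_subequation F"
  shows "subeq F"
  unfolding subeq_def
proof (intro conjI ballI impI)
  show S: "F \<subseteq> Sym" using F unfolding cone_subequation_def by blast
  fix A B assume A: "A \<in> F" and B: "B \<in> Sym" "\<forall>z. z \<bullet> (A *v z) \<le> z \<bullet> (B *v z)"
  then have "psd (B - A)" using psd_diff_iff S by blast
  then have "A + (B - A) \<in> F" using F A unfolding cone_subequation_def by blast
  then show "B \<in> F" by simp
next
  fix A :: "real^'n^'n" assume *: "\<forall>\<theta>>0. A + \<theta> *\<^sub>R mat 1 \<in> F"
  have "(\<lambda>n. A + (1 / (real n + 1)) *\<^sub>R mat 1) \<longlonglongrightarrow> A + 0 *\<^sub>R mat 1"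
    using LIMSEQ_inverse_real_of_nat by (intro tendsto_intros) (simp add: inverse_eq_divide add.commute)
  moreover have "A + (1 / (real n + 1)) *\<^sub>R mat 1 \<in> F" for n using * by simp
  moreover have "closed F" using F unfolding cone_subequation_def by blast
  ultimately have "A + 0 *\<^sub>R mat 1 \<in> F" by (metis (no_types, lifting) closed_sequentially)
  then show "A \<in> F" by simp
qed

lemma IntF_mono:
  assumes F: "cone_subequation F" and A: "A \<in> IntF F" and B: "B \<in> Sym" "\<forall>z. z \<bullet> (A *v z) \<le> z \<bullet> (B *v z)"
  shows "B \<in> IntF F"
proof -
  note S = cone_subequation_subeq[OF F]
  obtain e where AF: "A \<in> F" and e: "e > 0" "\<And>C. C \<in> Sym \<Longrightarrow> dist C A < e \<Longrightarrow> C \<in> F" using A unfolding IntF_def by blast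
  have AS: "A \<in> Sym" using AF S unfolding subeq_def by blast
  have "C \<in> F" if C: "C \<in> Sym" "dist C B < e" for C
  proof -
    have "C - B + A \<in> F" by (rule e(2)) (use C AS B(1) in \<open>auto intro!: Sym_add Sym_diff simp: dist_norm\<close>)
    moreover have "z \<bullet> ((C - B + A) *v z) \<le> z \<bullet> (C *v z)" for z
      using B(2) by (simp add: matrix_vector_mult_diff_rdistrib matrix_vector_mult_add_rdistrib inner_diff_right inner_add_right)
    ultimately show ?thesis using S C(1) unfolding subeq_def by blast
  qed
  moreover have "B \<in> F" using S AF B unfolding subeq_def by blast
  ultimately show ?thesis using e(1) unfolding IntF_def by blast
qed

lemma IntF_open:
  assumes "A \<in> IntF F"
  shows "\<exists>e>0. \<forall>B\<in>Sym. dist B A < e \<longrightarrow> B \<in> IntF F"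
proof -
  obtain e where e: "e > 0" "\<And>C. C \<in> Sym \<Longrightarrow> dist C A < e \<Longrightarrow> C \<in> F" using assms unfolding IntF_def by blast
  have "B \<in> IntF F" if B: "B \<in> Sym" "dist B A < e / 2" for B
  proof -
    have "C \<in> F" if "C \<in> Sym" "dist C B < e / 2" for C
    proof (rule e(2)[OF that(1)])
      show "dist C A < e" using dist_triangle[of C A B] that(2) B(2) by linarith
    qed
    moreover have "B \<in> F" using e B by (intro e(2)) auto
    ultimately show ?thesis using e(1) unfolding IntF_def by (blast intro: half_gt_zero)
  qed
  then show ?thesis using e(1) by (meson half_gt_zero)
qed

text \<open>The dual has to enter comparison on the same footing as F. Both clauses are read off at
  - A: the order is reversed, and openness of \<open>IntF F\<close> gives the limit clause.\<close>

lemma dual_subeq: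
  fixes F :: "(real^'n^'n) set"
  assumes F: "cone_subequation F"
  shows "subeq (dual F)"
  unfolding subeq_def
proof (intro conjI ballI impI)
  show S: "dual F \<subseteq> Sym" unfolding dual_def by blast
  fix A B assume A: "A \<in> dual F" and B: "B \<in> Sym" "\<forall>z. z \<bullet> (A *v z) \<le> z \<bullet> (B *v z)"
  have "- A \<in> IntF F" if "- B \<in> IntF F"
    by (rule IntF_mono[OF F that]) (use A B in \<open>auto simp: dual_def matrix_vector_mult_minus intro: Sym_minus\<close>)
  then show "B \<in> dual F" using A B unfolding dual_def by blast
next
  fix A :: "real^'n^'n" assume A: "A \<in> Sym" and *: "\<forall>\<theta>>0. A + \<theta> *\<^sub>R mat 1 \<in> dual F"
  show "A \<in> dual F"
  proof (rule ccontr)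
    assume "A \<notin> dual F"
    then have "- A \<in> IntF F" using A unfolding dual_def by blast
    then obtain e where e: "e > 0" "\<And>C. C \<in> Sym \<Longrightarrow> dist C (- A) < e \<Longrightarrow> C \<in> IntF F" using IntF_open by blast
    define m where "m = norm (mat 1 :: real^'n^'n) + 1"
    define \<theta> where "\<theta> = e / (2 * m)"
    have nn: "0 < m" unfolding m_def by (simp add: add_nonneg_pos)
    have \<theta>: "\<theta> > 0" unfolding \<theta>_def using e(1) nn by simp
    have "\<theta> * norm (mat 1 :: real^'n^'n) \<le> \<theta> * m" unfolding m_def using \<theta> by simp
    also have "\<dots> = e / 2" unfolding \<theta>_def using nn by simp
    also have "\<dots> < e" using e(1) by simp
    finally have "dist (- (A + \<theta> *\<^sub>R mat 1)) (- A) < e" using \<theta> by (simp add: dist_norm)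
    then have "- (A + \<theta> *\<^sub>R mat 1) \<in> IntF F" by (intro e(2)) (use A in \<open>auto intro!: Sym_minus Sym_add Sym_scaleR Sym_mat simp del: minus_add_distrib\<close>)
    then show False using * \<theta> unfolding dual_def by blast
  qed
qed

text \<open>A perturbation of norm below \<eta> / c changes the quadratic form by at most \<eta>
  |z|^2, with c the crude constant of \<open>quad_form_bound\<close>; monotonicity absorbs
  it.\<close>

lemma IntF_add_mat:
  assumes F: "cone_subequation F" and A: "A \<in> F" and \<eta>: "\<eta> > 0"
  shows "A + \<eta> *\<^sub>R mat 1 \<in> IntF F"
proof -
  note S = cone_subequation_subeq[OF F]
  have AS: "A \<in> Sym" using A S unfolding subeq_def by blast
  define c where "c = (real CARD('a))\<^sup>2"
  have c: "c > 0" unfolding c_def by simp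
  have "B \<in> F" if B: "B \<in> Sym" "dist B (A + \<eta> *\<^sub>R mat 1) < \<eta> / c" for B
  proof -
    have "z \<bullet> (A *v z) \<le> z \<bullet> (B *v z)" for z
    proof -
      let ?M = "B - (A + \<eta> *\<^sub>R mat 1)"
      have "c * norm ?M \<le> c * (\<eta> / c)" using B(2) c by (intro mult_left_mono) (auto simp: dist_norm)
      then have "c * norm ?M * (norm z)\<^sup>2 \<le> \<eta> * (norm z)\<^sup>2" using c by (intro mult_right_mono) auto
      then have "\<bar>z \<bullet> (?M *v z)\<bar> \<le> \<eta> * (norm z)\<^sup>2" using quad_form_bound[of z ?M] unfolding c_def by linarith
      moreover have "z \<bullet> (?M *v z) = z \<bullet> (B *v z) - z \<bullet> (A *v z) - \<eta> * (norm z)\<^sup>2"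
        unfolding matrix_vector_mult_diff_rdistrib inner_diff_right quad_form_add_mat by simp
      ultimately show ?thesis by (simp add: abs_le_iff)
    qed
    then show ?thesis using S A B(1) unfolding subeq_def by blast
  qed
  moreover have "A + \<eta> *\<^sub>R mat 1 \<in> F" using calculation[of "A + \<eta> *\<^sub>R mat 1"] AS \<eta> c by (auto intro!: Sym_add Sym_scaleR Sym_mat)
  ultimately show ?thesis using \<eta> c unfolding IntF_def by (blast intro: divide_pos_pos)
qed

text \<open>This refutes the pair of matrices that a positive value of u + v would produce.\<close>

lemma dual_disjoint:
  assumes F: "cone_subequation F" and "A \<in> F" and "\<eta> > 0"
  shows "- A - \<eta> *\<^sub>R mat 1 \<notin> dual F"
proof -
  have "- (- A - \<eta> *\<^sub>R mat 1) = A + \<eta> *\<^sub>R mat 1" by simp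
  then show ?thesis using IntF_add_mat[OF assms] unfolding dual_def mem_Collect_eq by metis
qed

lemma viscosity_sub_dual_comparison:
  fixes u v :: "real^'n \<Rightarrow> real"
  assumes F: "cone_subequation F" and X: "open X" and u: "viscosity_sub F X u" and v: "viscosity_sub (dual F) X v"
    and L: "\<And>s. 0 < s \<Longrightarrow> compact {x\<in>X. s \<le> u x + v x}" and x: "x \<in> X"
  shows "u x + v x \<le> 0"
proof (rule ccontr)
  assume "\<not> u x + v x \<le> 0"
  then have "0 < (u x + v x) / 2" "(u x + v x) / 2 < u x + v x" by auto
  from viscosity_sum_matrices[OF X u v x this(2) L[OF this(1)]] show False using dual_disjoint[OF F] by blast
qed

lemma cone_scale:
  assumes F: "cone_subequation F" and t: "t > 0"
  shows "A \<in> F \<Longrightarrow> t *\<^sub>R A \<in> F" and "A \<in> IntF F \<Longrightarrow> t *\<^sub>R A \<in> IntF F" and "A \<in> dual F \<Longrightarrow> t *\<^sub>R A \<in> dual F"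
proof -
  have sc: "s *\<^sub>R A \<in> F" if "A \<in> F" "s > 0" for s A using F that unfolding cone_subequation_def by blast
  have SI: "s *\<^sub>R A \<in> IntF F" if A: "A \<in> IntF F" and s: "s > 0" for s A
  proof -
    obtain e where AF: "A \<in> F" and e: "e > 0" "\<And>C. C \<in> Sym \<Longrightarrow> dist C A < e \<Longrightarrow> C \<in> F" using A unfolding IntF_def by blast
    have "C \<in> F" if C: "C \<in> Sym" "dist C (s *\<^sub>R A) < s * e" for C
    proof -
      have "s *\<^sub>R ((1 / s) *\<^sub>R C - A) = C - s *\<^sub>R A" using s by (simp add: scaleR_diff_right)
      then have "s * dist ((1 / s) *\<^sub>R C) A < s * e" using C(2) s unfolding dist_norm by (metis abs_of_pos norm_scaleR)
      then have "(1 / s) *\<^sub>R C \<in> F" using s by (intro e(2) Sym_scaleR C(1)) simp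
      from sc[OF this s] show ?thesis using s by simp
    qed
    then show ?thesis using sc[OF AF s] e(1) s unfolding IntF_def by (blast intro: mult_pos_pos)
  qed
  show "A \<in> F \<Longrightarrow> t *\<^sub>R A \<in> F" "A \<in> IntF F \<Longrightarrow> t *\<^sub>R A \<in> IntF F" using sc SI t by blast+
  assume A: "A \<in> dual F"
  have "- A \<in> IntF F" if "- (t *\<^sub>R A) \<in> IntF F" using SI[OF that, of "1 / t"] t by simp
  then show "t *\<^sub>R A \<in> dual F" using A unfolding dual_def by (auto intro: Sym_scaleR)
qed

section \<open>Second-order Peano expansions\<close>

definition peano :: "(real^'n \<Rightarrow> real) \<Rightarrow> real^'n \<Rightarrow> real^'n \<Rightarrow> real^'n^'n \<Rightarrow> bool" where
  "peano w y g B \<longleftrightarrow> (\<forall>\<theta>>0. \<forall>\<^sub>F z in nhds y.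
     \<bar>w z - w y - g \<bullet> (z - y) - ((z - y) \<bullet> (B *v (z - y))) / 2\<bar> \<le> \<theta> * (norm (z - y))\<^sup>2)"

lemma quad_poly_centered:
  "quad_poly A (\<lambda>z. c + g \<bullet> (z - y) + ((z - y) \<bullet> (A *v (z - y))) / 2)"
proof -
  have "quad_poly A (\<lambda>z. c + g \<bullet> z + (z \<bullet> (A *v z)) / 2)" unfolding quad_poly_def by blast
  from quad_poly_affine_subst[OF _ this, of 1 y 0 0] show ?thesis by simp
qed

lemma quad_poly_centeredE:
  assumes A: "A \<in> Sym" and q: "quad_poly A q"
  obtains g where "\<And>z. q z = q y + g \<bullet> (z - y) + ((z - y) \<bullet> (A *v (z - y))) / 2"
proof -
  obtain c p where q: "\<And>z. q z = c + p \<bullet> z + (z \<bullet> (A *v z)) / 2" using q unfolding quad_poly_def by blast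
  have "q z = q y + (p + A *v y) \<bullet> (z - y) + ((z - y) \<bullet> (A *v (z - y))) / 2" for z
  proof -
    have "y \<bullet> (A *v z) = z \<bullet> (A *v y)" using A unfolding Sym_iff by blast
    then show ?thesis unfolding q
      by (simp add: matrix_vector_mult_diff_distrib inner_diff_left inner_diff_right inner_add_left inner_commute[of "A *v y"] field_simps)
  qed
  then show thesis by (rule that)
qed

text \<open>Adding \<theta> to the matrix swallows the error of the expansion and gives a genuine
  quadratic test function; the limit clause of \<open>subeq\<close> then removes \<theta>.\<close>

lemma viscosity_sub_peano:
  assumes F: "subeq F" and u: "viscosity_sub F X u" and y: "y \<in> X" and B: "B \<in> Sym"
    and w: "peano w y g B" and le: "\<forall>\<^sub>F z in nhds y. u z - w z \<le> u y - w y"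
  shows "B \<in> F"
proof -
  have "B + \<theta> *\<^sub>R mat 1 \<in> F" if \<theta>: "\<theta> > 0" for \<theta>
  proof -
    define q where "q z = u y + g \<bullet> (z - y) + ((z - y) \<bullet> ((B + \<theta> *\<^sub>R mat 1) *v (z - y))) / 2" for z
    have q: "quad_poly (B + \<theta> *\<^sub>R mat 1) q" unfolding q_def[abs_def] by (rule quad_poly_centered)
    have "\<forall>\<^sub>F z in nhds y. \<bar>w z - w y - g \<bullet> (z - y) - ((z - y) \<bullet> (B *v (z - y))) / 2\<bar> \<le> (\<theta> / 2) * (norm (z - y))\<^sup>2"
      using w \<theta> unfolding peano_def by (meson half_gt_zero)
    then have "\<forall>\<^sub>F z in nhds y. u z \<le> q z"
      using le by eventually_elim (simp add: q_def quad_form_add_mat abs_le_iff field_simps)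
    moreover have "q y = u y" unfolding q_def by simp
    ultimately show ?thesis using u y q B unfolding viscosity_sub_def by (blast intro: Sym_add Sym_scaleR Sym_mat)
  qed
  then show ?thesis using F B unfolding subeq_def by blast
qed

text \<open>A polynomial touching w from above has the same gradient and a larger quadratic form, so
  monotonicity carries B to A.\<close>

lemma peano_test:
  assumes F: "subeq F" and B: "B \<in> F" and w: "peano w y g B" and A: "A \<in> Sym" and q: "quad_poly A q"
    and eq: "q y = w y" and le: "\<forall>\<^sub>F z in nhds y. w z \<le> q z"
  shows "A \<in> F"
proof -
  obtain g' where g': "\<And>z. q z = q y + g' \<bullet> (z - y) + ((z - y) \<bullet> (A *v (z - y))) / 2" using quad_poly_centeredE[OF A q] by blast
  have key: "\<exists>\<delta>>0. \<forall>e. norm e < \<delta> \<longrightarrow> (g - g') \<bullet> e + (e \<bullet> (B *v e)) / 2 - (e \<bullet> (A *v e)) / 2 \<le> \<theta> * (norm e)\<^sup>2" if \<theta>: "\<theta> > 0" for \<theta>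
  proof -
    have "\<forall>\<^sub>F z in nhds y. \<bar>w z - w y - g \<bullet> (z - y) - ((z - y) \<bullet> (B *v (z - y))) / 2\<bar> \<le> \<theta> * (norm (z - y))\<^sup>2"
      using w \<theta> unfolding peano_def by blast
    then have "\<forall>\<^sub>F z in nhds y. (g - g') \<bullet> (z - y) + ((z - y) \<bullet> (B *v (z - y))) / 2 - ((z - y) \<bullet> (A *v (z - y))) / 2 \<le> \<theta> * (norm (z - y))\<^sup>2"
      using le by eventually_elim (use eq g' in \<open>unfold abs_le_iff inner_diff_left, smt (verit, best)\<close>)
    then obtain \<delta> where d: "\<delta> > 0" "\<And>z. dist z y < \<delta> \<Longrightarrow> (g - g') \<bullet> (z - y) + ((z - y) \<bullet> (B *v (z - y))) / 2 - ((z - y) \<bullet> (A *v (z - y))) / 2 \<le> \<theta> * (norm (z - y))\<^sup>2"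
      unfolding eventually_nhds_metric by blast
    have "(g - g') \<bullet> e + (e \<bullet> (B *v e)) / 2 - (e \<bullet> (A *v e)) / 2 \<le> \<theta> * (norm e)\<^sup>2" if "norm e < \<delta>" for e
      using d(2)[of "y + e"] that by (simp add: dist_norm)
    then show ?thesis using d(1) by blast
  qed
  have gg: "g - g' = 0"
  proof -
    obtain \<delta> where d: "\<delta> > 0" "\<And>e. norm e < \<delta> \<Longrightarrow> (g - g') \<bullet> e + (e \<bullet> (B *v e)) / 2 - (e \<bullet> (A *v e)) / 2 \<le> 1 * (norm e)\<^sup>2"
      using key[of 1] by auto
    define K where "K = (real CARD('a))\<^sup>2 * norm B + (real CARD('a))\<^sup>2 * norm A + 1"
    show ?thesis
    proof (rule eq_0_of_inner_le_square_local[OF _ d(1)])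
      fix e :: "real^'a" assume "norm e < \<delta>"
      from d(2)[OF this] show "(g - g') \<bullet> e \<le> K * (norm e)\<^sup>2"
        using quad_form_bound[of e A] quad_form_bound[of e B] unfolding K_def distrib_right abs_le_iff by linarith
    qed
  qed
  have "e \<bullet> (B *v e) \<le> e \<bullet> (A *v e)" for e
  proof (rule ccontr)
    assume neg: "\<not> ?thesis"
    then have e0: "e \<noteq> 0" by auto
    define \<theta> where "\<theta> = (e \<bullet> (B *v e) - e \<bullet> (A *v e)) / (4 * (norm e)\<^sup>2)"
    have \<theta>: "\<theta> > 0" unfolding \<theta>_def using neg e0 by simp
    obtain \<delta> where d: "\<delta> > 0" "\<And>e. norm e < \<delta> \<Longrightarrow> (g - g') \<bullet> e + (e \<bullet> (B *v e)) / 2 - (e \<bullet> (A *v e)) / 2 \<le> \<theta> * (norm e)\<^sup>2"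
      using key[OF \<theta>] by blast
    \<comment> \<open>The quadratic inequality is homogeneous, so e may be shrunk into the ball of
      radius \<delta>; by the choice of \<theta> the gap would then be at most half of
      itself.\<close>
    define t where "t = \<delta> / (2 * norm e)"
    have t: "t > 0" unfolding t_def using d e0 by simp
    have "norm (t *\<^sub>R e) < \<delta>" unfolding t_def using d(1) e0 by simp
    from d(2)[OF this] have "t\<^sup>2 * (e \<bullet> (B *v e) - e \<bullet> (A *v e)) \<le> t\<^sup>2 * (2 * \<theta> * (norm e)\<^sup>2)"
      unfolding gg by (simp add: matrix_vector_mult_scaleR power_mult_distrib power2_eq_square algebra_simps)
    then have "e \<bullet> (B *v e) - e \<bullet> (A *v e) \<le> 2 * \<theta> * (norm e)\<^sup>2" using t by simp
    also have "\<dots> = (e \<bullet> (B *v e) - e \<bullet> (A *v e)) / 2" unfolding \<theta>_def using e0 by simp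
    finally show False using neg by simp
  qed
  then show ?thesis using F B A unfolding subeq_def by blast
qed

lemma peano_continuous:
  assumes "peano w y g B"
  shows "\<exists>c. \<forall>\<^sub>F z in nhds y. \<bar>w z - w y - g \<bullet> (z - y)\<bar> \<le> c * (norm (z - y))\<^sup>2"
proof -
  have "\<forall>\<^sub>F z in nhds y. \<bar>w z - w y - g \<bullet> (z - y) - ((z - y) \<bullet> (B *v (z - y))) / 2\<bar> \<le> 1 * (norm (z - y))\<^sup>2"
    using assms[unfolded peano_def, rule_format, of 1] by simp
  then have "\<forall>\<^sub>F z in nhds y. \<bar>w z - w y - g \<bullet> (z - y)\<bar> \<le> ((real CARD('a))\<^sup>2 * norm B + 1) * (norm (z - y))\<^sup>2"
  proof eventually_elim
    case (elim z)
    have "\<bar>((z - y) \<bullet> (B *v (z - y))) / 2\<bar> \<le> (real CARD('a))\<^sup>2 * norm B * (norm (z - y))\<^sup>2"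
      using quad_form_bound[of "z - y" B] by linarith
    then show ?case using elim unfolding distrib_right by linarith
  qed
  then show ?thesis by blast
qed

section \<open>Twice continuously differentiable test functions\<close>

lemma linear_axis_sum:
  fixes f :: "real^'n \<Rightarrow> real"
  assumes "linear f"
  shows "f w = (\<Sum>i\<in>UNIV. w $ i * f (axis i 1))"
proof -
  have "f w = f (\<Sum>i\<in>UNIV. (w $ i) *\<^sub>R axis i 1)"
    using basis_expansion[of w] by (simp add: scalar_mult_eq_scaleR)
  also have "\<dots> = (\<Sum>i\<in>UNIV. w $ i * f (axis i 1))"
    using assms by (simp add: linear_sum linear_cmul)
  finally show ?thesis .
qed

lemma Ck_on_2E:
  assumes "Ck_on 2 U \<phi>"
  obtains D D2 where "\<And>x. x \<in> U \<Longrightarrow> (\<phi> has_derivative D x) (at x)"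
    "\<And>v x. x \<in> U \<Longrightarrow> ((\<lambda>x. D x v) has_derivative D2 v x) (at x)"
    "\<And>v w. continuous_on U (\<lambda>x. D2 v x w)"
proof -
  have "Ck_on (Suc (Suc 0)) U \<phi>" using assms by (simp add: numeral_2_eq_2)
  then obtain D where D: "\<And>x. x \<in> U \<Longrightarrow> (\<phi> has_derivative D x) (at x)"
    and D1: "\<forall>v. \<exists>E. (\<forall>x\<in>U. ((\<lambda>x. D x v) has_derivative E x) (at x)) \<and> (\<forall>w. continuous_on U (\<lambda>x. E x w))"
    by auto
  then obtain D2 where "\<And>v. (\<forall>x\<in>U. ((\<lambda>x. D x v) has_derivative D2 v x) (at x)) \<and> (\<forall>w. continuous_on U (\<lambda>x. D2 v x w))"
    by metis
  then show thesis using that[of D D2] D by blast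
qed

lemma derivative_eq_grad:
  assumes "(\<phi> has_derivative D) (at x)"
  shows "D w = grad_at \<phi> x \<bullet> w"
proof -
  have "linear D" using assms has_derivative_linear by blast
  moreover have "frechet_derivative \<phi> (at x) = D" using frechet_derivative_at[OF assms] by simp
  ultimately show ?thesis using linear_axis_sum[of D w]
    by (simp add: grad_at_def inner_vec_def mult.commute)
qed

lemma hess_at_component:
  assumes U: "open U" "x \<in> U" and D: "\<And>x. x \<in> U \<Longrightarrow> (\<phi> has_derivative D x) (at x)"
    and D2: "((\<lambda>x. D x (axis j 1)) has_derivative E) (at x)"
  shows "hess_at \<phi> x $ i $ j = E (axis i 1)"
proof -
  have "((\<lambda>z. frechet_derivative \<phi> (at z) (axis j 1)) has_derivative E) (at x)"
  proof (rule has_derivative_transform_within_open[OF D2 U])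
    show "D z (axis j 1) = frechet_derivative \<phi> (at z) (axis j 1)" if "z \<in> U" for z
      using frechet_derivative_at[OF D[OF that]] by simp
  qed
  from frechet_derivative_at[OF this] show ?thesis unfolding hess_at_def by simp
qed

lemma grad_hess_continuous:
  assumes U: "open U" and C2: "Ck_on 2 U \<phi>"
  shows "continuous_on U (grad_at \<phi>)" "continuous_on U (hess_at \<phi>)"
proof -
  obtain D D2 where D: "\<And>x. x \<in> U \<Longrightarrow> (\<phi> has_derivative D x) (at x)"
    and D2: "\<And>v x. x \<in> U \<Longrightarrow> ((\<lambda>x. D x v) has_derivative D2 v x) (at x)"
    and cont: "\<And>v w. continuous_on U (\<lambda>x. D2 v x w)" using Ck_on_2E[OF C2] by blast
  have "continuous_on U (\<lambda>x. D x v)" for v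
    using D2[THEN has_derivative_at_withinI] has_derivative_continuous_on[of U "\<lambda>x. D x v"] by blast
  then have "continuous_on U (\<lambda>x. \<chi> i. D x (axis i 1))" by (intro continuous_intros)
  moreover have "grad_at \<phi> x = (\<chi> i. D x (axis i 1))" if "x \<in> U" for x
    unfolding grad_at_def using frechet_derivative_at[OF D[OF that]] by simp
  ultimately show "continuous_on U (grad_at \<phi>)" by (simp cong: continuous_on_cong)
  have "continuous_on U (\<lambda>x. \<chi> i j. D2 (axis j 1) x (axis i 1))" by (intro continuous_intros cont)
  moreover have "hess_at \<phi> x = (\<chi> i j. D2 (axis j 1) x (axis i 1))" if "x \<in> U" for x
    using hess_at_component[OF U that D D2[OF that]] by (simp add: vec_eq_iff)
  ultimately show "continuous_on U (hess_at \<phi>)" by (simp cong: continuous_on_cong)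
qed

text \<open>Each of the n partial derivatives is expanded with error \<epsilon> / n; summing over
  the coordinates of w makes the estimate uniform in w.\<close>

lemma derivative_expansion:
  fixes \<phi> :: "real^'n \<Rightarrow> real"
  assumes U: "open U" "y \<in> U" and D: "\<And>x. x \<in> U \<Longrightarrow> (\<phi> has_derivative D x) (at x)"
    and D2: "\<And>v x. x \<in> U \<Longrightarrow> ((\<lambda>x. D x v) has_derivative D2 v x) (at x)" and \<epsilon>: "0 < \<epsilon>"
  shows "\<exists>\<delta>>0. ball y \<delta> \<subseteq> U \<and> (\<forall>z\<in>ball y \<delta>. \<forall>w.
    \<bar>D z w - grad_at \<phi> y \<bullet> w - (z - y) \<bullet> (hess_at \<phi> y *v w)\<bar> \<le> \<epsilon> * norm (z - y) * norm w)"
proof -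
  define n where "n = real CARD('n)"
  have n: "n > 0" unfolding n_def by simp
  have "\<forall>\<^sub>F z in nhds y. \<bar>D z (axis j 1) - D y (axis j 1) - D2 (axis j 1) y (z - y)\<bar> \<le> \<epsilon> / n * norm (z - y)" for j
  proof -
    have "0 < \<epsilon> / n" using \<epsilon> n by simp
    then obtain d where "d > 0" "\<And>z. norm (z - y) < d \<Longrightarrow> norm (D z (axis j 1) - D y (axis j 1) - D2 (axis j 1) y (z - y)) \<le> \<epsilon> / n * norm (z - y)"
      using D2[OF U(2), of "axis j 1"] unfolding has_derivative_at_alt by blast
    then show ?thesis unfolding eventually_nhds_metric dist_norm by auto
  qed
  then have "\<forall>\<^sub>F z in nhds y. \<forall>j\<in>UNIV. \<bar>D z (axis j 1) - D y (axis j 1) - D2 (axis j 1) y (z - y)\<bar> \<le> \<epsilon> / n * norm (z - y)"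
    by (intro eventually_ball_finite) auto
  moreover have "\<forall>\<^sub>F z in nhds y. z \<in> U" using U eventually_nhds_in_open by blast
  ultimately have "\<forall>\<^sub>F z in nhds y. z \<in> U \<and> (\<forall>j. \<bar>D z (axis j 1) - D y (axis j 1) - D2 (axis j 1) y (z - y)\<bar> \<le> \<epsilon> / n * norm (z - y))"
    by eventually_elim auto
  then obtain \<delta> where \<delta>: "\<delta> > 0" "\<And>z. dist z y < \<delta> \<Longrightarrow> z \<in> U"
    "\<And>z j. dist z y < \<delta> \<Longrightarrow> \<bar>D z (axis j 1) - D y (axis j 1) - D2 (axis j 1) y (z - y)\<bar> \<le> \<epsilon> / n * norm (z - y)"
    unfolding eventually_nhds_metric by blast
  have "\<bar>D z w - grad_at \<phi> y \<bullet> w - (z - y) \<bullet> (hess_at \<phi> y *v w)\<bar> \<le> \<epsilon> * norm (z - y) * norm w" if z: "dist z y < \<delta>" for z w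
  proof -
    have lin: "linear (D z)" "linear (D y)" and lin2: "linear (D2 (axis j 1) y)" for j
      using D[OF \<delta>(2)[OF z]] D[OF U(2)] D2[OF U(2)] has_derivative_linear by blast+
    have h: "hess_at \<phi> y $ i $ j = D2 (axis j 1) y (axis i 1)" for i j
      by (rule hess_at_component[OF U D D2[OF U(2)]])
    have "(z - y) \<bullet> (hess_at \<phi> y *v w) = (\<Sum>j\<in>UNIV. w $ j * D2 (axis j 1) y (z - y))"
    proof -
      have "(z - y) \<bullet> (hess_at \<phi> y *v w) = (\<Sum>i\<in>UNIV. \<Sum>j\<in>UNIV. w $ j * ((z - y) $ i * D2 (axis j 1) y (axis i 1)))"
        by (simp add: inner_vec_def matrix_vector_mult_def h sum_distrib_left algebra_simps)
      also have "\<dots> = (\<Sum>j\<in>UNIV. \<Sum>i\<in>UNIV. w $ j * ((z - y) $ i * D2 (axis j 1) y (axis i 1)))" by (rule sum.swap)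
      also have "\<dots> = (\<Sum>j\<in>UNIV. w $ j * D2 (axis j 1) y (z - y))"
        by (simp add: linear_axis_sum[OF lin2, of _ "z - y"] sum_distrib_left)
      finally show ?thesis .
    qed
    then have "D z w - grad_at \<phi> y \<bullet> w - (z - y) \<bullet> (hess_at \<phi> y *v w)
      = (\<Sum>j\<in>UNIV. w $ j * (D z (axis j 1) - D y (axis j 1) - D2 (axis j 1) y (z - y)))"
      unfolding derivative_eq_grad[OF D[OF U(2)], symmetric] linear_axis_sum[OF lin(1), of w] linear_axis_sum[OF lin(2), of w]
      by (simp add: sum_subtractf sum.distrib algebra_simps)
    also have "\<bar>\<dots>\<bar> \<le> (\<Sum>j\<in>(UNIV::'n set). norm w * (\<epsilon> / n * norm (z - y)))"
    proof (rule order_trans[OF sum_abs sum_mono])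
      show "\<bar>w $ j * (D z (axis j 1) - D y (axis j 1) - D2 (axis j 1) y (z - y))\<bar> \<le> norm w * (\<epsilon> / n * norm (z - y))" for j
        unfolding abs_mult by (rule mult_mono[OF component_le_norm_cart \<delta>(3)[OF z]]) auto
    qed
    also have "\<dots> = \<epsilon> * norm (z - y) * norm w" using n unfolding n_def by simp
    finally show ?thesis .
  qed
  moreover have "ball y \<delta> \<subseteq> U" using \<delta>(2) by (auto simp: dist_commute)
  ultimately show ?thesis using \<delta>(1) by (auto simp: dist_commute)
qed

lemma line_derivative:
  fixes \<phi> :: "real^'n \<Rightarrow> real"
  assumes "(\<phi> has_derivative D) (at (c + s *\<^sub>R b))"
  shows "((\<lambda>s. \<phi> (c + s *\<^sub>R b)) has_real_derivative D b) (at s)"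
proof -
  have "((\<lambda>s. c + s *\<^sub>R b) has_derivative (\<lambda>t. t *\<^sub>R b)) (at s)" by (auto intro!: derivative_eq_intros)
  from has_derivative_compose[OF this assms]
  have "((\<lambda>s. \<phi> (c + s *\<^sub>R b)) has_derivative (\<lambda>t. D (t *\<^sub>R b))) (at s)" .
  moreover have "(\<lambda>t. D (t *\<^sub>R b)) = (\<lambda>t. D b * t)"
    using linear_cmul[OF has_derivative_linear[OF assms]] by (auto simp: mult.commute)
  ultimately show ?thesis unfolding has_field_derivative_def by simp
qed

text \<open>The mixed second difference m c d is symmetric in c and d, and the mean value theorem
  identifies it with the Hessian form up to \<epsilon> times a quadratic error. An asymmetry would
  survive scaling c and d down.\<close>

lemma hess_at_Sym:
  fixes \<phi> :: "real^'n \<Rightarrow> real"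
  assumes U: "open U" "y \<in> U" and C2: "Ck_on 2 U \<phi>"
  shows "hess_at \<phi> y \<in> Sym"
proof -
  obtain D D2 where D: "\<And>x. x \<in> U \<Longrightarrow> (\<phi> has_derivative D x) (at x)"
    and D2: "\<And>v x. x \<in> U \<Longrightarrow> ((\<lambda>x. D x v) has_derivative D2 v x) (at x)"
    and "\<And>v w. continuous_on U (\<lambda>x. D2 v x w)" using Ck_on_2E[OF C2] by blast
  let ?H = "hess_at \<phi> y"
  have "a \<bullet> (?H *v b) = b \<bullet> (?H *v a)" for a b
  proof (rule ccontr)
    assume ne: "a \<bullet> (?H *v b) \<noteq> b \<bullet> (?H *v a)"
    define S where "S = norm a + norm b"
    have ab: "a \<noteq> 0" using ne by auto
    have S: "S > 0" unfolding S_def using ab by (simp add: add_pos_nonneg)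
    \<comment> \<open>The two errors add up, after division by the squared scale, to 4 * \<epsilon>
      * \<open>S\<^sup>2\<close>, which is half of the asymmetry.\<close>
    define \<epsilon> where "\<epsilon> = \<bar>a \<bullet> (?H *v b) - b \<bullet> (?H *v a)\<bar> / (8 * S\<^sup>2)"
    have \<epsilon>: "\<epsilon> > 0" unfolding \<epsilon>_def using ne S by simp
    obtain \<delta> where \<delta>: "\<delta> > 0" "ball y \<delta> \<subseteq> U"
      and r: "\<And>z w. z \<in> ball y \<delta> \<Longrightarrow> \<bar>D z w - grad_at \<phi> y \<bullet> w - (z - y) \<bullet> (?H *v w)\<bar> \<le> \<epsilon> * norm (z - y) * norm w"
    proof -
      have "\<exists>\<delta>>0. ball y \<delta> \<subseteq> U \<and> (\<forall>z\<in>ball y \<delta>. \<forall>w. \<bar>D z w - grad_at \<phi> y \<bullet> w - (z - y) \<bullet> (?H *v w)\<bar> \<le> \<epsilon> * norm (z - y) * norm w)"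
        by (rule derivative_expansion[OF U D D2 \<epsilon>])
      then show thesis using that by blast
    qed
    define m where "m c d = \<phi> (y + c + d) - \<phi> (y + c) - \<phi> (y + d) + \<phi> y" for c d
    have key: "\<bar>m c d - c \<bullet> (?H *v d)\<bar> \<le> 2 * \<epsilon> * (norm c + norm d)\<^sup>2" if small: "norm c + norm d < \<delta>" for c d
    proof -
      have in1: "y + c + s *\<^sub>R d \<in> ball y \<delta>" and in2: "y + s *\<^sub>R d \<in> ball y \<delta>" 
        and n1: "norm (c + s *\<^sub>R d) \<le> norm c + norm d" and n2: "norm (s *\<^sub>R d) \<le> norm c + norm d" if "0 \<le> s" "s \<le> 1" for s
      proof -
        have "s * norm d \<le> norm d" using that mult_right_mono[of s 1 "norm d"] by simp
        then have sd: "norm (s *\<^sub>R d) \<le> norm d" using that by simp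
        show 1: "norm (s *\<^sub>R d) \<le> norm c + norm d" using sd norm_ge_zero[of c] by linarith
        show 2: "norm (c + s *\<^sub>R d) \<le> norm c + norm d"
          using sd norm_triangle_ineq[of c "s *\<^sub>R d"] by linarith
        have "dist (y + c + s *\<^sub>R d) y < \<delta>" "dist (y + s *\<^sub>R d) y < \<delta>"
          unfolding dist_norm using 1 2 small by (simp_all add: add.assoc)
        then show "y + c + s *\<^sub>R d \<in> ball y \<delta>" "y + s *\<^sub>R d \<in> ball y \<delta>"
          unfolding mem_ball dist_commute[of y] by auto
      qed
      define k where "k s = \<phi> ((y + c) + s *\<^sub>R d) - \<phi> (y + s *\<^sub>R d)" for s
      have dk: "(k has_real_derivative (D ((y + c) + s *\<^sub>R d) d - D (y + s *\<^sub>R d) d)) (at s)" if "0 \<le> s" "s \<le> 1" for s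
      proof -
        have "y + c + s *\<^sub>R d \<in> U" "y + s *\<^sub>R d \<in> U" using in1[OF that] in2[OF that] \<delta>(2) by auto
        then show ?thesis unfolding k_def by (intro DERIV_diff line_derivative D)
      qed
      obtain s where s: "0 < s" "s < 1" "k 1 - k 0 = (1 - 0) * (D ((y + c) + s *\<^sub>R d) d - D (y + s *\<^sub>R d) d)"
        using MVT2[of 0 1 k "\<lambda>s. D ((y + c) + s *\<^sub>R d) d - D (y + s *\<^sub>R d) d"] dk by auto
      have m: "m c d = D ((y + c) + s *\<^sub>R d) d - D (y + s *\<^sub>R d) d" using s(3) unfolding k_def m_def by simp
      have s': "0 \<le> s" "s \<le> 1" using s by auto
      have b: "\<epsilon> * norm w * norm d \<le> \<epsilon> * (norm c + norm d)\<^sup>2" if "norm w \<le> norm c + norm d" for w :: "real^'n"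
      proof -
        have "norm w * norm d \<le> (norm c + norm d) * (norm c + norm d)" using that by (intro mult_mono) auto
        then show ?thesis using \<epsilon> by (simp add: power2_eq_square mult.assoc)
      qed
      have "\<bar>D ((y + c) + s *\<^sub>R d) d - grad_at \<phi> y \<bullet> d - (c + s *\<^sub>R d) \<bullet> (?H *v d)\<bar> \<le> \<epsilon> * (norm c + norm d)\<^sup>2"
        using r[OF in1[OF s'], of d] b[OF n1[OF s']] by (simp add: add.assoc)
      moreover have "\<bar>D (y + s *\<^sub>R d) d - grad_at \<phi> y \<bullet> d - (s *\<^sub>R d) \<bullet> (?H *v d)\<bar> \<le> \<epsilon> * (norm c + norm d)\<^sup>2"
        using r[OF in2[OF s'], of d] b[OF n2[OF s']] by simp
      ultimately show ?thesis unfolding m inner_add_left by (simp add: abs_le_iff)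
    qed
    define t where "t = \<delta> / (2 * S)"
    have t: "t > 0" unfolding t_def using \<delta> S by simp
    have tS: "\<delta> / 2 = t * S" unfolding t_def using S by simp
    have nt: "norm (t *\<^sub>R a) + norm (t *\<^sub>R b) = \<delta> / 2"
      unfolding tS S_def using t by (simp add: distrib_left)
    have "\<bar>m (t *\<^sub>R a) (t *\<^sub>R b) - (t *\<^sub>R a) \<bullet> (?H *v (t *\<^sub>R b))\<bar> \<le> 2 * \<epsilon> * (t * S)\<^sup>2"
      using key[of "t *\<^sub>R a" "t *\<^sub>R b"] nt \<delta>(1) tS by simp
    moreover have "\<bar>m (t *\<^sub>R b) (t *\<^sub>R a) - (t *\<^sub>R b) \<bullet> (?H *v (t *\<^sub>R a))\<bar> \<le> 2 * \<epsilon> * (t * S)\<^sup>2"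
      using key[of "t *\<^sub>R b" "t *\<^sub>R a"] nt \<delta>(1) tS by (simp add: add.commute)
    moreover have "m (t *\<^sub>R b) (t *\<^sub>R a) = m (t *\<^sub>R a) (t *\<^sub>R b)" unfolding m_def by (simp add: algebra_simps)
    ultimately have "\<bar>t\<^sup>2 * (a \<bullet> (?H *v b)) - t\<^sup>2 * (b \<bullet> (?H *v a))\<bar> \<le> 4 * \<epsilon> * (t * S)\<^sup>2"
      by (simp add: matrix_vector_mult_scaleR power2_eq_square abs_le_iff)
    then have "t\<^sup>2 * \<bar>a \<bullet> (?H *v b) - b \<bullet> (?H *v a)\<bar> \<le> t\<^sup>2 * (4 * \<epsilon> * S\<^sup>2)"
      by (simp add: right_diff_distrib[symmetric] abs_mult power_mult_distrib mult.left_commute mult.assoc)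
    then have "\<bar>a \<bullet> (?H *v b) - b \<bullet> (?H *v a)\<bar> \<le> 4 * \<epsilon> * S\<^sup>2" using t by simp
    also have "\<dots> = \<bar>a \<bullet> (?H *v b) - b \<bullet> (?H *v a)\<bar> / 2" unfolding \<epsilon>_def using S by simp
    finally show False using ne by simp
  qed
  then show ?thesis unfolding Sym_iff by blast
qed

text \<open>The mean value theorem for \<phi> minus its Taylor polynomial along the segment from y
  to z; the derivative of the difference is controlled by
  \<open>derivative_expansion\<close>.\<close>

lemma C2_peano:
  fixes \<phi> :: "real^'n \<Rightarrow> real"
  assumes U: "open U" "y \<in> U" and C2: "Ck_on 2 U \<phi>"
  shows "peano \<phi> y (grad_at \<phi> y) (hess_at \<phi> y)"
  unfolding peano_def
proof (intro allI impI)
  fix \<theta> :: real assume \<theta>: "\<theta> > 0"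
  obtain D D2 where D: "\<And>x. x \<in> U \<Longrightarrow> (\<phi> has_derivative D x) (at x)"
    and D2: "\<And>v x. x \<in> U \<Longrightarrow> ((\<lambda>x. D x v) has_derivative D2 v x) (at x)"
    and "\<And>v w. continuous_on U (\<lambda>x. D2 v x w)" using Ck_on_2E[OF C2] by blast
  let ?H = "hess_at \<phi> y"
  obtain \<delta> where \<delta>: "\<delta> > 0" "ball y \<delta> \<subseteq> U"
    and r: "\<And>z w. z \<in> ball y \<delta> \<Longrightarrow> \<bar>D z w - grad_at \<phi> y \<bullet> w - (z - y) \<bullet> (?H *v w)\<bar> \<le> \<theta> * norm (z - y) * norm w"
  proof -
    have "\<exists>\<delta>>0. ball y \<delta> \<subseteq> U \<and> (\<forall>z\<in>ball y \<delta>. \<forall>w. \<bar>D z w - grad_at \<phi> y \<bullet> w - (z - y) \<bullet> (?H *v w)\<bar> \<le> \<theta> * norm (z - y) * norm w)"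
      by (rule derivative_expansion[OF U D D2 \<theta>])
    then show thesis using that by blast
  qed
  have "\<bar>\<phi> z - \<phi> y - grad_at \<phi> y \<bullet> (z - y) - ((z - y) \<bullet> (?H *v (z - y))) / 2\<bar> \<le> \<theta> * (norm (z - y))\<^sup>2" if z: "dist z y < \<delta>" for z
  proof -
    define w where "w = z - y"
    have sb: "y + s *\<^sub>R w \<in> ball y \<delta>" and sn: "norm (s *\<^sub>R w) \<le> norm w" if "0 \<le> s" "s \<le> 1" for s
    proof -
      show *: "norm (s *\<^sub>R w) \<le> norm w" using that by (simp add: mult_left_le_one_le)
      show "y + s *\<^sub>R w \<in> ball y \<delta>" using * z unfolding w_def by (simp add: dist_norm)
    qed
    define k where "k s = \<phi> (y + s *\<^sub>R w) - s * (grad_at \<phi> y \<bullet> w) - s\<^sup>2 / 2 * (w \<bullet> (?H *v w))" for s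
    have "(k has_real_derivative (D (y + s *\<^sub>R w) w - grad_at \<phi> y \<bullet> w - s * (w \<bullet> (?H *v w)))) (at s)" if "0 \<le> s" "s \<le> 1" for s
      unfolding k_def using line_derivative[OF D, of y s w] sb[OF that] \<delta>(2)
      by (auto intro!: derivative_eq_intros)
    then obtain s where s: "0 < s" "s < 1" "k 1 - k 0 = (1 - 0) * (D (y + s *\<^sub>R w) w - grad_at \<phi> y \<bullet> w - s * (w \<bullet> (?H *v w)))"
      using MVT2[of 0 1 k "\<lambda>s. D (y + s *\<^sub>R w) w - grad_at \<phi> y \<bullet> w - s * (w \<bullet> (?H *v w))"] by auto
    have s': "0 \<le> s" "s \<le> 1" using s by auto
    have "\<bar>D (y + s *\<^sub>R w) w - grad_at \<phi> y \<bullet> w - (s *\<^sub>R w) \<bullet> (?H *v w)\<bar> \<le> \<theta> * norm (s *\<^sub>R w) * norm w"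
      using r[OF sb[OF s'], of w] by simp
    also have "\<dots> \<le> \<theta> * norm w * norm w" using sn[OF s'] \<theta> by (intro mult_right_mono mult_left_mono) auto
    finally have "\<bar>k 1 - k 0\<bar> \<le> \<theta> * (norm w)\<^sup>2" unfolding s(3) by (simp add: power2_eq_square mult.assoc)
    moreover have "k 1 - k 0 = \<phi> z - \<phi> y - grad_at \<phi> y \<bullet> w - (w \<bullet> (?H *v w)) / 2" unfolding k_def w_def by simp
    ultimately show ?thesis unfolding w_def by simp
  qed
  then show "\<forall>\<^sub>F z in nhds y. \<bar>\<phi> z - \<phi> y - grad_at \<phi> y \<bullet> (z - y) - ((z - y) \<bullet> (?H *v (z - y))) / 2\<bar> \<le> \<theta> * (norm (z - y))\<^sup>2"
    unfolding eventually_nhds_metric using \<delta>(1) by blast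
qed

lemma quad_poly_Ck_hess:
  fixes A :: "real^'n^'n"
  assumes A: "A \<in> Sym" and q: "quad_poly A q"
  shows "Ck_on 2 UNIV q" "hess_at q y = A"
proof -
  obtain c p where q: "\<And>z. q z = c + p \<bullet> z + (z \<bullet> (A *v z)) / 2" using q unfolding quad_poly_def by blast
  define D where "D x v = p \<bullet> v + x \<bullet> (A *v v)" for x v
  have D: "(q has_derivative D x) (at x)" for x
  proof -
    have sy: "x \<bullet> (A *v v) = v \<bullet> (A *v x)" for v using A unfolding Sym_iff by blast
    have "((\<lambda>z. A *v z) has_derivative (\<lambda>v. A *v v)) (at x)"
      by (rule bounded_linear.has_derivative[OF matrix_vector_mul_bounded_linear has_derivative_ident])
    then have "((\<lambda>z. c + p \<bullet> z + (z \<bullet> (A *v z)) / 2) has_derivative (\<lambda>v. p \<bullet> v + (x \<bullet> (A *v v) + v \<bullet> (A *v x)) / 2)) (at x)"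
      by (auto intro!: derivative_eq_intros)
    moreover have "(\<lambda>v. p \<bullet> v + (x \<bullet> (A *v v) + v \<bullet> (A *v x)) / 2) = D x" unfolding D_def sy[symmetric] by auto
    ultimately show ?thesis using q by (simp add: fun_eq_iff[of q, symmetric] q[abs_def])
  qed
  have D2: "((\<lambda>x. D x v) has_derivative (\<lambda>w. w \<bullet> (A *v v))) (at x)" for v x
    unfolding D_def by (auto intro!: derivative_eq_intros)
  show "Ck_on 2 UNIV q"
    unfolding numeral_2_eq_2 Ck_on.simps
  proof (rule exI[of _ D], intro conjI ballI allI)
    show "(q has_derivative D x) (at x)" for x by (rule D)
    show "\<exists>E. (\<forall>x\<in>UNIV. ((\<lambda>x. D x v) has_derivative E x) (at x)) \<and> (\<forall>w. continuous_on UNIV (\<lambda>x. E x w))" for v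
      by (rule exI[of _ "\<lambda>x w. w \<bullet> (A *v v)"]) (use D2 in auto)
  qed
  show "hess_at q y = A"
    using hess_at_component[OF open_UNIV UNIV_I D D2, of y]
    by (simp add: vec_eq_iff inner_axis' matrix_vector_mul_component inner_axis)
qed

lemma F_subharmonic_viscosity_sub:
  fixes u :: "real^'n \<Rightarrow> real"
  assumes u: "F_subharmonic F X (\<lambda>x. ereal (u x))"
  shows "viscosity_sub F X u"
  unfolding viscosity_sub_def
proof (intro conjI ballI allI impI)
  show "usc_real X u" unfolding usc_real_def
  proof (intro ballI allI impI)
    fix x c assume "x \<in> X" "u x < c"
    then have "\<forall>\<^sub>F y in at x within X. ereal (u y) < ereal c"
      using u unfolding F_subharmonic_def usc_on_def by (metis less_ereal.simps(1))
    then show "\<forall>\<^sub>F y in at x within X. u y < c" by simp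
  qed
  fix y A q assume y: "y \<in> X" and A: "A \<in> Sym" and q: "quad_poly A q" "q y = u y" and ev: "\<forall>\<^sub>F z in nhds y. u z \<le> q z"
  obtain U where U: "open U" "y \<in> U" "\<forall>z\<in>U. u z \<le> q z" using ev unfolding eventually_nhds by blast
  have mono: "Ck_on k UNIV f \<Longrightarrow> Ck_on k U f" for k and f :: "real^'n \<Rightarrow> real"
  proof (induction k arbitrary: f)
    case 0
    then show ?case using continuous_on_subset by auto
  next
    case (Suc k)
    then show ?case by (metis Ck_on.simps(2) UNIV_I)
  qed
  have "hess_at q y \<in> F"
    using u y U q mono[OF quad_poly_Ck_hess(1)[OF A q(1)]] unfolding F_subharmonic_def by fastforce
  then show "A \<in> F" using quad_poly_Ck_hess(2)[OF A q(1)] by simp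
qed

text \<open>As X is open, a C^2 function touching from above makes u - \<phi> locally maximal, and
  then its second-order expansion is all that matters.\<close>

lemma viscosity_sub_F_subharmonic:
  fixes u :: "real^'n \<Rightarrow> real"
  assumes F: "subeq F" and X: "open X" and u: "viscosity_sub F X u"
  shows "F_subharmonic F X (\<lambda>x. ereal (u x))"
  unfolding F_subharmonic_def
proof (intro conjI ballI allI impI)
  show "usc_on X (\<lambda>x. ereal (u x))" unfolding usc_on_def
  proof (intro ballI allI impI)
    fix x c assume x: "x \<in> X" "ereal (u x) < c"
    show "\<forall>\<^sub>F y in at x within X. ereal (u y) < c"
    proof (cases c)
      case (real r)
      then show ?thesis using x u unfolding viscosity_sub_def usc_real_def by auto
    qed (use x in auto)
  qed
  fix y \<phi> assume y: "y \<in> X" and "(\<exists>U. open U \<and> y \<in> U \<and> Ck_on 2 U \<phi> \<and> (\<forall>z\<in>U \<inter> X. ereal (u z) \<le> ereal (\<phi> z))) \<and> ereal (u y) = ereal (\<phi> y)"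
  then obtain U where U: "open U" "y \<in> U" "Ck_on 2 U \<phi>" "\<And>z. z \<in> U \<Longrightarrow> z \<in> X \<Longrightarrow> u z \<le> \<phi> z" and eq: "u y = \<phi> y" by auto
  show "hess_at \<phi> y \<in> F"
  proof (rule viscosity_sub_peano[OF F u y hess_at_Sym[OF U(1-3)] C2_peano[OF U(1-3)]])
    have "\<forall>\<^sub>F z in nhds y. z \<in> U \<inter> X" using U X y by (intro eventually_nhds_in_open) auto
    then show "\<forall>\<^sub>F z in nhds y. u z - \<phi> z \<le> u y - \<phi> y" by eventually_elim (use U(4) eq in auto)
  qed
qed auto

section \<open>Envelopes, gluing and barriers\<close>

text \<open>A junk value (Inf of the empty set) at points near which f is not bounded above on X.\<close>
definition usc_envelope :: "'a::topological_space set \<Rightarrow> ('a \<Rightarrow> real) \<Rightarrow> 'a \<Rightarrow> real" where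
  "usc_envelope X f x = Inf {s. \<forall>\<^sub>F y in nhds x. y \<in> X \<longrightarrow> f y \<le> s}"

lemma usc_envelope_le:
  assumes "x \<in> X" "\<forall>\<^sub>F y in nhds x. y \<in> X \<longrightarrow> f y \<le> s"
  shows "usc_envelope X f x \<le> s"
  unfolding usc_envelope_def
proof (rule cInf_lower)
  show "s \<in> {s. \<forall>\<^sub>F y in nhds x. y \<in> X \<longrightarrow> f y \<le> s}" using assms(2) by simp
  show "bdd_below {s. \<forall>\<^sub>F y in nhds x. y \<in> X \<longrightarrow> f y \<le> s}"
    unfolding bdd_below_def using assms(1) eventually_nhds_x_imp_x by (metis (mono_tags, lifting) mem_Collect_eq)
qed

lemma usc_envelope_less:
  assumes bd: "\<forall>\<^sub>F y in nhds x. y \<in> X \<longrightarrow> f y \<le> s0" and lt: "usc_envelope X f x < c"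
  shows "\<exists>s<c. \<forall>\<^sub>F y in nhds x. y \<in> X \<longrightarrow> f y \<le> s"
proof -
  have "{s. \<forall>\<^sub>F y in nhds x. y \<in> X \<longrightarrow> f y \<le> s} \<noteq> {}" using bd by auto
  from cInf_lessD[OF this lt[unfolded usc_envelope_def]] show ?thesis by blast
qed

lemma usc_envelope_ge:
  assumes x: "x \<in> X" and bd: "\<forall>\<^sub>F y in nhds x. y \<in> X \<longrightarrow> f y \<le> s0"
  shows "f x \<le> usc_envelope X f x"
proof (rule ccontr)
  assume "\<not> ?thesis"
  then obtain s where "s < f x" "\<forall>\<^sub>F y in nhds x. y \<in> X \<longrightarrow> f y \<le> s" using usc_envelope_less[OF bd, of "f x"] by auto
  then show False using eventually_nhds_x_imp_x x by fastforce
qed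

lemma usc_envelope_usc:
  assumes bd: "\<And>x. x \<in> X \<Longrightarrow> \<exists>s. \<forall>\<^sub>F y in nhds x. y \<in> X \<longrightarrow> f y \<le> s"
  shows "usc_real X (usc_envelope X f)"
  unfolding usc_real_nhds
proof (intro ballI allI impI)
  fix x c assume x: "x \<in> X" and "usc_envelope X f x < c"
  obtain s0 where "\<forall>\<^sub>F y in nhds x. y \<in> X \<longrightarrow> f y \<le> s0" using bd[OF x] by blast
  from usc_envelope_less[OF this \<open>usc_envelope X f x < c\<close>]
  obtain s where s: "s < c" "\<forall>\<^sub>F y in nhds x. y \<in> X \<longrightarrow> f y \<le> s" by blast
  from s(2) have "\<forall>\<^sub>F y in nhds x. \<forall>\<^sub>F z in nhds y. z \<in> X \<longrightarrow> f z \<le> s" by (simp add: eventually_eventually)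
  then show "\<forall>\<^sub>F y in nhds x. y \<in> X \<longrightarrow> usc_envelope X f y < c"
    by (rule eventually_mono) (use usc_envelope_le s(1) in fastforce)
qed

lemma usc_envelope_le_continuous:
  assumes b: "continuous_on X b" and le: "\<And>x. x \<in> X \<Longrightarrow> f x \<le> b x" and x: "x \<in> X"
  shows "usc_envelope X f x \<le> b x" "\<exists>s. \<forall>\<^sub>F y in nhds x. y \<in> X \<longrightarrow> f y \<le> s"
proof -
  have ev: "\<forall>\<^sub>F y in nhds x. y \<in> X \<longrightarrow> f y \<le> b x + e" if "e > 0" for e
  proof -
    have "b x < b x + e" using that by simp
    then have "\<forall>\<^sub>F y in nhds x. y \<in> X \<longrightarrow> b y < b x + e" using usc_real_continuous[OF b] x unfolding usc_real_nhds by blast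
    then show ?thesis by (rule eventually_mono) (use le in fastforce)
  qed
  show "\<exists>s. \<forall>\<^sub>F y in nhds x. y \<in> X \<longrightarrow> f y \<le> s" using ev[of 1] by auto
  show "usc_envelope X f x \<le> b x" by (rule field_le_epsilon) (use usc_envelope_le[OF x ev] in auto)
qed

lemma viscosity_sub_cong:
  assumes X: "open X" and eq: "\<And>x. x \<in> X \<Longrightarrow> u x = v x" and u: "viscosity_sub F X u"
  shows "viscosity_sub F X v"
  unfolding viscosity_sub_def
proof (intro conjI ballI allI impI)
  show "usc_real X v" unfolding usc_real_nhds
  proof (intro ballI allI impI)
    fix x c assume "x \<in> X" "v x < c"
    then have "\<forall>\<^sub>F y in nhds x. y \<in> X \<longrightarrow> u y < c" using u eq unfolding viscosity_sub_def usc_real_nhds by metis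
    then show "\<forall>\<^sub>F y in nhds x. y \<in> X \<longrightarrow> v y < c" by (rule eventually_mono) (use eq in auto)
  qed
  fix y A q assume y: "y \<in> X" and A: "A \<in> Sym" "quad_poly A q" "q y = v y" and ev: "\<forall>\<^sub>F z in nhds y. v z \<le> q z"
  have "\<forall>\<^sub>F z in nhds y. z \<in> X" by (rule eventually_nhds_in_open[OF X y])
  with ev have "\<forall>\<^sub>F z in nhds y. u z \<le> q z" by eventually_elim (use eq in auto)
  then show "A \<in> F" using u y A eq[OF y] unfolding viscosity_sub_def by metis
qed

lemma quad_poly_scale:
  assumes "quad_poly A q"
  shows "quad_poly (t *\<^sub>R A) (\<lambda>z. t * q z + k)"
proof -
  obtain c p where q: "\<And>z. q z = c + p \<bullet> z + (z \<bullet> (A *v z)) / 2" using assms unfolding quad_poly_def by blast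
  show ?thesis unfolding quad_poly_def
    by (intro exI[of _ "t * c + k"] exI[of _ "t *\<^sub>R p"]) (simp add: q matrix_scaleR_vector_mult algebra_simps)
qed

lemma viscosity_sub_affine:
  assumes u: "viscosity_sub F X u" and t: "t > 0" and sc: "\<And>A. A \<in> F \<Longrightarrow> t *\<^sub>R A \<in> F"
  shows "viscosity_sub F X (\<lambda>x. t * u x + k)"
  unfolding viscosity_sub_def
proof (intro conjI ballI allI impI)
  show "usc_real X (\<lambda>x. t * u x + k)" unfolding usc_real_nhds
  proof (intro ballI allI impI)
    fix x c assume "x \<in> X" "t * u x + k < c"
    then have "u x < (c - k) / t" using t by (simp add: less_divide_eq mult.commute)
    then have "\<forall>\<^sub>F y in nhds x. y \<in> X \<longrightarrow> u y < (c - k) / t" using u \<open>x \<in> X\<close> unfolding viscosity_sub_def usc_real_nhds by blast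
    then show "\<forall>\<^sub>F y in nhds x. y \<in> X \<longrightarrow> t * u y + k < c"
      by (rule eventually_mono) (use t in \<open>auto simp: less_divide_eq mult.commute\<close>)
  qed
  fix y A q assume y: "y \<in> X" and A: "A \<in> Sym" and q: "quad_poly A q" "q y = t * u y + k" and ev: "\<forall>\<^sub>F z in nhds y. t * u z + k \<le> q z"
  have "quad_poly ((1 / t) *\<^sub>R A) (\<lambda>z. (1 / t) * q z + (- k / t))" by (rule quad_poly_scale[OF q(1)])
  moreover have "(1 / t) * q y + (- k / t) = u y" using q(2) t by (simp add: field_simps)
  moreover have "\<forall>\<^sub>F z in nhds y. u z \<le> (1 / t) * q z + (- k / t)" using ev by eventually_elim (use t in \<open>simp add: field_simps\<close>)
  ultimately have "(1 / t) *\<^sub>R A \<in> F" using u y Sym_scaleR[OF A] unfolding viscosity_sub_def by blast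
  from sc[OF this] show "A \<in> F" using t by simp
qed

text \<open>The closed set T keeps the places where v may exceed u away from the boundary of D in X,
  so near such boundary points the glued function is just u; anywhere else a test function touches
  one of the two.\<close>

lemma viscosity_sub_max_glue:
  assumes X: "open X" and D: "open D" "D \<subseteq> X" and T: "closed T" "T \<inter> X \<subseteq> D"
    and u: "viscosity_sub F X u" and v: "viscosity_sub F D v" and le: "\<And>z. z \<in> D \<Longrightarrow> z \<notin> T \<Longrightarrow> v z \<le> u z"
  shows "viscosity_sub F X (\<lambda>z. if z \<in> D then max (u z) (v z) else u z)" (is "viscosity_sub F X ?w")
  unfolding viscosity_sub_def
proof (intro conjI ballI allI impI)
  show "usc_real X ?w" unfolding usc_real_nhds
  proof (intro ballI allI impI)
    fix x c assume x: "x \<in> X" and lt: "?w x < c"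
    have "u x < c" using lt by (auto split: if_splits)
    then have eu: "\<forall>\<^sub>F y in nhds x. y \<in> X \<longrightarrow> u y < c" using u x unfolding viscosity_sub_def usc_real_nhds by blast
    show "\<forall>\<^sub>F y in nhds x. y \<in> X \<longrightarrow> ?w y < c"
    proof (cases "x \<in> D")
      case True
      then have "v x < c" using lt by auto
      then have "\<forall>\<^sub>F y in nhds x. y \<in> D \<longrightarrow> v y < c" using v True unfolding viscosity_sub_def usc_real_nhds by blast
      then show ?thesis using eu by eventually_elim auto
    next
      case False
      then have "x \<in> - T" using T(2) x by blast
      then have "\<forall>\<^sub>F y in nhds x. y \<in> - T" using T(1) by (intro eventually_nhds_in_open) auto
      then show ?thesis using eu by eventually_elim (use le in \<open>fastforce simp: max_def\<close>)
    qed
  qed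
  fix y A q assume y: "y \<in> X" and A: "A \<in> Sym" and q: "quad_poly A q" "q y = ?w y" and ev: "\<forall>\<^sub>F z in nhds y. ?w z \<le> q z"
  show "A \<in> F"
  proof (cases "?w y = u y")
    case True
    have "\<forall>\<^sub>F z in nhds y. u z \<le> q z" using ev by (rule eventually_mono) (auto split: if_splits)
    then show ?thesis using u y A q True unfolding viscosity_sub_def by metis
  next
    case False
    then have yD: "y \<in> D" and wy: "?w y = v y" by (auto split: if_splits simp: max_def)
    have "\<forall>\<^sub>F z in nhds y. z \<in> D" by (rule eventually_nhds_in_open[OF D(1) yD])
    with ev have "\<forall>\<^sub>F z in nhds y. v z \<le> q z" by eventually_elim auto
    then show ?thesis using v yD A q wy unfolding viscosity_sub_def by metis
  qed
qed

text \<open>The factor t may be negative, as it is for the upper barriers.\<close>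

lemma peano_affine:
  assumes "peano w y g B"
  shows "peano (\<lambda>z. k + t * w z) y (t *\<^sub>R g) (t *\<^sub>R B)"
  unfolding peano_def
proof (intro allI impI)
  fix \<theta> :: real assume \<theta>: "\<theta> > 0"
  have "\<theta> / (\<bar>t\<bar> + 1) > 0" using \<theta> by simp
  then have "\<forall>\<^sub>F z in nhds y. \<bar>w z - w y - g \<bullet> (z - y) - ((z - y) \<bullet> (B *v (z - y))) / 2\<bar> \<le> \<theta> / (\<bar>t\<bar> + 1) * (norm (z - y))\<^sup>2"
    using assms unfolding peano_def by blast
  then show "\<forall>\<^sub>F z in nhds y. \<bar>k + t * w z - (k + t * w y) - (t *\<^sub>R g) \<bullet> (z - y) - ((z - y) \<bullet> ((t *\<^sub>R B) *v (z - y))) / 2\<bar> \<le> \<theta> * (norm (z - y))\<^sup>2"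
  proof eventually_elim
    case (elim z)
    have "k + t * w z - (k + t * w y) - (t *\<^sub>R g) \<bullet> (z - y) - ((z - y) \<bullet> ((t *\<^sub>R B) *v (z - y))) / 2
      = t * (w z - w y - g \<bullet> (z - y) - ((z - y) \<bullet> (B *v (z - y))) / 2)"
      by (simp add: matrix_scaleR_vector_mult right_diff_distrib)
    then have "\<bar>k + t * w z - (k + t * w y) - (t *\<^sub>R g) \<bullet> (z - y) - ((z - y) \<bullet> ((t *\<^sub>R B) *v (z - y))) / 2\<bar>
      = \<bar>t\<bar> * \<bar>w z - w y - g \<bullet> (z - y) - ((z - y) \<bullet> (B *v (z - y))) / 2\<bar>" by (simp add: abs_mult)
    also have "\<dots> \<le> (\<bar>t\<bar> + 1) * (\<theta> / (\<bar>t\<bar> + 1) * (norm (z - y))\<^sup>2)" using elim by (intro mult_mono) auto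
    also have "\<dots> = \<theta> * (norm (z - y))\<^sup>2" by simp
    finally show ?case .
  qed
qed

lemma viscosity_sub_of_peano:
  assumes F: "subeq F" and c: "continuous_on D w" and p: "\<And>y. y \<in> D \<Longrightarrow> \<exists>g B. B \<in> F \<and> peano w y g B"
  shows "viscosity_sub F D w"
  unfolding viscosity_sub_def using usc_real_continuous[OF c] p peano_test[OF F] by metis

lemma quad_poly_peano:
  assumes "A \<in> Sym" "quad_poly A q"
  shows "peano q y (grad_at q y) A"
  using C2_peano[OF open_UNIV UNIV_I quad_poly_Ck_hess(1)[OF assms], of y] quad_poly_Ck_hess(2)[OF assms] by simp

section \<open>Barriers from a local defining function\<close>

lemma proj_line_quad: "v \<bullet> (proj_line e *v v) = (e \<bullet> v)\<^sup>2"
proof -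
  have "v \<bullet> (proj_line e *v v) = (\<Sum>i\<in>UNIV. \<Sum>j\<in>UNIV. (e $ i * v $ i) * (e $ j * v $ j))"
    by (simp add: inner_vec_def matrix_vector_mult_def proj_line_def sum_distrib_left algebra_simps)
  also have "\<dots> = (e \<bullet> v)\<^sup>2" by (simp add: inner_vec_def power2_eq_square sum_product)
  finally show ?thesis .
qed

lemma proj_line_scaleR: "proj_line (k *\<^sub>R e) = k\<^sup>2 *\<^sub>R proj_line e"
  by (simp add: proj_line_def vec_eq_iff power2_eq_square)

lemma proj_line_Sym: "proj_line e \<in> Sym"
  by (simp add: Sym_def transpose_def proj_line_def vec_eq_iff)

text \<open>The square of \<rho> contributes the rank-one matrix of the gradient to the Hessian, so
  s bends the barrier in the normal direction at will; the term with \<eta> separates it from its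
  value at x0 elsewhere.\<close>

lemma peano_barrier:
  fixes \<rho> :: "real^'n \<Rightarrow> real"
  assumes p: "peano \<rho> y g H"
  shows "peano (\<lambda>z. \<rho> z + s / 2 * (\<rho> z)\<^sup>2 - \<eta> * (norm (z - x0))\<^sup>2) y
     ((1 + s * \<rho> y) *\<^sub>R g - (2 * \<eta>) *\<^sub>R (y - x0)) ((1 + s * \<rho> y) *\<^sub>R H + s *\<^sub>R proj_line g - (2 * \<eta>) *\<^sub>R mat 1)"
  unfolding peano_def
proof (intro allI impI)
  fix \<theta> :: real assume \<theta>: "\<theta> > 0"
  define \<kappa> where "\<kappa> = \<bar>1 + s * \<rho> y\<bar> + 1"
  have \<kappa>: "\<kappa> > 0" unfolding \<kappa>_def by simp
  obtain c where c: "\<forall>\<^sub>F z in nhds y. \<bar>\<rho> z - \<rho> y - g \<bullet> (z - y)\<bar> \<le> c * (norm (z - y))\<^sup>2" using peano_continuous[OF p] by blast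
  have e1: "\<forall>\<^sub>F z in nhds y. \<bar>\<rho> z - \<rho> y - g \<bullet> (z - y) - ((z - y) \<bullet> (H *v (z - y))) / 2\<bar> \<le> \<theta> / (2 * \<kappa>) * (norm (z - y))\<^sup>2"
    by (rule p[unfolded peano_def, rule_format]) (use \<theta> \<kappa> in simp)
  have "((\<lambda>z. \<bar>s\<bar> / 2 * (\<bar>c\<bar> * (\<bar>c\<bar> * (norm (z - y))\<^sup>2 + 2 * norm g * norm (z - y)))) \<longlongrightarrow> \<bar>s\<bar> / 2 * (\<bar>c\<bar> * (\<bar>c\<bar> * (norm (y - y))\<^sup>2 + 2 * norm g * norm (y - y)))) (nhds y)"
    by (intro tendsto_intros filterlim_ident)
  then have e2: "\<forall>\<^sub>F z in nhds y. \<bar>s\<bar> / 2 * (\<bar>c\<bar> * (\<bar>c\<bar> * (norm (z - y))\<^sup>2 + 2 * norm g * norm (z - y))) < \<theta> / 2"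
    using \<theta> by (intro order_tendstoD(2)[where y = "\<bar>s\<bar> / 2 * (\<bar>c\<bar> * (\<bar>c\<bar> * (norm (y - y))\<^sup>2 + 2 * norm g * norm (y - y)))"]) auto
  show "\<forall>\<^sub>F z in nhds y. \<bar>\<rho> z + s / 2 * (\<rho> z)\<^sup>2 - \<eta> * (norm (z - x0))\<^sup>2 - (\<rho> y + s / 2 * (\<rho> y)\<^sup>2 - \<eta> * (norm (y - x0))\<^sup>2)
    - ((1 + s * \<rho> y) *\<^sub>R g - (2 * \<eta>) *\<^sub>R (y - x0)) \<bullet> (z - y)
    - ((z - y) \<bullet> (((1 + s * \<rho> y) *\<^sub>R H + s *\<^sub>R proj_line g - (2 * \<eta>) *\<^sub>R mat 1) *v (z - y))) / 2\<bar> \<le> \<theta> * (norm (z - y))\<^sup>2"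
    using c e1 e2
  proof eventually_elim
    case (elim z)
    define e where "e = z - y"
    define l where "l = \<rho> z - \<rho> y"
    define X where "X = l - g \<bullet> e - (e \<bullet> (H *v e)) / 2"
    have quad: "e \<bullet> (((1 + s * \<rho> y) *\<^sub>R H + s *\<^sub>R proj_line g - (2 * \<eta>) *\<^sub>R mat 1) *v e)
      = (1 + s * \<rho> y) * (e \<bullet> (H *v e)) + s * (g \<bullet> e)\<^sup>2 - 2 * \<eta> * (norm e)\<^sup>2"
      by (simp add: matrix_vector_mult_diff_rdistrib matrix_vector_mult_add_rdistrib matrix_scaleR_vector_mult
          inner_diff_right inner_add_right proj_line_quad power2_norm_eq_inner)
    have "\<rho> z = l + \<rho> y" unfolding l_def by simp
    then have "\<rho> z + s / 2 * (\<rho> z)\<^sup>2 - \<eta> * (norm (z - x0))\<^sup>2 - (\<rho> y + s / 2 * (\<rho> y)\<^sup>2 - \<eta> * (norm (y - x0))\<^sup>2)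
      = (1 + s * \<rho> y) * l + s / 2 * l\<^sup>2 - \<eta> * ((norm (z - x0))\<^sup>2 - (norm (y - x0))\<^sup>2)"
      by (simp add: power2_eq_square algebra_simps)
    also have "\<dots> = (1 + s * \<rho> y) * l + s / 2 * l\<^sup>2 - \<eta> * (2 * ((y - x0) \<bullet> e) + (norm e)\<^sup>2)"
      unfolding norm_shift_square e_def by simp
    finally have eq: "\<rho> z + s / 2 * (\<rho> z)\<^sup>2 - \<eta> * (norm (z - x0))\<^sup>2 - (\<rho> y + s / 2 * (\<rho> y)\<^sup>2 - \<eta> * (norm (y - x0))\<^sup>2)
       - ((1 + s * \<rho> y) *\<^sub>R g - (2 * \<eta>) *\<^sub>R (y - x0)) \<bullet> e - (e \<bullet> (((1 + s * \<rho> y) *\<^sub>R H + s *\<^sub>R proj_line g - (2 * \<eta>) *\<^sub>R mat 1) *v e)) / 2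
      = (1 + s * \<rho> y) * X + s / 2 * (l\<^sup>2 - (g \<bullet> e)\<^sup>2)"
      unfolding quad X_def inner_diff_left inner_scaleR_left by (simp add: field_simps)
    have b1: "\<bar>(1 + s * \<rho> y) * X\<bar> \<le> \<theta> / 2 * (norm e)\<^sup>2"
    proof -
      have "\<bar>(1 + s * \<rho> y) * X\<bar> \<le> \<kappa> * (\<theta> / (2 * \<kappa>) * (norm e)\<^sup>2)"
        unfolding abs_mult using elim(2) \<kappa> unfolding X_def l_def e_def \<kappa>_def by (intro mult_mono) auto
      then show ?thesis using \<kappa> by simp
    qed
    have b2: "\<bar>s / 2 * (l\<^sup>2 - (g \<bullet> e)\<^sup>2)\<bar> \<le> \<theta> / 2 * (norm e)\<^sup>2"
    proof -
      have d: "\<bar>l - g \<bullet> e\<bar> \<le> \<bar>c\<bar> * (norm e)\<^sup>2"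
        using elim(1) mult_right_mono[OF abs_ge_self[of c] zero_le_power2[of "norm e"]] unfolding l_def e_def by linarith
      have "\<bar>g \<bullet> e\<bar> \<le> norm g * norm e" by (rule Cauchy_Schwarz_ineq2)
      then have a: "\<bar>l + g \<bullet> e\<bar> \<le> \<bar>c\<bar> * (norm e)\<^sup>2 + 2 * norm g * norm e" using d by linarith
      \<comment> \<open>The factors are of order two and one in e, so the product is of third
        order.\<close>
      have "l\<^sup>2 - (g \<bullet> e)\<^sup>2 = (l - g \<bullet> e) * (l + g \<bullet> e)" by (simp add: power2_eq_square algebra_simps)
      then have "\<bar>s / 2 * (l\<^sup>2 - (g \<bullet> e)\<^sup>2)\<bar> = \<bar>s\<bar> / 2 * (\<bar>l - g \<bullet> e\<bar> * \<bar>l + g \<bullet> e\<bar>)" by (simp add: abs_mult)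
      also have "\<dots> \<le> \<bar>s\<bar> / 2 * ((\<bar>c\<bar> * (norm e)\<^sup>2) * (\<bar>c\<bar> * (norm e)\<^sup>2 + 2 * norm g * norm e))"
        using d a by (intro mult_left_mono mult_mono) auto
      also have "\<dots> = (\<bar>s\<bar> / 2 * (\<bar>c\<bar> * (\<bar>c\<bar> * (norm e)\<^sup>2 + 2 * norm g * norm e))) * (norm e)\<^sup>2" by (simp add: algebra_simps)
      also have "\<dots> \<le> \<theta> / 2 * (norm e)\<^sup>2" using elim(3) unfolding e_def by (intro mult_right_mono) auto
      finally show ?thesis .
    qed
    show ?case unfolding e_def[symmetric] eq using b1 b2 by linarith
  qed
qed

text \<open>As \<rho> vanishes at x0, the Hessian there is the prescribed one up to the term with
  \<eta>, which is given half of e; continuity nearby takes the other half. On the closure of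
  \<Omega> the sign survives the bending, because \<open>\<rho> z * (1 + s * \<rho> z / 2)\<close>
  is at most 0 while |s * \<rho> z| < 1.\<close>

lemma defining_function_barrier:
  fixes \<Omega> :: "(real^'n) set"
  assumes ld: "local_defining_function \<Omega> x0 U \<rho>" and x0: "x0 \<in> frontier \<Omega>" and \<Omega>: "open \<Omega>"
    and e: "0 < e" and s: "0 \<le> s"
  shows "\<exists>\<eta> R \<beta>. 0 < \<eta> \<and> 0 < R \<and> continuous_on (cball x0 R) \<beta> \<and> \<beta> x0 = 0
    \<and> (\<forall>z\<in>closure \<Omega> \<inter> cball x0 R. \<beta> z \<le> - \<eta> * (norm (z - x0))\<^sup>2)
    \<and> (\<forall>y\<in>cball x0 R. \<exists>g B. B \<in> Sym \<and> dist B (hess_at \<rho> x0 + s *\<^sub>R proj_line (grad_at \<rho> x0)) < e \<and> peano \<beta> y g B)"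
proof -
  have U: "open U" "x0 \<in> U" and C2: "Ck_on 2 U \<rho>" and C0: "Ck_on 0 U \<rho>" and eq: "\<Omega> \<inter> U = {y \<in> U. \<rho> y < 0}"
    using ld unfolding local_defining_function_def smooth_on_def by blast+
  have cr: "continuous_on U \<rho>" using C0 by simp
  note cg = grad_hess_continuous[OF U(1) C2]
  have x0n: "x0 \<notin> \<Omega>" using x0 \<Omega> unfolding frontier_def by (simp add: interior_open)
  have le0: "\<rho> z \<le> 0" if z: "z \<in> closure \<Omega>" "z \<in> U" for z
  proof (rule ccontr)
    assume "\<not> \<rho> z \<le> 0"
    then have "z \<in> U \<inter> \<rho> -` {0<..}" using z by auto
    moreover have "open (U \<inter> \<rho> -` {0<..})" by (rule continuous_open_preimage[OF cr U(1)]) simp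
    ultimately have "\<Omega> \<inter> (U \<inter> \<rho> -` {0<..}) \<noteq> {}" using z(1) by (metis open_Int_closure_eq_empty disjoint_iff inf_commute)
    then obtain w where "w \<in> \<Omega> \<inter> U" "\<rho> w > 0" by auto
    then show False using eq by auto
  qed
  have r0: "\<rho> x0 = 0" using le0[of x0] x0 x0n U(2) eq unfolding frontier_def by fastforce
  define m where "m = norm (mat 1 :: real^'n^'n) + 1"
  have m: "m > 0" unfolding m_def by (simp add: add_nonneg_pos)
  define \<eta> where "\<eta> = e / (4 * m)"
  have \<eta>: "\<eta> > 0" unfolding \<eta>_def using e m by simp
  define M where "M = hess_at \<rho> x0 + s *\<^sub>R proj_line (grad_at \<rho> x0)"
  define B' where "B' y = (1 + s * \<rho> y) *\<^sub>R hess_at \<rho> y + s *\<^sub>R proj_line (grad_at \<rho> y)" for y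
  have "continuous_on U B'" unfolding B'_def proj_line_def by (intro continuous_intros cr cg)
  then have "(B' \<longlongrightarrow> B' x0) (at x0)" using U unfolding continuous_on_def by (metis at_within_open)
  moreover have "B' x0 = M" unfolding B'_def M_def r0 by simp
  ultimately have "\<forall>\<^sub>F y in at x0. dist (B' y) M < e / 2" using e tendstoD half_gt_zero by metis
  then have "\<forall>\<^sub>F y in nhds x0. dist (B' y) M < e / 2" unfolding eventually_at_filter
  proof (rule eventually_mono)
    show "dist (B' y) M < e / 2" if "y \<noteq> x0 \<longrightarrow> y \<in> UNIV \<longrightarrow> dist (B' y) M < e / 2" for y
      using that \<open>B' x0 = M\<close> e by (cases "y = x0") auto
  qed
  moreover have "\<forall>\<^sub>F y in nhds x0. y \<in> U" using U by (intro eventually_nhds_in_open)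
  moreover have "\<forall>\<^sub>F y in nhds x0. \<bar>s * \<rho> y\<bar> < 1"
  proof -
    have "continuous_on U (\<lambda>y. \<bar>s * \<rho> y\<bar>)" by (intro continuous_intros cr)
    then have "usc_real U (\<lambda>y. \<bar>s * \<rho> y\<bar>)" by (rule usc_real_continuous)
    then have "\<forall>\<^sub>F y in nhds x0. y \<in> U \<longrightarrow> \<bar>s * \<rho> y\<bar> < 1" using U(2) r0 unfolding usc_real_nhds by simp
    then show ?thesis using \<open>\<forall>\<^sub>F y in nhds x0. y \<in> U\<close> by eventually_elim auto
  qed
  ultimately have "\<forall>\<^sub>F y in nhds x0. dist (B' y) M < e / 2 \<and> y \<in> U \<and> \<bar>s * \<rho> y\<bar> < 1" by eventually_elim auto
  then obtain d where d: "d > 0" "\<And>y. dist y x0 < d \<Longrightarrow> dist (B' y) M < e / 2 \<and> y \<in> U \<and> \<bar>s * \<rho> y\<bar> < 1"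
    unfolding eventually_nhds_metric by blast
  define R where "R = d / 2"
  have R: "R > 0" and Rd: "\<And>y. y \<in> cball x0 R \<Longrightarrow> dist (B' y) M < e / 2 \<and> y \<in> U \<and> \<bar>s * \<rho> y\<bar> < 1"
    using d unfolding R_def by (auto simp: dist_commute)
  define \<beta> where "\<beta> z = \<rho> z + s / 2 * (\<rho> z)\<^sup>2 - \<eta> * (norm (z - x0))\<^sup>2" for z
  have "continuous_on U \<beta>" unfolding \<beta>_def by (intro continuous_intros cr)
  then have cb: "continuous_on (cball x0 R) \<beta>" by (rule continuous_on_subset) (use Rd in blast)
  have neg: "\<beta> z \<le> - \<eta> * (norm (z - x0))\<^sup>2" if "z \<in> closure \<Omega> \<inter> cball x0 R" for z
  proof -
    have "\<rho> z \<le> 0" "\<bar>s * \<rho> z\<bar> < 1" using that le0 Rd by auto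
    then have "\<rho> z * (1 + s * \<rho> z / 2) \<le> 0" by (intro mult_nonpos_nonneg) (auto simp: abs_less_iff)
    then show ?thesis unfolding \<beta>_def by (simp add: power2_eq_square algebra_simps)
  qed
  have pe: "\<exists>g B. B \<in> Sym \<and> dist B M < e \<and> peano \<beta> y g B" if y: "y \<in> cball x0 R" for y
  proof (intro exI conjI)
    have yU: "y \<in> U" using Rd y by blast
    let ?B = "(1 + s * \<rho> y) *\<^sub>R hess_at \<rho> y + s *\<^sub>R proj_line (grad_at \<rho> y) - (2 * \<eta>) *\<^sub>R mat 1"
    show "peano \<beta> y ((1 + s * \<rho> y) *\<^sub>R grad_at \<rho> y - (2 * \<eta>) *\<^sub>R (y - x0)) ?B"
      unfolding \<beta>_def by (rule peano_barrier[OF C2_peano[OF U(1) yU C2]])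
    show "?B \<in> Sym" by (intro Sym_add Sym_diff Sym_scaleR Sym_mat proj_line_Sym hess_at_Sym[OF U(1) yU C2])
    have "dist ?B (B' y) = 2 * \<eta> * norm (mat 1 :: real^'n^'n)" unfolding B'_def dist_norm using \<eta> by simp
    also have "\<dots> \<le> 2 * \<eta> * m" unfolding m_def using \<eta> by simp
    also have "\<dots> = e / 2" unfolding \<eta>_def using m by simp
    finally show "dist ?B M < e" using Rd[OF y] dist_triangle[of ?B M "B' y"] by linarith
  qed
  have "\<beta> x0 = 0" unfolding \<beta>_def r0 by simp
  then show ?thesis using \<eta> R cb neg pe unfolding M_def by blast
qed

section \<open>Comparison near the singular set\<close>

locale singular_dirichlet =
  fixes F :: "(real^'n^'n) set" and \<Omega> \<Sigma> :: "(real^'n) set" and h :: "real^'n \<Rightarrow> ereal"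
  assumes F: "cone_subequation F"
    and \<Omega>: "open \<Omega>" "bounded \<Omega>"
    and \<Sigma>: "compact \<Sigma>" "\<Sigma> \<subseteq> \<Omega>"
    and h_cont: "continuous_on (closure \<Omega>) h"
    and h_fin: "\<And>x. x \<in> closure \<Omega> \<Longrightarrow> h x \<noteq> \<infinity>"
    and \<Sigma>_eq: "\<Sigma> = {x \<in> closure \<Omega>. h x = - \<infinity>}"
    and h_harm: "F_harmonic F (\<Omega> - \<Sigma>) (\<lambda>x. real_of_ereal (h x))"
begin

definition "X = \<Omega> - \<Sigma>"

definition g :: "real^'n \<Rightarrow> real" where "g x = real_of_ereal (h x)"

lemma X_open: "open X" unfolding X_def using \<Omega> \<Sigma> compact_imp_closed by (intro open_Diff) auto

lemma h_eq: "x \<in> closure \<Omega> - \<Sigma> \<Longrightarrow> h x = ereal (g x)"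
  using h_fin[of x] \<Sigma>_eq unfolding g_def by (cases "h x") auto

lemma frontier_closure: "frontier \<Omega> \<subseteq> closure \<Omega> - \<Sigma>"
  using \<Sigma>(2) \<Omega>(1) unfolding frontier_def by (auto simp: interior_open)

lemma X_closure: "X \<subseteq> closure \<Omega> - \<Sigma>" unfolding X_def using closure_subset by blast

lemma closure_split: "closure \<Omega> - \<Sigma> = X \<union> frontier \<Omega>"
  using frontier_closure X_closure unfolding frontier_def X_def using \<Omega>(1) by (auto simp: interior_open)

lemma frontier_X: "frontier \<Omega> \<inter> X = {}"
  unfolding X_def frontier_def using \<Omega>(1) by (auto simp: interior_open)

lemma compact_frontier_\<Omega>: "compact (frontier \<Omega>)" using \<Omega>(2) by (rule compact_frontier_bounded)

lemma g_cont: "continuous_on (closure \<Omega> - \<Sigma>) g"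
proof -
  have "continuous_on (closure \<Omega> - \<Sigma>) h" by (rule continuous_on_subset[OF h_cont]) auto
  then have "continuous_on (closure \<Omega> - \<Sigma>) (\<lambda>x. ereal (g x))" using h_eq by (rule continuous_on_eq)
  then show ?thesis by (simp add: continuous_on_def)
qed

lemma g_contX: "continuous_on X g" by (rule continuous_on_subset[OF g_cont X_closure])

lemma g_sub: "viscosity_sub F X g"
  using h_harm unfolding F_harmonic_def X_def g_def[abs_def] by (intro F_subharmonic_viscosity_sub) simp

lemma g_dual: "viscosity_sub (dual F) X (\<lambda>x. - g x)"
  using h_harm unfolding F_harmonic_def X_def g_def[abs_def] by (intro F_subharmonic_viscosity_sub) simp

lemma subF: "subeq F" and subD: "subeq (dual F)"
  using F cone_subequation_subeq dual_subeq by blast+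

lemma limit_X:
  assumes "\<forall>\<^sub>F x in at x0 within X. P x" "x0 \<in> frontier \<Omega>"
  shows "\<forall>\<^sub>F x in nhds x0. x \<in> X \<longrightarrow> P x"
  using assms(1) unfolding eventually_at_filter
  by (rule eventually_mono) (use assms(2) frontier_X in blast)

lemma near_\<Sigma>:
  assumes "x0 \<in> \<Sigma>"
  shows "\<forall>\<^sub>F x in nhds x0. x \<in> X \<longrightarrow> g x < N"
proof -
  have x0: "x0 \<in> closure \<Omega>" "h x0 < ereal N" using assms \<Sigma>_eq by auto
  then have "\<forall>\<^sub>F x in at x0 within closure \<Omega>. h x < ereal N"
    using h_cont unfolding continuous_on_def by (metis order_tendstoD(2))
  then show ?thesis unfolding eventually_at_filter
  proof (rule eventually_mono)
    fix x assume *: "x \<noteq> x0 \<longrightarrow> x \<in> closure \<Omega> \<longrightarrow> h x < ereal N"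
    show "x \<in> X \<longrightarrow> g x < N"
    proof
      assume x: "x \<in> X"
      then have "x \<noteq> x0" "x \<in> closure \<Omega> - \<Sigma>" using assms X_closure unfolding X_def by auto
      then show "g x < N" using * h_eq[of x] by auto
    qed
  qed
qed

text \<open>Upper semicontinuity handles points of X, and the two limit hypotheses exclude
  accumulation at the frontier and at \<Sigma>; boundedness comes from \<Omega>.\<close>

lemma singular_level_compact:
  assumes w: "usc_real X w" and s: "\<And>x0. x0 \<in> frontier \<Omega> \<Longrightarrow> \<forall>\<^sub>F x in nhds x0. x \<in> X \<longrightarrow> w x < s"
    and \<Sigma>s: "\<And>x0. x0 \<in> \<Sigma> \<Longrightarrow> \<forall>\<^sub>F x in nhds x0. x \<in> X \<longrightarrow> w x < s"
  shows "compact {x\<in>X. s \<le> w x}"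
  unfolding compact_eq_bounded_closed
proof
  have "{x\<in>X. s \<le> w x} \<subseteq> \<Omega>" unfolding X_def by blast
  then show "bounded {x\<in>X. s \<le> w x}" using \<Omega>(2) bounded_subset by blast
  show "closed {x\<in>X. s \<le> w x}"
    unfolding closed_def openE
  proof (subst open_subopen, intro ballI)
    fix x assume x: "x \<in> - {x\<in>X. s \<le> w x}"
    have "\<forall>\<^sub>F y in nhds x. y \<in> - {x\<in>X. s \<le> w x}"
    proof (cases "x \<in> closure \<Omega>")
      case False
      then have "\<forall>\<^sub>F y in nhds x. y \<in> - closure \<Omega>" by (intro eventually_nhds_in_open) auto
      then show ?thesis by (rule eventually_mono) (use closure_subset in \<open>auto simp: X_def\<close>)
    next
      case True
      then have "\<forall>\<^sub>F y in nhds x. y \<in> X \<longrightarrow> w y < s"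
      proof (cases "x \<in> \<Sigma> \<or> x \<in> frontier \<Omega>")
        case False
        then have "x \<in> X" using True closure_split by blast
        then have "w x < s" using x by auto
        then show ?thesis using w \<open>x \<in> X\<close> unfolding usc_real_nhds by blast
      qed (use s \<Sigma>s in blast)
      then show ?thesis by (rule eventually_mono) auto
    qed
    then show "\<exists>T. open T \<and> x \<in> T \<and> T \<subseteq> - {x\<in>X. s \<le> w x}" unfolding eventually_nhds by blast
  qed
qed

text \<open>The bounds by g only say that u + v is bounded near the singular set, but u + (1 - \<epsilon>) v is at most
  \<epsilon> g plus a constant and tends to -\<infinity> there.\<close>
lemma singular_comparison:
  assumes u: "viscosity_sub F X u" and v: "viscosity_sub (dual F) X v"
    and ug: "\<And>x. x \<in> X \<Longrightarrow> u x \<le> g x + C1" and vg: "\<And>x. x \<in> X \<Longrightarrow> v x \<le> - g x + C2"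
    and ub: "\<And>x0 e. x0 \<in> frontier \<Omega> \<Longrightarrow> 0 < e \<Longrightarrow> \<forall>\<^sub>F x in nhds x0. x \<in> X \<longrightarrow> u x < \<phi> x0 + e"
    and vb: "\<And>x0 e. x0 \<in> frontier \<Omega> \<Longrightarrow> 0 < e \<Longrightarrow> \<forall>\<^sub>F x in nhds x0. x \<in> X \<longrightarrow> v x < - \<phi> x0 + e"
    and m: "\<And>x0. x0 \<in> frontier \<Omega> \<Longrightarrow> \<phi> x0 \<le> m" and x: "x \<in> X"
  shows "u x + v x \<le> 0"
proof -
  \<comment> \<open>Shrinking v by the factor 1 - \<epsilon> raises its boundary bound - \<phi> by
    \<epsilon> * \<phi>, hence by at most \<epsilon> * m; the added constant takes this
    back.\<close>
  have key: "u x + ((1 - \<epsilon>) * v x + (- \<epsilon> * m)) \<le> 0" if e: "0 < \<epsilon>" "\<epsilon> < 1" for \<epsilon>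
  proof (rule viscosity_sub_dual_comparison[OF F X_open u _ _ x])
    show v': "viscosity_sub (dual F) X (\<lambda>x. (1 - \<epsilon>) * v x + (- \<epsilon> * m))"
      by (rule viscosity_sub_affine[OF v]) (use e cone_scale(3)[OF F] in auto)
    fix s :: real assume s: "0 < s"
    show "compact {x \<in> X. s \<le> u x + ((1 - \<epsilon>) * v x + (- \<epsilon> * m))}"
    proof (rule singular_level_compact)
      show "usc_real X (\<lambda>x. u x + ((1 - \<epsilon>) * v x + (- \<epsilon> * m)))"
        using u v' unfolding viscosity_sub_def by (intro usc_real_add[of X u "\<lambda>x. (1 - \<epsilon>) * v x + (- \<epsilon> * m)"]) blast+
      fix x0 assume x0: "x0 \<in> frontier \<Omega>"
      have "0 < s / 2" using s by simp
      from ub[OF x0 this] vb[OF x0 this]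
      show "\<forall>\<^sub>F x in nhds x0. x \<in> X \<longrightarrow> u x + ((1 - \<epsilon>) * v x + (- \<epsilon> * m)) < s"
      proof eventually_elim
        case (elim x)
        show ?case
        proof
          assume "x \<in> X"
          then have "u x < \<phi> x0 + s / 2" "v x < - \<phi> x0 + s / 2" using elim by auto
          then have "(1 - \<epsilon>) * v x \<le> (1 - \<epsilon>) * (- \<phi> x0 + s / 2)" using e by (intro mult_left_mono) auto
          also have "\<dots> = - \<phi> x0 + \<epsilon> * \<phi> x0 + s / 2 - \<epsilon> * s / 2" by (simp add: field_simps)
          also have "\<epsilon> * \<phi> x0 \<le> \<epsilon> * m" using e m[OF x0] by (intro mult_left_mono) auto
          finally have "(1 - \<epsilon>) * v x \<le> - \<phi> x0 + \<epsilon> * m + s / 2 - \<epsilon> * s / 2" by simp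
          moreover have "0 < \<epsilon> * s" using e s by simp
          ultimately show "u x + ((1 - \<epsilon>) * v x + (- \<epsilon> * m)) < s" using \<open>u x < \<phi> x0 + s / 2\<close> by simp
        qed
      qed
    next
      fix x0 assume "x0 \<in> \<Sigma>"
      from near_\<Sigma>[OF this, of "(s - C1 - (1 - \<epsilon>) * C2 + \<epsilon> * m) / \<epsilon>"]
      show "\<forall>\<^sub>F x in nhds x0. x \<in> X \<longrightarrow> u x + ((1 - \<epsilon>) * v x + (- \<epsilon> * m)) < s"
      proof (rule eventually_mono, intro impI)
        fix x assume "x \<in> X \<longrightarrow> g x < (s - C1 - (1 - \<epsilon>) * C2 + \<epsilon> * m) / \<epsilon>" and x: "x \<in> X"
        then have "\<epsilon> * g x < s - C1 - (1 - \<epsilon>) * C2 + \<epsilon> * m" using e by (simp add: less_divide_eq mult.commute)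
        moreover have "(1 - \<epsilon>) * v x \<le> (1 - \<epsilon>) * (- g x + C2)" using e vg[OF x] by (intro mult_left_mono) auto
        ultimately show "u x + ((1 - \<epsilon>) * v x + (- \<epsilon> * m)) < s" using ug[OF x] by (simp add: algebra_simps)
      qed
    qed
  qed
  have "u x + v x \<le> 0 + \<delta>" if \<delta>: "\<delta> > 0" for \<delta>
  proof -
    \<comment> \<open>The point x is now fixed, so the loss \<epsilon> * (v x + m) can be kept at
      most \<delta>.\<close>
    define \<epsilon> where "\<epsilon> = min (1/2) (\<delta> / (\<bar>v x + m\<bar> + 1))"
    have e: "0 < \<epsilon>" "\<epsilon> < 1" unfolding \<epsilon>_def using \<delta> by auto
    have "\<epsilon> * (v x + m) \<le> \<epsilon> * (\<bar>v x + m\<bar> + 1)" using e by (intro mult_left_mono) auto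
    also have "\<dots> \<le> (\<delta> / (\<bar>v x + m\<bar> + 1)) * (\<bar>v x + m\<bar> + 1)" unfolding \<epsilon>_def by (intro mult_right_mono) auto
    also have "\<dots> = \<delta>" by simp
    finally have "\<epsilon> * (v x + m) \<le> \<delta>" .
    then show ?thesis using key[OF e] by (simp add: algebra_simps)
  qed
  then show ?thesis by (rule field_le_epsilon)
qed

lemma boundary_limit:
  fixes H :: "real^'n \<Rightarrow> real"
  assumes "continuous_on (closure \<Omega> - \<Sigma>) H" "x0 \<in> frontier \<Omega>" "0 < e"
  shows "\<forall>\<^sub>F x in nhds x0. x \<in> X \<longrightarrow> \<bar>H x - H x0\<bar> < e"
proof -
  have "x0 \<in> closure \<Omega> - \<Sigma>" using assms(2) frontier_closure by blast
  then have "\<forall>\<^sub>F x in at x0 within (closure \<Omega> - \<Sigma>). dist (H x) (H x0) < e"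
    using assms(1,3) tendstoD unfolding continuous_on_def by blast
  then have "\<forall>\<^sub>F x in at x0 within X. dist (H x) (H x0) < e"
    using at_within_le_nhds by (meson X_closure at_le filter_leD)
  from limit_X[OF this assms(2)] show ?thesis by (simp add: dist_real_def)
qed

lemma frontier_bound:
  assumes "continuous_on (frontier \<Omega>) (\<phi> :: real^'n \<Rightarrow> real)"
  obtains m where "0 \<le> m" "\<And>x. x \<in> frontier \<Omega> \<Longrightarrow> \<bar>\<phi> x\<bar> \<le> m"
proof -
  have "bounded (\<phi> ` frontier \<Omega>)" using compact_continuous_image[OF assms compact_frontier_\<Omega>] compact_imp_bounded by blast
  then obtain m where "0 < m" "\<And>x. x \<in> frontier \<Omega> \<Longrightarrow> \<bar>\<phi> x\<bar> \<le> m" unfolding bounded_pos by auto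
  then show thesis using that[of m] by simp
qed

lemma uniqueness_le:
  assumes \<phi>: "continuous_on (frontier \<Omega>) \<phi>" and 1: "DP_solution F \<Omega> \<Sigma> h \<phi> H1" and 2: "DP_solution F \<Omega> \<Sigma> h \<phi> H2" and x: "x \<in> X"
  shows "H1 x \<le> H2 x"
proof -
  obtain m where m: "\<And>x. x \<in> frontier \<Omega> \<Longrightarrow> \<bar>\<phi> x\<bar> \<le> m" using frontier_bound[OF \<phi>] by blast
  have c: "continuous_on (closure \<Omega> - \<Sigma>) H1" "continuous_on (closure \<Omega> - \<Sigma>) H2"
    and b: "\<And>x. x \<in> frontier \<Omega> \<Longrightarrow> H1 x = \<phi> x" "\<And>x. x \<in> frontier \<Omega> \<Longrightarrow> H2 x = \<phi> x"
    and hh: "F_harmonic F X H1" "F_harmonic F X H2"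
    using 1 2 unfolding DP_solution_def X_def by auto
  obtain C1 where C1: "\<And>x. x \<in> X \<Longrightarrow> ereal (H1 x) \<le> h x + ereal C1" using 1 unfolding DP_solution_def X_def by auto
  obtain C2 where C2: "\<And>x. x \<in> X \<Longrightarrow> h x + ereal C2 \<le> ereal (H2 x)" using 2 unfolding DP_solution_def X_def by auto
  have "H1 x + (- H2 x) \<le> 0"
  proof (rule singular_comparison[where ?C1.0 = C1 and ?C2.0 = "- C2" and m = m and \<phi> = \<phi>, OF _ _ _ _ _ _ _ x])
    show "viscosity_sub F X H1" using hh(1) unfolding F_harmonic_def by (intro F_subharmonic_viscosity_sub) simp
    show "viscosity_sub (dual F) X (\<lambda>x. - H2 x)" using hh(2) unfolding F_harmonic_def by (intro F_subharmonic_viscosity_sub) simp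
    show "H1 x \<le> g x + C1" if "x \<in> X" for x using C1[OF that] h_eq that X_closure by auto
    show "- H2 x \<le> - g x + - C2" if "x \<in> X" for x using C2[OF that] h_eq that X_closure by auto
    show "\<forall>\<^sub>F x in nhds x0. x \<in> X \<longrightarrow> H1 x < \<phi> x0 + e" if "x0 \<in> frontier \<Omega>" "0 < e" for x0 e
      using boundary_limit[OF c(1) that] by (rule eventually_mono) (use b(1)[OF that(1)] in auto)
    show "\<forall>\<^sub>F x in nhds x0. x \<in> X \<longrightarrow> - H2 x < - \<phi> x0 + e" if "x0 \<in> frontier \<Omega>" "0 < e" for x0 e
      using boundary_limit[OF c(2) that] by (rule eventually_mono) (use b(2)[OF that(1)] in auto)
    show "\<phi> x0 \<le> m" if "x0 \<in> frontier \<Omega>" for x0 using m[OF that] by simp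
  qed
  then show ?thesis by simp
qed

lemma uniqueness:
  assumes "continuous_on (frontier \<Omega>) \<phi>" "DP_solution F \<Omega> \<Sigma> h \<phi> H1" "DP_solution F \<Omega> \<Sigma> h \<phi> H2" "x \<in> closure \<Omega> - \<Sigma>"
  shows "H1 x = H2 x"
  using assms(4) uniqueness_le[OF assms(1,2,3)] uniqueness_le[OF assms(1,3,2)] assms(2,3)
  unfolding closure_split DP_solution_def by (metis Un_iff antisym)

end

section \<open>Perron's method\<close>

text \<open>The strict inequality between \<phi> and g + C on the frontier leaves room below the
  upper obstacle for a barrier near each boundary point.\<close>

locale perron = singular_dirichlet F \<Omega> \<Sigma> h
  for F :: "(real^'n^'n) set" and \<Omega> \<Sigma> :: "(real^'n) set" and h :: "real^'n \<Rightarrow> ereal" +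
  fixes \<phi> :: "real^'n \<Rightarrow> real" and c C :: real
  assumes no_proj: "\<And>e::real^'n. norm e = 1 \<Longrightarrow> - proj_line e \<notin> F"
    and convex: "strictly_F_convex_boundary F \<Omega>"
    and \<phi>_cont: "continuous_on (frontier \<Omega>) \<phi>"
    and c_less: "\<And>x. x \<in> frontier \<Omega> \<Longrightarrow> g x + c < \<phi> x"
    and C_greater: "\<And>x. x \<in> frontier \<Omega> \<Longrightarrow> \<phi> x < g x + C"
    and cC: "c \<le> C"
begin

text \<open>The two obstacles keep the supremum finite and within bounded distance of g up to
  \<Sigma>, as \<open>singular_comparison\<close> requires. Boundary values are imposed from above
  only; the lower half is produced by barriers.\<close>

definition admissible :: "(real^'n \<Rightarrow> real) \<Rightarrow> bool" where
  "admissible u \<longleftrightarrow> viscosity_sub F X u \<and> (\<forall>x\<in>X. g x + c \<le> u x \<and> u x \<le> g x + C)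
     \<and> (\<forall>x0\<in>frontier \<Omega>. \<forall>e>0. \<forall>\<^sub>F x in nhds x0. x \<in> X \<longrightarrow> u x < \<phi> x0 + e)"

definition perron_sup :: "real^'n \<Rightarrow> real" where
  "perron_sup x = (SUP u\<in>Collect admissible. u x)"

lemma g_boundary:
  assumes "x0 \<in> frontier \<Omega>" "0 < e"
  shows "\<forall>\<^sub>F x in nhds x0. x \<in> X \<longrightarrow> \<bar>g x - g x0\<bar> < e"
  by (rule boundary_limit[OF g_cont assms])

lemma viscosity_sub_add_const: "viscosity_sub G X u \<Longrightarrow> viscosity_sub G X (\<lambda>x. u x + k)"
  using viscosity_sub_affine[of G X u 1 k] by simp

lemma admissible_g: "admissible (\<lambda>x. g x + c)"
  unfolding admissible_def
proof (intro conjI ballI allI impI)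
  show "viscosity_sub F X (\<lambda>x. g x + c)" by (rule viscosity_sub_add_const[OF g_sub])
  fix x0 and e :: real assume x0: "x0 \<in> frontier \<Omega>" and e: "0 < e"
  show "\<forall>\<^sub>F x in nhds x0. x \<in> X \<longrightarrow> g x + c < \<phi> x0 + e"
    using g_boundary[OF x0 e] by (rule eventually_mono) (use c_less[OF x0] in auto)
qed (use cC in auto)

lemma admissible_le:
  assumes "admissible u" "x \<in> X"
  shows "u x \<le> perron_sup x"
  unfolding perron_sup_def
proof (rule cSUP_upper)
  show "bdd_above ((\<lambda>u. u x) ` Collect admissible)"
    unfolding bdd_above_def using assms(2) unfolding admissible_def by (intro exI[of _ "g x + C"]) auto
qed (use assms in simp)

lemma perron_sup_le:
  assumes "\<And>u. admissible u \<Longrightarrow> u x \<le> s"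
  shows "perron_sup x \<le> s"
  unfolding perron_sup_def using assms admissible_g by (intro cSUP_least) auto

lemma perron_sup_less:
  assumes "s < perron_sup x"
  shows "\<exists>u. admissible u \<and> s < u x"
  using perron_sup_le[of x s] assms by force

lemma perron_sup_bounds: "x \<in> X \<Longrightarrow> g x + c \<le> perron_sup x" "x \<in> X \<Longrightarrow> perron_sup x \<le> g x + C"
  using admissible_le[OF admissible_g] perron_sup_le[of x "g x + C"] unfolding admissible_def by auto

text \<open>Collects in one radius what the lower and the upper barrier ask for.\<close>

lemma barrier_setup:
  assumes ld: "local_defining_function \<Omega> x0 U \<rho>" and x0: "x0 \<in> frontier \<Omega>" and e: "0 < e" and s: "0 \<le> s" and \<epsilon>: "0 < \<epsilon>"
  obtains \<eta> R \<beta> m where "0 < \<eta>" "0 < R" "continuous_on (cball x0 R) \<beta>" "\<beta> x0 = 0" "cball x0 R \<inter> \<Sigma> = {}"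
    "\<And>z. z \<in> closure \<Omega> \<Longrightarrow> z \<in> cball x0 R \<Longrightarrow> \<beta> z \<le> - \<eta> * (norm (z - x0))\<^sup>2"
    "\<And>y. y \<in> cball x0 R \<Longrightarrow> \<exists>g B. B \<in> Sym \<and> dist B (hess_at \<rho> x0 + s *\<^sub>R proj_line (grad_at \<rho> x0)) < e \<and> peano \<beta> y g B"
    "\<And>x. x \<in> X \<Longrightarrow> x \<in> cball x0 R \<Longrightarrow> \<bar>g x\<bar> \<le> m"
    "\<And>x. x \<in> X \<Longrightarrow> x \<in> cball x0 R \<Longrightarrow> \<phi> x0 < g x + C"
    "\<And>x1. x1 \<in> frontier \<Omega> \<Longrightarrow> x1 \<in> cball x0 R \<Longrightarrow> \<bar>\<phi> x1 - \<phi> x0\<bar> < \<epsilon>"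
proof -
  obtain \<eta> R0 \<beta> where \<eta>: "0 < \<eta>" and R0: "0 < R0" and cb: "continuous_on (cball x0 R0) \<beta>" and b0: "\<beta> x0 = 0"
    and neg: "\<forall>z\<in>closure \<Omega> \<inter> cball x0 R0. \<beta> z \<le> - \<eta> * (norm (z - x0))\<^sup>2"
    and pe: "\<forall>y\<in>cball x0 R0. \<exists>g B. B \<in> Sym \<and> dist B (hess_at \<rho> x0 + s *\<^sub>R proj_line (grad_at \<rho> x0)) < e \<and> peano \<beta> y g B"
    using defining_function_barrier[OF ld x0 \<Omega>(1) e s] by blast
  have x0n: "x0 \<in> - \<Sigma>" using x0 frontier_closure by blast
  have "\<forall>\<^sub>F x in nhds x0. x \<in> - \<Sigma>" using \<Sigma>(1) x0n by (intro eventually_nhds_in_open) (auto intro: compact_imp_closed)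
  moreover have "\<forall>\<^sub>F x in nhds x0. x \<in> X \<longrightarrow> \<phi> x0 < g x + C"
  proof -
    have "0 < g x0 + C - \<phi> x0" using C_greater[OF x0] by simp
    from g_boundary[OF x0 this] show ?thesis by (rule eventually_mono) auto
  qed
  moreover have "\<forall>\<^sub>F x in nhds x0. x \<in> X \<longrightarrow> \<bar>g x\<bar> \<le> \<bar>g x0\<bar> + 1"
    using g_boundary[OF x0 zero_less_one] by (rule eventually_mono) auto
  moreover have "\<forall>\<^sub>F x in nhds x0. x \<in> frontier \<Omega> \<longrightarrow> \<bar>\<phi> x - \<phi> x0\<bar> < \<epsilon>"
  proof -
    have "\<forall>\<^sub>F x in at x0 within frontier \<Omega>. dist (\<phi> x) (\<phi> x0) < \<epsilon>"
      using \<phi>_cont x0 \<epsilon> tendstoD unfolding continuous_on_def by blast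
    then show ?thesis unfolding eventually_at_filter by (rule eventually_mono) (use \<epsilon> in \<open>auto simp: dist_real_def\<close>)
  qed
  ultimately have "\<forall>\<^sub>F x in nhds x0. x \<notin> \<Sigma> \<and> (x \<in> X \<longrightarrow> \<phi> x0 < g x + C \<and> \<bar>g x\<bar> \<le> \<bar>g x0\<bar> + 1) \<and> (x \<in> frontier \<Omega> \<longrightarrow> \<bar>\<phi> x - \<phi> x0\<bar> < \<epsilon>)"
    by eventually_elim auto
  then obtain d where d: "d > 0" "\<And>x. dist x x0 < d \<Longrightarrow> x \<notin> \<Sigma> \<and> (x \<in> X \<longrightarrow> \<phi> x0 < g x + C \<and> \<bar>g x\<bar> \<le> \<bar>g x0\<bar> + 1) \<and> (x \<in> frontier \<Omega> \<longrightarrow> \<bar>\<phi> x - \<phi> x0\<bar> < \<epsilon>)"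
    unfolding eventually_nhds_metric by blast
  define R where "R = min R0 (d / 2)"
  have R: "R > 0" and RR: "cball x0 R \<subseteq> cball x0 R0" and Rd: "\<And>x. x \<in> cball x0 R \<Longrightarrow> dist x x0 < d"
    using R0 d(1) unfolding R_def by (auto simp: dist_commute)
  show thesis
  proof (rule that[OF \<eta> R continuous_on_subset[OF cb RR] b0, of "\<bar>g x0\<bar> + 1"])
    show "cball x0 R \<inter> \<Sigma> = {}" using Rd d(2) by blast
    show "\<beta> z \<le> - \<eta> * (norm (z - x0))\<^sup>2" if "z \<in> closure \<Omega>" "z \<in> cball x0 R" for z using neg that RR by blast
    show "\<exists>g B. B \<in> Sym \<and> dist B (hess_at \<rho> x0 + s *\<^sub>R proj_line (grad_at \<rho> x0)) < e \<and> peano \<beta> y g B" if "y \<in> cball x0 R" for y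
      using pe that RR by blast
  qed (use Rd d(2) in auto)
qed

text \<open>Strict convexity supplies s1 directly. For s2, the matrices - (H + t P) / t tend to - P,
  which lies outside the closed cone F, so for large t the negative Hessian is outside F together
  with a neighbourhood.\<close>

lemma barrier_matrices:
  assumes x0: "x0 \<in> frontier \<Omega>"
  obtains U \<rho> s1 e1 s2 e2 where "local_defining_function \<Omega> x0 U \<rho>" "0 \<le> s1" "0 < e1" "0 \<le> s2" "0 < e2"
    "\<And>B. B \<in> Sym \<Longrightarrow> dist B (hess_at \<rho> x0 + s1 *\<^sub>R proj_line (grad_at \<rho> x0)) < e1 \<Longrightarrow> B \<in> F"
    "\<And>B. B \<in> Sym \<Longrightarrow> dist B (hess_at \<rho> x0 + s2 *\<^sub>R proj_line (grad_at \<rho> x0)) < e2 \<Longrightarrow> - B \<notin> F"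
proof -
  obtain U \<rho> where ld: "local_defining_function \<Omega> x0 U \<rho>" 
    using convex x0 unfolding strictly_F_convex_boundary_def smooth_boundary_def by blast
  define G where "G = grad_at \<rho> x0"
  define H where "H = hess_at \<rho> x0"
  have G0: "G \<noteq> 0" using ld unfolding local_defining_function_def G_def by blast
  define P where "P = proj_line ((1 / norm G) *\<^sub>R G)"
  \<comment> \<open>The matrices of the unit normal and of the gradient differ by the squared norm
    of the gradient, which is absorbed into s1 and s2.\<close>
  have P: "t *\<^sub>R P = (t / (norm G)\<^sup>2) *\<^sub>R proj_line G" for t unfolding P_def proj_line_scaleR by (simp add: power_divide)
  obtain T where T: "\<And>t. T \<le> t \<Longrightarrow> H + t *\<^sub>R P \<in> IntF F"
    using convex x0 ld unfolding strictly_F_convex_boundary_def G_def H_def P_def by blast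
  define t1 where "t1 = max T 0"
  obtain e1 where e1: "e1 > 0" "\<And>B. B \<in> Sym \<Longrightarrow> dist B (H + t1 *\<^sub>R P) < e1 \<Longrightarrow> B \<in> F"
    using T[of t1] unfolding t1_def IntF_def by auto
  have "- P \<notin> F" unfolding P_def using G0 by (intro no_proj) simp
  moreover have clF: "closed F" using F unfolding cone_subequation_def by blast
  ultimately have "\<exists>e>0. ball (- P) e \<subseteq> - F" by (metis ComplI open_Compl open_contains_ball)
  then obtain d where d: "d > 0" "ball (- P) d \<subseteq> - F" by blast
  have d2: "B \<notin> F" if "dist B (- P) < d" for B using d(2) that by (auto simp: subset_iff dist_commute)
  \<comment> \<open>Large enough that \<open>norm H / t2 < d\<close>.\<close>
  define t2 where "t2 = norm H / d + 1"
  have t2: "t2 > 0" unfolding t2_def using d by (simp add: add_nonneg_pos)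
  have nM: "- (H + t2 *\<^sub>R P) \<notin> F"
  proof
    assume "- (H + t2 *\<^sub>R P) \<in> F"
    then have "(1 / t2) *\<^sub>R (- (H + t2 *\<^sub>R P)) \<in> F" using cone_scale(1)[OF F] t2 by simp
    moreover have "(1 / t2) *\<^sub>R (- (H + t2 *\<^sub>R P)) = - P - (1 / t2) *\<^sub>R H" using t2 by (simp add: scaleR_right_diff_distrib)
    moreover have "dist (- P - (1 / t2) *\<^sub>R H) (- P) < d"
    proof -
      have "norm H < d * t2" unfolding t2_def using d by (simp add: distrib_left)
      then show ?thesis using t2 by (simp add: dist_norm divide_less_eq)
    qed
    ultimately show False using d2 by metis
  qed
  then have "\<exists>e>0. ball (- (H + t2 *\<^sub>R P)) e \<subseteq> - F" using clF by (metis ComplI open_Compl open_contains_ball)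
  then obtain e2 where e2: "e2 > 0" "ball (- (H + t2 *\<^sub>R P)) e2 \<subseteq> - F" by blast
  have e22: "B \<notin> F" if "dist B (- (H + t2 *\<^sub>R P)) < e2" for B using e2(2) that by (auto simp: subset_iff dist_commute)
  show thesis
  proof (rule that[OF ld, of "t1 / (norm G)\<^sup>2" e1 "t2 / (norm G)\<^sup>2" e2])
    show "0 \<le> t1 / (norm G)\<^sup>2" "0 \<le> t2 / (norm G)\<^sup>2" using t2 unfolding t1_def by auto
    show "B \<in> F" if "B \<in> Sym" "dist B (hess_at \<rho> x0 + (t1 / (norm G)\<^sup>2) *\<^sub>R proj_line (grad_at \<rho> x0)) < e1" for B
      using e1(2) that unfolding P[symmetric] G_def[symmetric] H_def[symmetric] by blast
    show "- B \<notin> F" if "B \<in> Sym" "dist B (hess_at \<rho> x0 + (t2 / (norm G)\<^sup>2) *\<^sub>R proj_line (grad_at \<rho> x0)) < e2" for B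
    proof -
      have "dist (- B) (- (H + t2 *\<^sub>R P)) = dist B (H + t2 *\<^sub>R P)" unfolding dist_norm by (metis minus_diff_minus norm_minus_cancel)
      then show ?thesis using e22[of "- B"] that unfolding P[symmetric] G_def[symmetric] H_def[symmetric] by simp
    qed
  qed (use e1 e2 in auto)
qed

text \<open>Makes a barrier cross the obstacle on the whole shell beyond R / 2, leaving the inner
  ball for the actual argument.\<close>

lemma barrier_constant:
  fixes \<eta> R M :: real
  assumes "0 < \<eta>" "0 < R"
  obtains K where "0 < K" "\<And>r. R / 2 < r \<Longrightarrow> M \<le> K * (\<eta> * r\<^sup>2)"
proof -
  define K where "K = (\<bar>M\<bar> + 1) / (\<eta> * (R / 2)\<^sup>2)"
  have K: "0 < K" unfolding K_def using assms by simp
  have "M \<le> K * (\<eta> * r\<^sup>2)" if r: "R / 2 < r" for r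
  proof -
    have "(R / 2)\<^sup>2 \<le> r\<^sup>2" using r assms by (intro power_mono) auto
    then have "K * (\<eta> * (R / 2)\<^sup>2) \<le> K * (\<eta> * r\<^sup>2)" using K assms by (intro mult_left_mono) auto
    moreover have "K * (\<eta> * (R / 2)\<^sup>2) = \<bar>M\<bar> + 1" unfolding K_def using assms by simp
    ultimately show ?thesis by linarith
  qed
  with K show thesis by (rule that)
qed

lemma barrier_near_0:
  assumes "continuous_on (cball x0 R) \<beta>" "\<beta> x0 = 0" "0 < R" "0 < (K::real)" "0 < \<epsilon>"
  shows "\<forall>\<^sub>F x in nhds x0. x \<in> ball x0 R \<and> - \<epsilon> < K * \<beta> x"
proof -
  have "continuous_on (ball x0 R) (\<lambda>x. - (K * \<beta> x))"
    by (intro continuous_intros continuous_on_subset[OF assms(1)]) auto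
  then have "\<forall>\<^sub>F x in nhds x0. x \<in> ball x0 R \<longrightarrow> - (K * \<beta> x) < \<epsilon>"
    using usc_real_continuous assms(2,3,5) unfolding usc_real_nhds by fastforce
  moreover have "\<forall>\<^sub>F x in nhds x0. x \<in> ball x0 R" using assms(3) by (intro eventually_nhds_in_open) auto
  ultimately show ?thesis by eventually_elim auto
qed

text \<open>The maximum of g + c and a barrier based at \<phi> x0 - \<epsilon> is admissible, since
  K makes the barrier sink below g + c beyond R / 2. The Perron function lies above it, and the
  barrier is continuous at x0.\<close>

lemma perron_boundary_lower:
  assumes x0: "x0 \<in> frontier \<Omega>" and \<epsilon>: "0 < \<epsilon>"
  shows "\<forall>\<^sub>F x in nhds x0. x \<in> X \<longrightarrow> \<phi> x0 - 2 * \<epsilon> < perron_sup x"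
proof -
  obtain U \<rho> s e where ld: "local_defining_function \<Omega> x0 U \<rho>" and s: "0 \<le> s" "0 < e"
    and BF: "\<And>B. B \<in> Sym \<Longrightarrow> dist B (hess_at \<rho> x0 + s *\<^sub>R proj_line (grad_at \<rho> x0)) < e \<Longrightarrow> B \<in> F"
    using barrier_matrices[OF x0] by metis
  obtain \<eta> R \<beta> m where \<eta>: "0 < \<eta>" and R: "0 < R" and cb: "continuous_on (cball x0 R) \<beta>" and b0: "\<beta> x0 = 0"
    and "cball x0 R \<inter> \<Sigma> = {}"
    and neg: "\<And>z. z \<in> closure \<Omega> \<Longrightarrow> z \<in> cball x0 R \<Longrightarrow> \<beta> z \<le> - \<eta> * (norm (z - x0))\<^sup>2"
    and pe: "\<And>y. y \<in> cball x0 R \<Longrightarrow> \<exists>g B. B \<in> Sym \<and> dist B (hess_at \<rho> x0 + s *\<^sub>R proj_line (grad_at \<rho> x0)) < e \<and> peano \<beta> y g B"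
    and gm: "\<And>x. x \<in> X \<Longrightarrow> x \<in> cball x0 R \<Longrightarrow> \<bar>g x\<bar> \<le> m"
    and gC: "\<And>x. x \<in> X \<Longrightarrow> x \<in> cball x0 R \<Longrightarrow> \<phi> x0 < g x + C"
    and ph: "\<And>x1. x1 \<in> frontier \<Omega> \<Longrightarrow> x1 \<in> cball x0 R \<Longrightarrow> \<bar>\<phi> x1 - \<phi> x0\<bar> < \<epsilon>"
    by (rule barrier_setup[OF ld x0 s(2,1) \<epsilon>], rule that)
  obtain K where K: "0 < K" and KR: "\<And>r. R / 2 < r \<Longrightarrow> \<phi> x0 - \<epsilon> - c + m \<le> K * (\<eta> * r\<^sup>2)"
    using barrier_constant[OF \<eta> R] by metis
  define w where "w z = (\<phi> x0 - \<epsilon>) + K * \<beta> z" for z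
  define D where "D = X \<inter> ball x0 R"
  have oD: "open D" "D \<subseteq> X" unfolding D_def using X_open by auto
  have Dcl: "z \<in> closure \<Omega>" "z \<in> cball x0 R" "z \<in> X" if "z \<in> D" for z using that X_closure unfolding D_def by auto
  have wle: "w z \<le> (\<phi> x0 - \<epsilon>) - K * (\<eta> * (norm (z - x0))\<^sup>2)" if "z \<in> D" for z
  proof -
    have "K * \<beta> z \<le> K * (- \<eta> * (norm (z - x0))\<^sup>2)" using neg Dcl[OF that] K by (intro mult_left_mono) auto
    then show ?thesis unfolding w_def by simp
  qed
  have w1: "w z \<le> \<phi> x0 - \<epsilon>" if "z \<in> D" for z
  proof -
    have "0 \<le> K * (\<eta> * (norm (z - x0))\<^sup>2)" using K \<eta> by simp
    then show ?thesis using wle[OF that] by linarith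
  qed
  have w2: "w z \<le> g z + c" if "z \<in> D" "z \<notin> cball x0 (R / 2)" for z
  proof -
    have "R / 2 < norm (z - x0)" using that(2) by (simp add: dist_norm norm_minus_commute)
    from KR[OF this] wle[OF that(1)] gm[OF Dcl(3,2)[OF that(1)]] show ?thesis by linarith
  qed
  have "continuous_on D w" unfolding w_def D_def
    by (intro continuous_intros continuous_on_subset[OF cb]) auto
  moreover have "\<exists>g B. B \<in> F \<and> peano w y g B" if yD: "y \<in> D" for y
  proof -
    obtain g' B where "B \<in> Sym" "dist B (hess_at \<rho> x0 + s *\<^sub>R proj_line (grad_at \<rho> x0)) < e" "peano \<beta> y g' B"
      using pe Dcl[OF yD] by blast
    then show ?thesis using BF cone_scale(1)[OF F K] peano_affine[of \<beta> y g' B "\<phi> x0 - \<epsilon>" K] unfolding w_def by blast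
  qed
  ultimately have vw: "viscosity_sub F D w" by (rule viscosity_sub_of_peano[OF subF])
  define u where "u z = (if z \<in> D then max (g z + c) (w z) else g z + c)" for z
  have "admissible u"
    unfolding admissible_def
  proof (intro conjI ballI allI impI)
    show "viscosity_sub F X u" unfolding u_def
      by (rule viscosity_sub_max_glue[OF X_open oD, of "cball x0 (R / 2)"])
         (use R w2 vw viscosity_sub_add_const[OF g_sub] in \<open>auto simp: D_def\<close>)
    show "g x + c \<le> u x" if "x \<in> X" for x unfolding u_def by auto
    show "u x \<le> g x + C" if "x \<in> X" for x
      unfolding u_def using w1[of x] gC[of x] Dcl[of x] \<epsilon> cC by fastforce
    fix x1 and e1 :: real assume x1: "x1 \<in> frontier \<Omega>" and e1: "0 < e1"
    have ge: "\<forall>\<^sub>F x in nhds x1. x \<in> X \<longrightarrow> g x + c < \<phi> x1 + e1"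
      using admissible_g x1 e1 unfolding admissible_def by blast
    show "\<forall>\<^sub>F x in nhds x1. x \<in> X \<longrightarrow> u x < \<phi> x1 + e1"
    proof (cases "x1 \<in> cball x0 R")
      case True
      \<comment> \<open>In this ball the barrier is at most \<phi> x0 - \<epsilon>, and \<phi> x1
        exceeds that.\<close>
      from ge show ?thesis by (rule eventually_mono) (use w1 ph[OF x1 True] e1 in \<open>fastforce simp: u_def\<close>)
    next
      case False
      then have "\<forall>\<^sub>F x in nhds x1. x \<in> - cball x0 R" by (intro eventually_nhds_in_open) auto
      with ge show ?thesis by eventually_elim (auto simp: u_def D_def)
    qed
  qed
  from admissible_le[OF this] have ge: "w x \<le> perron_sup x" if "x \<in> D" for x
    using that oD(2) unfolding u_def by fastforce
  from barrier_near_0[OF cb b0 R K \<epsilon>] show ?thesis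
    by (rule eventually_mono) (use ge in \<open>fastforce simp: D_def w_def\<close>)
qed

text \<open>The reversed barrier has its Hessian outside F, so u - w has no local maximum for an
  admissible u. On the shell beyond R / 2 the obstacle g + C keeps u below w, and near the frontier
  the boundary bound does.\<close>

lemma perron_boundary_upper:
  assumes x0: "x0 \<in> frontier \<Omega>" and \<epsilon>: "0 < \<epsilon>"
  shows "\<forall>\<^sub>F x in nhds x0. x \<in> X \<longrightarrow> perron_sup x \<le> \<phi> x0 + 2 * \<epsilon>"
proof -
  obtain U \<rho> s e where ld: "local_defining_function \<Omega> x0 U \<rho>" and s: "0 \<le> s" "0 < e"
    and BF: "\<And>B. B \<in> Sym \<Longrightarrow> dist B (hess_at \<rho> x0 + s *\<^sub>R proj_line (grad_at \<rho> x0)) < e \<Longrightarrow> - B \<notin> F"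
    using barrier_matrices[OF x0] by metis
  obtain \<eta> R \<beta> m where \<eta>: "0 < \<eta>" and R: "0 < R" and cb: "continuous_on (cball x0 R) \<beta>" and b0: "\<beta> x0 = 0"
    and mS: "cball x0 R \<inter> \<Sigma> = {}"
    and neg: "\<And>z. z \<in> closure \<Omega> \<Longrightarrow> z \<in> cball x0 R \<Longrightarrow> \<beta> z \<le> - \<eta> * (norm (z - x0))\<^sup>2"
    and pe: "\<And>y. y \<in> cball x0 R \<Longrightarrow> \<exists>g B. B \<in> Sym \<and> dist B (hess_at \<rho> x0 + s *\<^sub>R proj_line (grad_at \<rho> x0)) < e \<and> peano \<beta> y g B"
    and gm: "\<And>x. x \<in> X \<Longrightarrow> x \<in> cball x0 R \<Longrightarrow> \<bar>g x\<bar> \<le> m"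
    and "\<And>x. x \<in> X \<Longrightarrow> x \<in> cball x0 R \<Longrightarrow> \<phi> x0 < g x + C"
    and ph: "\<And>x1. x1 \<in> frontier \<Omega> \<Longrightarrow> x1 \<in> cball x0 R \<Longrightarrow> \<bar>\<phi> x1 - \<phi> x0\<bar> < \<epsilon>"
    by (rule barrier_setup[OF ld x0 s(2,1) \<epsilon>], rule that)
  obtain K where K: "0 < K" and KR: "\<And>r. R / 2 < r \<Longrightarrow> m + C - \<phi> x0 - \<epsilon> \<le> K * (\<eta> * r\<^sup>2)"
    using barrier_constant[OF \<eta> R] by metis
  define w where "w z = (\<phi> x0 + \<epsilon>) + (- K) * \<beta> z" for z
  define D where "D = X \<inter> ball x0 R"
  have oD: "open D" "D \<subseteq> X" unfolding D_def using X_open by auto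
  have Dcl: "z \<in> closure \<Omega>" "z \<in> cball x0 R" "z \<in> X" if "z \<in> D" for z using that X_closure unfolding D_def by auto
  have wge: "(\<phi> x0 + \<epsilon>) + K * (\<eta> * (norm (z - x0))\<^sup>2) \<le> w z" if "z \<in> closure \<Omega>" "z \<in> cball x0 R" for z
  proof -
    have "K * \<beta> z \<le> K * (- \<eta> * (norm (z - x0))\<^sup>2)" using neg that K by (intro mult_left_mono) auto
    then show ?thesis unfolding w_def by simp
  qed
  have w1: "\<phi> x0 + \<epsilon> \<le> w z" if "z \<in> closure \<Omega>" "z \<in> cball x0 R" for z
  proof -
    have "0 \<le> K * (\<eta> * (norm (z - x0))\<^sup>2)" using K \<eta> by simp
    then show ?thesis using wge[OF that] by linarith
  qed
  have cw: "continuous_on (cball x0 R) w" unfolding w_def by (intro continuous_intros cb)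
  have main: "u x \<le> w x" if u: "admissible u" and x: "x \<in> D" for u x
  proof (rule ccontr)
    assume "\<not> u x \<le> w x"
    then have pos: "0 < u x - w x" by simp
    have vu: "viscosity_sub F X u" and ug: "\<And>x. x \<in> X \<Longrightarrow> u x \<le> g x + C"
      and ub: "\<And>x0 e. x0 \<in> frontier \<Omega> \<Longrightarrow> 0 < e \<Longrightarrow> \<forall>\<^sub>F x in nhds x0. x \<in> X \<longrightarrow> u x < \<phi> x0 + e"
      using u unfolding admissible_def by auto
    have out: "u z \<le> w z" if "z \<in> D" "z \<notin> cball x0 (R / 2)" for z
    proof -
      have "R / 2 < norm (z - x0)" using that(2) by (simp add: dist_norm norm_minus_commute)
      from KR[OF this] wge[OF Dcl(1,2)[OF that(1)]] gm[OF Dcl(3,2)[OF that(1)]] ug[OF Dcl(3)[OF that(1)]] show ?thesis by linarith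
    qed
    \<comment> \<open>This superlevel set is closed in the whole space, because u is below w near
      the frontier and the ball avoids \<Sigma>; hence u - w attains a positive maximum on
      it.\<close>
    define Z where "Z = {z \<in> X \<inter> cball x0 (R / 2). u x - w x \<le> u z - w z}"
    have sub: "cball x0 (R / 2) \<subseteq> cball x0 R" "cball x0 (R / 2) \<subseteq> ball x0 R" using R by auto
    have usc: "usc_real (X \<inter> cball x0 R) (\<lambda>z. u z + - w z)"
      using vu unfolding viscosity_sub_def
      by (intro usc_real_add[OF usc_real_subset[of X u] usc_real_continuous] continuous_on_minus continuous_on_subset[OF cw]) auto
    have "closed Z"
      unfolding closed_def
    proof (subst open_subopen, intro ballI)
      fix y assume y: "y \<in> - Z"
      have "\<forall>\<^sub>F z in nhds y. z \<in> - Z"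
      proof (cases "y \<in> cball x0 (R / 2) \<and> y \<in> closure \<Omega>")
        case False
        then have "y \<in> - (cball x0 (R / 2) \<inter> closure \<Omega>)" by blast
        then have "\<forall>\<^sub>F z in nhds y. z \<in> - (cball x0 (R / 2) \<inter> closure \<Omega>)"
          by (intro eventually_nhds_in_open) (auto intro: closed_Int)
        then show ?thesis by (rule eventually_mono) (use X_closure in \<open>auto simp: Z_def\<close>)
      next
        case True
        have yS: "y \<notin> \<Sigma>" using mS True sub by blast
        show ?thesis
        proof (cases "y \<in> X")
          case yX: True
          then have "u y + - w y < u x - w x" using y True unfolding Z_def by auto
          then have "\<forall>\<^sub>F z in nhds y. z \<in> X \<inter> cball x0 R \<longrightarrow> u z + - w z < u x - w x"
            using usc yX True sub unfolding usc_real_nhds by blast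
          then show ?thesis by (rule eventually_mono) (use sub in \<open>auto simp: Z_def\<close>)
        next
          case False
          then have yf: "y \<in> frontier \<Omega>" using True yS closure_split by blast
          have yR: "y \<in> cball x0 R" using True sub by blast
          \<comment> \<open>The oscillation bound on \<phi> makes this a usable margin at y: u falls
            below \<phi> x0 + \<epsilon> nearby, and w is at least that.\<close>
          have "0 < \<phi> x0 + \<epsilon> - \<phi> y" using ph[OF yf yR] by (simp add: abs_less_iff)
          from ub[OF yf this] show ?thesis
          proof (rule eventually_mono)
            fix z assume *: "z \<in> X \<longrightarrow> u z < \<phi> y + (\<phi> x0 + \<epsilon> - \<phi> y)"
            show "z \<in> - Z"
            proof
              assume z: "z \<in> Z"
              then have zX: "z \<in> X" "z \<in> cball x0 R" "z \<in> closure \<Omega>" using sub X_closure unfolding Z_def by auto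
              then have "u z < w z" using * w1 by fastforce
              then show False using z pos unfolding Z_def by auto
            qed
          qed
        qed
      qed
      then show "\<exists>T. open T \<and> y \<in> T \<and> T \<subseteq> - Z" unfolding eventually_nhds by blast
    qed
    moreover have "bounded Z" unfolding Z_def by (rule bounded_subset[OF bounded_cball[of x0 "R / 2"]]) auto
    ultimately have cZ: "compact Z" by (simp add: compact_eq_bounded_closed)
    have xZ: "x \<in> Z" using x out[of x] pos unfolding Z_def D_def by fastforce
    have ZX: "Z \<subseteq> X \<inter> cball x0 R" using sub unfolding Z_def by blast
    obtain z where z: "z \<in> Z" "\<And>y. y \<in> Z \<Longrightarrow> u y + - w y \<le> u z + - w z"
      using usc_real_attains_sup[OF cZ _ usc_real_subset[OF usc ZX]] xZ by blast
    have zD: "z \<in> D" using z(1) sub unfolding Z_def D_def by blast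
    have mx: "u y - w y \<le> u z - w z" if y: "y \<in> D" for y
    proof (cases "y \<in> Z")
      case False
      have zx: "u x - w x \<le> u z - w z" using z(1) unfolding Z_def by blast
      show ?thesis
      proof (cases "y \<in> cball x0 (R / 2)")
        case True
        then have "u y - w y < u x - w x" using y False unfolding Z_def D_def by auto
        then show ?thesis using zx by simp
      next
        case False
        then show ?thesis using out[OF y] zx pos by simp
      qed
    qed (use z(2) in auto)
    obtain g' B where B: "B \<in> Sym" "dist B (hess_at \<rho> x0 + s *\<^sub>R proj_line (grad_at \<rho> x0)) < e" "peano \<beta> z g' B"
      using pe Dcl[OF zD] by blast
    have "(- K) *\<^sub>R B \<in> F"
    proof (rule viscosity_sub_peano[OF subF vu])
      show "z \<in> X" using Dcl[OF zD] by blast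
      show "(- K) *\<^sub>R B \<in> Sym" using B by (intro Sym_scaleR)
      show "peano w z ((- K) *\<^sub>R g') ((- K) *\<^sub>R B)" unfolding w_def by (rule peano_affine[OF B(3)])
      have "\<forall>\<^sub>F y in nhds z. y \<in> D" by (rule eventually_nhds_in_open[OF oD(1) zD])
      then show "\<forall>\<^sub>F y in nhds z. u y - w y \<le> u z - w z" by (rule eventually_mono) (use mx in blast)
    qed
    from cone_scale(1)[OF F _ this, of "1 / K"] have "- B \<in> F" using K by simp
    then show False using BF B by blast
  qed
  have le: "perron_sup x \<le> w x" if "x \<in> D" for x using perron_sup_le main that by blast
  from barrier_near_0[OF cb b0 R K \<epsilon>] show ?thesis
    by (rule eventually_mono) (use le in \<open>fastforce simp: D_def w_def\<close>)
qed

end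

section \<open>Continuity and harmonicity of the Perron function\<close>

context perron
begin

definition perron_usc :: "real^'n \<Rightarrow> real" where
  "perron_usc = usc_envelope X perron_sup"

text \<open>Minus the lower semicontinuous envelope of \<open>perron_sup\<close>; in this form the
  dual condition is again subharmonicity of an upper semicontinuous function.\<close>

definition perron_lsc_neg :: "real^'n \<Rightarrow> real" where
  "perron_lsc_neg = usc_envelope X (\<lambda>x. - perron_sup x)"

lemma g_add_cont: "continuous_on X (\<lambda>x. g x + k)" "continuous_on X (\<lambda>x. - g x + k)"
  by (intro continuous_intros g_contX)+

lemma perron_usc_bounds:
  assumes "x \<in> X"
  shows "perron_sup x \<le> perron_usc x" "perron_usc x \<le> g x + C" "\<exists>s. \<forall>\<^sub>F y in nhds x. y \<in> X \<longrightarrow> perron_sup y \<le> s"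
proof -
  note b = usc_envelope_le_continuous[OF g_add_cont(1)[of C] perron_sup_bounds(2) assms]
  show "perron_usc x \<le> g x + C" "\<exists>s. \<forall>\<^sub>F y in nhds x. y \<in> X \<longrightarrow> perron_sup y \<le> s"
    using b unfolding perron_usc_def by auto
  then show "perron_sup x \<le> perron_usc x" unfolding perron_usc_def using usc_envelope_ge[OF assms] by blast
qed

lemma perron_lsc_neg_bounds:
  assumes "x \<in> X"
  shows "- perron_sup x \<le> perron_lsc_neg x" "perron_lsc_neg x \<le> - g x - c" "\<exists>s. \<forall>\<^sub>F y in nhds x. y \<in> X \<longrightarrow> - perron_sup y \<le> s"
proof -
  have "- perron_sup x \<le> - g x + - c" if "x \<in> X" for x using perron_sup_bounds(1)[OF that] by simp
  note b = usc_envelope_le_continuous[OF g_add_cont(2)[of "- c"] this assms]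
  show "perron_lsc_neg x \<le> - g x - c" "\<exists>s. \<forall>\<^sub>F y in nhds x. y \<in> X \<longrightarrow> - perron_sup y \<le> s"
    using b unfolding perron_lsc_neg_def by auto
  then show "- perron_sup x \<le> perron_lsc_neg x" unfolding perron_lsc_neg_def using usc_envelope_ge[OF assms, of "\<lambda>x. - perron_sup x"] by blast
qed

text \<open>Adding \<theta> to the matrix opens a gap on a sphere. One admissible u that almost
  attains the envelope at a point near y still peaks inside the sphere relative to Q, and the sphere
  form of the viscosity condition for u yields the matrix.\<close>

lemma perron_usc_sub: "viscosity_sub F X perron_usc"
  unfolding viscosity_sub_def
proof (intro conjI ballI allI impI)
  show "usc_real X perron_usc" unfolding perron_usc_def by (rule usc_envelope_usc) (rule perron_usc_bounds(3))
  fix y A q assume y: "y \<in> X" and A: "A \<in> Sym" and q: "quad_poly A q" "q y = perron_usc y" and ev: "\<forall>\<^sub>F z in nhds y. perron_usc z \<le> q z"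
  have "A + \<theta> *\<^sub>R mat 1 \<in> F" if \<theta>: "\<theta> > 0" for \<theta>
  proof -
    have "\<forall>\<^sub>F z in nhds y. z \<in> X" by (rule eventually_nhds_in_open[OF X_open y])
    with ev have "\<forall>\<^sub>F z in nhds y. perron_usc z \<le> q z \<and> z \<in> X" by eventually_elim auto
    then obtain d where d: "d > 0" "\<And>z. dist z y < d \<Longrightarrow> perron_usc z \<le> q z \<and> z \<in> X" unfolding eventually_nhds_metric by blast
    define r where "r = d / 2"
    have r: "r > 0" and rz: "\<And>z. z \<in> cball y r \<Longrightarrow> perron_usc z \<le> q z \<and> z \<in> X"
      using d unfolding r_def by (auto simp: dist_commute)
    obtain p where p: "\<And>z. q z = q y + p \<bullet> (z - y) + ((z - y) \<bullet> (A *v (z - y))) / 2" using quad_poly_centeredE[OF A q(1)] by blast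
    define Q where "Q z = q y + p \<bullet> (z - y) + ((z - y) \<bullet> ((A + \<theta> *\<^sub>R mat 1) *v (z - y))) / 2" for z
    have Q: "quad_poly (A + \<theta> *\<^sub>R mat 1) Q" unfolding Q_def[abs_def] by (rule quad_poly_centered)
    have Qq: "Q z = q z + \<theta> / 2 * (norm (z - y))\<^sup>2" for z
      using p[of z] unfolding Q_def quad_form_add_mat by (simp add: field_simps)
    \<comment> \<open>The gap on the sphere is 4 * \<delta>; taking u x near the envelope and Q x
      near Q y costs less than 2 * \<delta>.\<close>
    define \<delta> where "\<delta> = \<theta> * r\<^sup>2 / 8"
    have \<delta>: "\<delta> > 0" unfolding \<delta>_def using \<theta> r by simp
    have "usc_real UNIV Q" by (rule usc_real_continuous[OF quad_poly_continuous[OF Q]])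
    then have "\<forall>\<^sub>F z in nhds y. Q z < Q y + \<delta>" using \<delta> unfolding usc_real_nhds by auto
    moreover have "\<forall>\<^sub>F z in nhds y. z \<in> ball y r" using r by (intro eventually_nhds_in_open) auto
    ultimately have near: "\<forall>\<^sub>F z in nhds y. z \<in> ball y r \<and> Q z < Q y + \<delta>" by eventually_elim auto
    obtain x where x: "x \<in> X" "perron_usc y - \<delta> < perron_sup x" "x \<in> ball y r" "Q x < Q y + \<delta>"
    proof (rule ccontr)
      assume no: "\<not> thesis"
      have "\<forall>\<^sub>F z in nhds y. z \<in> X \<longrightarrow> perron_sup z \<le> perron_usc y - \<delta>"
        using near by (rule eventually_mono) (use that no in force)
      from usc_envelope_le[OF y this] show False using \<delta> unfolding perron_usc_def by simp
    qed
    obtain u where u: "admissible u" "perron_usc y - \<delta> < u x" using perron_sup_less[OF x(2)] by blast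
    have "touch_sphere F X u" using u(1) viscosity_sub_touch_sphere unfolding admissible_def by blast
    moreover have "cball y r \<subseteq> X" using rz by blast
    moreover have "\<forall>z\<in>sphere y r. u z - Q z < u x - Q x"
    proof
      fix z assume z: "z \<in> sphere y r"
      then have zc: "z \<in> cball y r" by auto
      have "u z \<le> q z" using admissible_le[OF u(1), of z] perron_usc_bounds(1)[of z] rz[OF zc] by linarith
      moreover have "Q z = q z + \<theta> / 2 * r\<^sup>2" using z unfolding Qq by (simp add: dist_norm norm_minus_commute)
      moreover have "Q y = perron_usc y" unfolding Qq using q(2) by simp
      moreover have "\<theta> / 2 * r\<^sup>2 = 4 * \<delta>" unfolding \<delta>_def by simp
      ultimately show "u z - Q z < u x - Q x" using u(2) x(4) \<delta> by linarith
    qed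
    moreover have "A + \<theta> *\<^sub>R mat 1 \<in> Sym" using A by (intro Sym_add Sym_scaleR Sym_mat)
    ultimately show ?thesis using Q x(3) unfolding touch_sphere_def by blast
  qed
  then show "A \<in> F" using subF A unfolding subeq_def by blast
qed

text \<open>The upper barrier gives a non-strict bound on a neighbourhood, which passes to the
  envelope. An admissible envelope lies below the supremum, so the two agree in
  \<open>perron_sup_eq\<close>.\<close>

lemma perron_admissible: "admissible perron_usc"
  unfolding admissible_def
proof (intro conjI ballI allI impI)
  show "viscosity_sub F X perron_usc" by (rule perron_usc_sub)
  show "g x + c \<le> perron_usc x" "perron_usc x \<le> g x + C" if "x \<in> X" for x
    using perron_usc_bounds[OF that] perron_sup_bounds[OF that] by linarith+
  fix x0 and e :: real assume x0: "x0 \<in> frontier \<Omega>" and e: "0 < e"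
  have "0 < e / 4" using e by simp
  from perron_boundary_upper[OF x0 this]
  have "\<forall>\<^sub>F x in nhds x0. \<forall>\<^sub>F z in nhds x. z \<in> X \<longrightarrow> perron_sup z \<le> \<phi> x0 + 2 * (e / 4)" by (simp add: eventually_eventually)
  then show "\<forall>\<^sub>F x in nhds x0. x \<in> X \<longrightarrow> perron_usc x < \<phi> x0 + e"
  proof (rule eventually_mono, intro impI)
    fix x assume *: "\<forall>\<^sub>F z in nhds x. z \<in> X \<longrightarrow> perron_sup z \<le> \<phi> x0 + 2 * (e / 4)" and x: "x \<in> X"
    from usc_envelope_le[OF x *] show "perron_usc x < \<phi> x0 + e" using e unfolding perron_usc_def by simp
  qed
qed

lemma perron_sup_eq: "x \<in> X \<Longrightarrow> perron_usc x = perron_sup x"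
  using admissible_le[OF perron_admissible] perron_usc_bounds(1) by (simp add: antisym)

lemma perron_sup_sub: "viscosity_sub F X perron_sup"
  by (rule viscosity_sub_cong[OF X_open _ perron_usc_sub]) (rule perron_sup_eq)

lemma perron_sup_upper: "x0 \<in> frontier \<Omega> \<Longrightarrow> 0 < e \<Longrightarrow> \<forall>\<^sub>F x in nhds x0. x \<in> X \<longrightarrow> perron_sup x < \<phi> x0 + e"
  using perron_admissible perron_sup_eq unfolding admissible_def by simp

text \<open>Where the lower envelope stays below the obstacle g + C, a failure of the dual inequality
  leaves room to bump the maximal function up; on the contact set the obstacle itself serves as a test.\<close>
lemma perron_lsc_dual: "viscosity_sub (dual F) X perron_lsc_neg"
  unfolding viscosity_sub_def
proof (intro conjI ballI allI impI)
  show "usc_real X perron_lsc_neg" unfolding perron_lsc_neg_def by (rule usc_envelope_usc) (rule perron_lsc_neg_bounds(3))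
  fix y A q assume y: "y \<in> X" and A: "A \<in> Sym" and q: "quad_poly A q" "q y = perron_lsc_neg y" and ev: "\<forall>\<^sub>F z in nhds y. perron_lsc_neg z \<le> q z"
  have evX: "\<forall>\<^sub>F z in nhds y. z \<in> X" by (rule eventually_nhds_in_open[OF X_open y])
  have lo: "- g x - C \<le> perron_lsc_neg x" if "x \<in> X" for x using perron_lsc_neg_bounds(1)[OF that] perron_sup_bounds(2)[OF that] by linarith
  show "A \<in> dual F"
  proof (rule ccontr)
    assume "A \<notin> dual F"
    then have "- A \<in> IntF F" using A unfolding dual_def by blast
    then obtain e where e: "e > 0" "\<And>B. B \<in> Sym \<Longrightarrow> dist B (- A) < e \<Longrightarrow> B \<in> F" unfolding IntF_def by blast
    have contact: "perron_lsc_neg y \<noteq> - g y - C"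
    proof
      assume eq: "perron_lsc_neg y = - g y - C"
      have "viscosity_sub (dual F) X (\<lambda>x. - g x + - C)" by (rule viscosity_sub_add_const[OF g_dual])
      moreover have "\<forall>\<^sub>F z in nhds y. - g z + - C \<le> q z" using ev evX by eventually_elim (use lo in fastforce)
      moreover have "q y = - g y + - C" using q(2) eq by simp
      ultimately show False using y A q(1) \<open>A \<notin> dual F\<close> unfolding viscosity_sub_def by blast
    qed
    \<comment> \<open>Half the gap to the obstacle, kept in reserve for the bump.\<close>
    define \<kappa> where "\<kappa> = (perron_lsc_neg y + g y + C) / 2"
    have \<kappa>: "\<kappa> > 0" unfolding \<kappa>_def using lo[OF y] contact by simp
    define m where "m = norm (mat 1 :: real^'n^'n) + 1"
    have m: "m > 0" unfolding m_def by (simp add: add_nonneg_pos)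
    define \<theta> where "\<theta> = e / (2 * m)"
    have \<theta>: "\<theta> > 0" unfolding \<theta>_def using e m by simp
    have AF: "- A - \<theta> *\<^sub>R mat 1 \<in> F"
    proof (rule e(2))
      show "- A - \<theta> *\<^sub>R mat 1 \<in> Sym" using A by (intro Sym_diff Sym_minus Sym_scaleR Sym_mat)
      have "dist (- A - \<theta> *\<^sub>R mat 1) (- A) = \<theta> * norm (mat 1 :: real^'n^'n)" using \<theta> by (simp add: dist_norm)
      also have "\<dots> \<le> \<theta> * m" using \<theta> unfolding m_def by simp
      also have "\<dots> = e / 2" unfolding \<theta>_def using m by simp
      also have "\<dots> < e" using e by simp
      finally show "dist (- A - \<theta> *\<^sub>R mat 1) (- A) < e" .
    qed
    have "usc_real X (\<lambda>z. - q z - g z)"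
      by (intro usc_real_continuous continuous_intros g_contX quad_poly_continuous[OF q(1)])
    moreover have "- q y - g y < C - \<kappa>" unfolding \<kappa>_def q(2) using \<kappa> unfolding \<kappa>_def by (simp add: field_simps)
    ultimately have "\<forall>\<^sub>F z in nhds y. z \<in> X \<longrightarrow> - q z - g z < C - \<kappa>" using y unfolding usc_real_nhds by blast
    with ev evX have "\<forall>\<^sub>F z in nhds y. perron_lsc_neg z \<le> q z \<and> z \<in> X \<and> - q z - g z < C - \<kappa>" by eventually_elim auto
    then obtain d where d: "d > 0" "\<And>z. dist z y < d \<Longrightarrow> perron_lsc_neg z \<le> q z \<and> z \<in> X \<and> - q z - g z < C - \<kappa>"
      unfolding eventually_nhds_metric by blast
    define r where "r = d / 2"
    have r: "r > 0" and rz: "\<And>z. z \<in> cball y r \<Longrightarrow> perron_lsc_neg z \<le> q z \<and> z \<in> X \<and> - q z - g z < C - \<kappa>"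
      using d unfolding r_def by (auto simp: dist_commute)
    \<comment> \<open>The bump must respect the obstacle, hence the bound \<kappa>, and must have
      sunk below \<open>perron_sup\<close> beyond r / 2, where the quadratic loss is at least
      \<theta> * \<open>r\<^sup>2\<close> / 8.\<close>
    define \<delta> where "\<delta> = min \<kappa> (\<theta> * r\<^sup>2 / 8)"
    have \<delta>: "\<delta> > 0" unfolding \<delta>_def using \<theta> r \<kappa> by simp
    obtain p where p: "\<And>z. q z = q y + p \<bullet> (z - y) + ((z - y) \<bullet> (A *v (z - y))) / 2" using quad_poly_centeredE[OF A q(1)] by blast
    define P where "P z = (- q y + \<delta>) + (- p) \<bullet> (z - y) + ((z - y) \<bullet> ((- A - \<theta> *\<^sub>R mat 1) *v (z - y))) / 2" for z
    have Pq: "quad_poly (- A - \<theta> *\<^sub>R mat 1) P" unfolding P_def[abs_def] by (rule quad_poly_centered)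
    have PP: "P z = - q z - \<theta> / 2 * (norm (z - y))\<^sup>2 + \<delta>" for z
    proof -
      have quad: "v \<bullet> ((- A - \<theta> *\<^sub>R mat 1) *v v) = - (v \<bullet> (A *v v)) - \<theta> * (norm v)\<^sup>2" for v
        by (simp add: matrix_vector_mult_diff_rdistrib matrix_vector_mult_minus matrix_scaleR_vector_mult inner_diff_right power2_norm_eq_inner)
      show ?thesis using p[of z] unfolding P_def quad[of "z - y"] by (simp add: field_simps)
    qed
    have symA: "- A - \<theta> *\<^sub>R mat 1 \<in> Sym" using A by (intro Sym_diff Sym_minus Sym_scaleR Sym_mat)
    have vP: "viscosity_sub F (ball y r) P"
      by (rule viscosity_sub_of_peano[OF subF quad_poly_continuous[OF Pq]]) (use AF quad_poly_peano[OF symA Pq] in blast)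
    have P_small: "P z \<le> perron_sup z" if z: "z \<in> ball y r" "z \<notin> cball y (r / 2)" for z
    proof -
      have "r / 2 \<le> norm (z - y)" using z(2) by (simp add: dist_norm norm_minus_commute)
      then have "(r / 2)\<^sup>2 \<le> (norm (z - y))\<^sup>2" using r by (intro power_mono) auto
      then have "\<theta> / 2 * (r / 2)\<^sup>2 \<le> \<theta> / 2 * (norm (z - y))\<^sup>2" using \<theta> by (intro mult_left_mono) auto
      moreover have "\<theta> / 2 * (r / 2)\<^sup>2 = \<theta> * r\<^sup>2 / 8" by (simp add: power2_eq_square)
      moreover have "- q z \<le> perron_sup z" using rz[of z] z(1) perron_lsc_neg_bounds(1)[of z] by auto
      ultimately show ?thesis unfolding PP \<delta>_def by linarith
    qed
    define u where "u z = (if z \<in> ball y r then max (perron_sup z) (P z) else perron_sup z)" for z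
    have "admissible u"
      unfolding admissible_def
    proof (intro conjI ballI allI impI)
      have sub: "ball y r \<subseteq> X" using rz by auto
      show "viscosity_sub F X u" unfolding u_def
        by (rule viscosity_sub_max_glue[OF X_open open_ball sub _ _ perron_sup_sub vP, of "cball y (r / 2)"])
           (use r P_small in auto)
      show "g x + c \<le> u x" if "x \<in> X" for x using perron_sup_bounds(1)[OF that] unfolding u_def by auto
      show "u x \<le> g x + C" if "x \<in> X" for x
      proof -
        have "P x \<le> g x + C" if "x \<in> ball y r"
        proof -
          have "0 \<le> \<theta> / 2 * (norm (x - y))\<^sup>2" using \<theta> by simp
          moreover have "- q x - g x < C - \<kappa>" using rz[of x] that by auto
          ultimately show ?thesis unfolding PP \<delta>_def by linarith
        qed
        then show ?thesis using perron_sup_bounds(2)[OF that] unfolding u_def by auto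
      qed
      fix x0 and e1 :: real assume x0: "x0 \<in> frontier \<Omega>" and e1: "0 < e1"
      have "x0 \<in> - cball y r" using rz x0 frontier_X by blast
      then have "\<forall>\<^sub>F x in nhds x0. x \<in> - cball y r" by (intro eventually_nhds_in_open) auto
      with perron_sup_upper[OF x0 e1] show "\<forall>\<^sub>F x in nhds x0. x \<in> X \<longrightarrow> u x < \<phi> x0 + e1"
        by eventually_elim (auto simp: u_def)
    qed
    from admissible_le[OF this] have PS: "P z \<le> perron_sup z" if "z \<in> ball y r" for z
      using that rz[of z] unfolding u_def by fastforce
    \<comment> \<open>The bump keeps \<open>perron_sup\<close> at or above - q y + \<delta> / 2 near
      y, against the value of the envelope at y.\<close>
    have "\<forall>\<^sub>F z in nhds y. z \<in> ball y r" using r by (intro eventually_nhds_in_open) auto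
    moreover have "\<forall>\<^sub>F z in nhds y. - P z < - P y + \<delta> / 2"
    proof -
      have "usc_real UNIV (\<lambda>z. - P z)" by (intro usc_real_continuous continuous_on_minus quad_poly_continuous[OF Pq])
      then show ?thesis using \<delta> unfolding usc_real_nhds by auto
    qed
    ultimately have "\<forall>\<^sub>F z in nhds y. z \<in> X \<longrightarrow> - perron_sup z \<le> - P y + \<delta> / 2"
      by eventually_elim (use PS in force)
    from usc_envelope_le[OF y this] have "perron_lsc_neg y \<le> - P y + \<delta> / 2" unfolding perron_lsc_neg_def .
    moreover have "- P y = perron_lsc_neg y - \<delta>" unfolding PP using q(2) by simp
    ultimately show False using \<delta> by simp
  qed
qed

lemma perron_lsc_upper:
  assumes x0: "x0 \<in> frontier \<Omega>" and e: "0 < e"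
  shows "\<forall>\<^sub>F x in nhds x0. x \<in> X \<longrightarrow> perron_lsc_neg x < - \<phi> x0 + e"
proof -
  have "0 < e / 4" using e by simp
  from perron_boundary_lower[OF x0 this]
  have "\<forall>\<^sub>F x in nhds x0. \<forall>\<^sub>F z in nhds x. z \<in> X \<longrightarrow> \<phi> x0 - 2 * (e / 4) < perron_sup z" by (simp add: eventually_eventually)
  then show ?thesis
  proof (rule eventually_mono, intro impI)
    fix x assume "\<forall>\<^sub>F z in nhds x. z \<in> X \<longrightarrow> \<phi> x0 - 2 * (e / 4) < perron_sup z" and x: "x \<in> X"
    then have "\<forall>\<^sub>F z in nhds x. z \<in> X \<longrightarrow> - perron_sup z \<le> - \<phi> x0 + e / 2" by (elim eventually_mono) auto
    from usc_envelope_le[OF x this] show "perron_lsc_neg x < - \<phi> x0 + e" using e unfolding perron_lsc_neg_def by simp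
  qed
qed

text \<open>Comparison of the Perron function with its own lower envelope: the boundary limits and
  the bounds by g hold for both, so they coincide, which gives continuity and the dual condition at
  once.\<close>

lemma perron_lsc_eq:
  assumes x: "x \<in> X"
  shows "perron_lsc_neg x = - perron_sup x"
proof -
  obtain m where m: "\<And>x. x \<in> frontier \<Omega> \<Longrightarrow> \<bar>\<phi> x\<bar> \<le> m" using frontier_bound[OF \<phi>_cont] by blast
  have "perron_sup x + perron_lsc_neg x \<le> 0"
  proof (rule singular_comparison[OF perron_sup_sub perron_lsc_dual _ _ perron_sup_upper perron_lsc_upper _ x])
    show "perron_sup x \<le> g x + C" if "x \<in> X" for x by (rule perron_sup_bounds(2)[OF that])
    show "perron_lsc_neg x \<le> - g x + - c" if "x \<in> X" for x using perron_lsc_neg_bounds(2)[OF that] by simp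
    show "\<phi> x0 \<le> m" if "x0 \<in> frontier \<Omega>" for x0 using m[OF that] by simp
  qed
  then show ?thesis using perron_lsc_neg_bounds(1)[OF x] by linarith
qed

definition perron_solution :: "real^'n \<Rightarrow> real" where
  "perron_solution x = (if x \<in> X then perron_sup x else \<phi> x)"

lemma perron_solution_sub: "viscosity_sub F X perron_solution"
  by (rule viscosity_sub_cong[OF X_open _ perron_sup_sub]) (simp add: perron_solution_def)

lemma perron_solution_dual: "viscosity_sub (dual F) X (\<lambda>x. - perron_solution x)"
  by (rule viscosity_sub_cong[OF X_open _ perron_lsc_dual]) (simp add: perron_solution_def perron_lsc_eq)

text \<open>Inside X the two semicontinuities combine; at the frontier the two boundary limits and
  the continuity of \<phi> do.\<close>

lemma perron_solution_near:
  assumes x: "x \<in> closure \<Omega> - \<Sigma>" and e: "0 < e"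
  shows "\<forall>\<^sub>F y in nhds x. y \<in> closure \<Omega> - \<Sigma> \<longrightarrow> \<bar>perron_solution y - perron_solution x\<bar> < e"
proof (cases "x \<in> X")
  case True
  have "perron_solution x < perron_solution x + e" "- perron_solution x < - perron_solution x + e" using e by auto
  then have "\<forall>\<^sub>F y in nhds x. y \<in> X \<longrightarrow> perron_solution y < perron_solution x + e"
    "\<forall>\<^sub>F y in nhds x. y \<in> X \<longrightarrow> - perron_solution y < - perron_solution x + e"
    using perron_solution_sub perron_solution_dual True unfolding viscosity_sub_def usc_real_nhds by blast+
  moreover have "\<forall>\<^sub>F y in nhds x. y \<in> X" by (rule eventually_nhds_in_open[OF X_open True])
  ultimately show ?thesis by eventually_elim auto
next
  case False
  then have xf: "x \<in> frontier \<Omega>" using x closure_split by blast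
  have sx: "perron_solution x = \<phi> x" using False by (simp add: perron_solution_def)
  have "\<forall>\<^sub>F y in at x within frontier \<Omega>. dist (\<phi> y) (\<phi> x) < e"
    using \<phi>_cont xf e tendstoD unfolding continuous_on_def by blast
  then have "\<forall>\<^sub>F y in nhds x. y \<in> frontier \<Omega> \<longrightarrow> \<bar>\<phi> y - \<phi> x\<bar> < e"
    unfolding eventually_at_filter by (rule eventually_mono) (use e in \<open>auto simp: dist_real_def\<close>)
  with perron_sup_upper[OF xf e] perron_lsc_upper[OF xf e]
  show ?thesis
  proof eventually_elim
    case (elim y)
    show ?case
    proof
      assume "y \<in> closure \<Omega> - \<Sigma>"
      then consider "y \<in> X" | "y \<in> frontier \<Omega>" "y \<notin> X" using closure_split frontier_X by blast
      then show "\<bar>perron_solution y - perron_solution x\<bar> < e"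
      proof cases
        case 1
        then show ?thesis using elim perron_lsc_eq[OF 1] unfolding sx by (auto simp: perron_solution_def abs_less_iff)
      next
        case 2
        then show ?thesis using elim unfolding sx by (auto simp: perron_solution_def)
      qed
    qed
  qed
qed

lemma perron_solution_DP: "DP_solution F \<Omega> \<Sigma> h \<phi> perron_solution"
  unfolding DP_solution_def
proof (intro conjI ballI)
  show c: "continuous_on (closure \<Omega> - \<Sigma>) perron_solution"
    unfolding continuous_on_def
  proof (intro ballI tendstoI)
    fix x and e :: real assume "x \<in> closure \<Omega> - \<Sigma>" "0 < e"
    from perron_solution_near[OF this]
    show "\<forall>\<^sub>F y in at x within closure \<Omega> - \<Sigma>. dist (perron_solution y) (perron_solution x) < e"
      unfolding eventually_at_filter by (rule eventually_mono) (auto simp: dist_real_def)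
  qed
  show "F_harmonic F (\<Omega> - \<Sigma>) perron_solution"
    unfolding F_harmonic_def X_def[symmetric]
    using continuous_on_subset[OF c X_closure] viscosity_sub_F_subharmonic[OF subF X_open perron_solution_sub]
      viscosity_sub_F_subharmonic[OF subD X_open perron_solution_dual] by blast
  show "perron_solution x = \<phi> x" if "x \<in> frontier \<Omega>" for x
    using that frontier_X unfolding perron_solution_def by auto
  have "h x + ereal c \<le> ereal (perron_solution x) \<and> ereal (perron_solution x) \<le> h x + ereal C" if x: "x \<in> X" for x
    using perron_sup_bounds[OF x] h_eq[of x] x X_closure unfolding perron_solution_def by auto
  then show "\<exists>c C. \<forall>x\<in>\<Omega> - \<Sigma>. h x + ereal c \<le> ereal (perron_solution x) \<and> ereal (perron_solution x) \<le> h x + ereal C"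
    unfolding X_def by blast
qed

end

context singular_dirichlet
begin

lemma existence:
  assumes e: "\<And>e::real^'n. norm e = 1 \<Longrightarrow> - proj_line e \<notin> F" and convex: "strictly_F_convex_boundary F \<Omega>"
    and \<phi>: "continuous_on (frontier \<Omega>) \<phi>"
  shows "\<exists>H. DP_solution F \<Omega> \<Sigma> h \<phi> H"
proof -
  have "continuous_on (frontier \<Omega>) (\<lambda>x. \<phi> x - g x)"
    by (intro continuous_intros \<phi> continuous_on_subset[OF g_cont frontier_closure])
  then obtain m where m: "0 \<le> m" "\<And>x. x \<in> frontier \<Omega> \<Longrightarrow> \<bar>\<phi> x - g x\<bar> \<le> m" using frontier_bound by blast
  \<comment> \<open>The bound m alone would give non-strict obstacles; adding 1 makes them
    strict.\<close>
  have "perron F \<Omega> \<Sigma> h \<phi> (- m - 1) (m + 1)"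
  proof (intro perron.intro singular_dirichlet_axioms perron_axioms.intro)
    show "g x + (- m - 1) < \<phi> x" "\<phi> x < g x + (m + 1)" if "x \<in> frontier \<Omega>" for x using m(2)[OF that] by linarith+
  qed (use e convex \<phi> m in auto)
  then show ?thesis using perron.perron_solution_DP by blast
qed

end

theorem theorem6p5:
  fixes F :: "(real^'n^'n) set" and \<Omega> \<Sigma> :: "(real^'n) set" and h :: "real^'n \<Rightarrow> ereal"
  assumes "cone_subequation F"
    and "\<forall>e::real^'n. norm e = 1 \<longrightarrow> - proj_line e \<notin> F"
    and "open \<Omega>" and "connected \<Omega>" and "\<Omega> \<noteq> {}" and "bounded \<Omega>"
    and "smooth_boundary \<Omega>"
    and "compact \<Sigma>" and "\<Sigma> \<subseteq> \<Omega>"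
    and "continuous_on (closure \<Omega>) h"
    and "\<forall>x\<in>closure \<Omega>. h x \<noteq> \<infinity>"
    and "\<Sigma> = {x \<in> closure \<Omega>. h x = - \<infinity>}"
    and "F_harmonic F (\<Omega> - \<Sigma>) (\<lambda>x. real_of_ereal (h x))"
  shows "(strictly_F_convex_boundary F \<Omega> \<longrightarrow>
            (\<forall>\<phi>. continuous_on (frontier \<Omega>) \<phi> \<longrightarrow> (\<exists>H. DP_solution F \<Omega> \<Sigma> h \<phi> H)))
       \<and> (\<forall>\<phi> H1 H2. continuous_on (frontier \<Omega>) \<phi> \<longrightarrow>
            DP_solution F \<Omega> \<Sigma> h \<phi> H1 \<longrightarrow> DP_solution F \<Omega> \<Sigma> h \<phi> H2 \<longrightarrow>
            (\<forall>x\<in>closure \<Omega> - \<Sigma>. H1 x = H2 x))"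
proof -
  interpret singular_dirichlet F \<Omega> \<Sigma> h
    using assms by unfold_locales auto
  show ?thesis using existence uniqueness assms(2) by blast
qed

end
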